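(* Let $\mathcal M=(M,<,\ldots)$ be a definably complete locally o-minimal structure having property (a) (the image of a nonempty definable discrete set under a coordinate projection is again discrete). Let $\{X_i\}_{i=1}^m$ be a finite family of definable subsets of $M^n$. Then there exists a decomposition $\{C_i\}_{i=1}^N$ of $M^n$ into quasi-special submanifolds partitioning $\{X_i\}_{i=1}^m$ with $N\le 2^{m+n}$.
   Context: "Definable" means definable in $\mathcal M$ with parameters. $M$ carries the order topology and $M^n$ the product topology ($M^0$ is a single point). An open interval is a set $(a,b)=\{x\in M\mid a<x<b\}$ with $a,b\in M$; an open box in $M^n$ is a product of $n$ open intervals. A coordinate projection $M^n\to M^d$ is a map $(x_1,\ldots,x_n)\mapsto(x_{i_1},\ldots,x_{i_d})$ with $1\le i_1<\cdots<i_d\le n$. A set is discrete if its subspace topology is discrete. A densely linearly ordered structure without endpoints $\mathcal M=(M,<,\ldots)$ is locally o-minimal if for every definable $X\subseteq M$ and every $a\in M$ there is an open interval $I$ containing $a$ such that $X\cap I$ is a finite union of points and open intervals. It is definably complete if every definable subset of $M$ has a supremum and an infimum in $M\cup\{\pm\infty\}$. Quasi-special submanifolds: let $X\subseteq M^n$ be definable and $\pi:M^n\to M^d$ a coordinate projection. $X$ is a $\pi$-quasi-special submanifold if $\pi(X)$ is a definable open set and, for every $x\in\pi(X)$, there exists an open box $U$ in $M^d$ containing $x$ such that for any $y\in X\cap\pi^{-1}(x)$ there exist an open box $V$ in $M^n$ with $y\in V$ and a definable continuous map $\tau:U\to M^n$ such that $\pi(V)=U$, $\tau(U)=X\cap V$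 and $\pi\circ\tau$ is the identity map on $U$. $X$ is a quasi-special submanifold if it is a $\pi$-quasi-special submanifold for some coordinate projection $\pi$ (for some $0\le d\le n$). A decomposition of $M^n$ into quasi-special submanifolds partitioning $\{X_i\}_{i=1}^m$ is a finite family $\{C_i\}_{i=1}^N$ of quasi-special submanifolds of $M^n$ such that $\bigcup_{i=1}^N C_i=M^n$, $C_i\cap C_j=\emptyset$ when $i\ne j$, and for all $1\le i\le N$ and $1\le j\le m$ either $C_i\cap X_j=\emptyset$ or $C_i\subseteq X_j$. *)

theory Defs
  imports "HOL-Analysis.Function_Topology" "HOL-Library.Extended" "HOL-Library.Lub_Glb"
begin

section \<open>First-order structures expanding an order, and definable sets\<close>

text \<open>
  The universe \<open>M\<close> is a type \<open>'a\<close>; its order is the one of the type class. The order and equality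
  are logical primitives of the formulas below. All the other function and relation symbols,
  with their arities and their interpretations, are given by a record. The
  interpretations matter only on argument lists of the right length.
\<close>

record ('a, 'f, 'r) fo_structure =
  fun_arity :: "'f \<Rightarrow> nat"
  rel_arity :: "'r \<Rightarrow> nat"
  fun_interp :: "'f \<Rightarrow> 'a list \<Rightarrow> 'a"
  rel_interp :: "'r \<Rightarrow> 'a list \<Rightarrow> bool"

datatype 'f fo_term = Var nat | App 'f "'f fo_term list"

datatype ('f, 'r) fo_formula =
    Eq "'f fo_term" "'f fo_term"
  | Less "'f fo_term" "'f fo_term"
  | Rel 'r "'f fo_term list"
  | Neg "('f, 'r) fo_formula"
  | Conj "('f, 'r) fo_formula" "('f, 'r) fo_formula"
  | Exi nat "('f, 'r) fo_formula"

fun wf_term :: "('a, 'f, 'r) fo_structure \<Rightarrow> 'f fo_term \<Rightarrow> bool" where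
  "wf_term \<M> (Var i) \<longleftrightarrow> True"
| "wf_term \<M> (App f ts) \<longleftrightarrow> length ts = fun_arity \<M> f \<and> (\<forall>t\<in>set ts. wf_term \<M> t)"

fun wf_formula :: "('a, 'f, 'r) fo_structure \<Rightarrow> ('f, 'r) fo_formula \<Rightarrow> bool" where
  "wf_formula \<M> (Eq s t) \<longleftrightarrow> wf_term \<M> s \<and> wf_term \<M> t"
| "wf_formula \<M> (Less s t) \<longleftrightarrow> wf_term \<M> s \<and> wf_term \<M> t"
| "wf_formula \<M> (Rel r ts) \<longleftrightarrow> length ts = rel_arity \<M> r \<and> (\<forall>t\<in>set ts. wf_term \<M> t)"
| "wf_formula \<M> (Neg \<phi>) \<longleftrightarrow> wf_formula \<M> \<phi>"
| "wf_formula \<M> (Conj \<phi> \<psi>) \<longleftrightarrow> wf_formula \<M> \<phi> \<and> wf_formula \<M> \<psi>"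
| "wf_formula \<M> (Exi i \<phi>) \<longleftrightarrow> wf_formula \<M> \<phi>"

fun term_val :: "('a, 'f, 'r) fo_structure \<Rightarrow> (nat \<Rightarrow> 'a) \<Rightarrow> 'f fo_term \<Rightarrow> 'a" where
  "term_val \<M> e (Var i) = e i"
| "term_val \<M> e (App f ts) = fun_interp \<M> f (map (term_val \<M> e) ts)"

fun satisfies ::
    "('a::linorder, 'f, 'r) fo_structure \<Rightarrow> (nat \<Rightarrow> 'a) \<Rightarrow> ('f, 'r) fo_formula \<Rightarrow> bool" where
  "satisfies \<M> e (Eq s t) \<longleftrightarrow> term_val \<M> e s = term_val \<M> e t"
| "satisfies \<M> e (Less s t) \<longleftrightarrow> term_val \<M> e s < term_val \<M> e t"
| "satisfies \<M> e (Rel r ts) \<longleftrightarrow> rel_interp \<M> r (map (term_val \<M> e) ts)"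
| "satisfies \<M> e (Neg \<phi>) \<longleftrightarrow> \<not> satisfies \<M> e \<phi>"
| "satisfies \<M> e (Conj \<phi> \<psi>) \<longleftrightarrow> satisfies \<M> e \<phi> \<and> satisfies \<M> e \<psi>"
| "satisfies \<M> e (Exi i \<phi>) \<longleftrightarrow> (\<exists>a. satisfies \<M> (e(i := a)) \<phi>)"

text \<open>
  \<open>M\<^sup>n\<close> consists of the extensional functions on \<open>{..<n}\<close>, which are the points of the library's
  product topology; coordinates are thus numbered from \<open>0\<close>. In particular \<open>M\<^sup>0\<close> is a single point.
\<close>

abbreviation cart_power :: "nat \<Rightarrow> (nat \<Rightarrow> 'a) set" where
  "cart_power n \<equiv> {..<n} \<rightarrow>\<^sub>E UNIV"

abbreviation power_topology :: "nat \<Rightarrow> (nat \<Rightarrow> 'a::topological_space) topology" where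
  "power_topology n \<equiv> product_topology (\<lambda>_. euclidean) {..<n}"

text \<open>
  The variables \<open>0, \<dots>, n - 1\<close> are the coordinates; the values \<open>p i\<close> with \<open>i \<ge> n\<close> of
  the other free variables (finitely many in each formula) are the parameters.
\<close>

definition definable ::
    "('a::linorder, 'f, 'r) fo_structure \<Rightarrow> nat \<Rightarrow> (nat \<Rightarrow> 'a) set \<Rightarrow> bool" where
  "definable \<M> n X \<longleftrightarrow>
     (\<exists>\<phi> p. wf_formula \<M> \<phi> \<and>
        X = {x \<in> cart_power n. satisfies \<M> (\<lambda>i. if i < n then x i else p i) \<phi>})"

definition definable_line :: "('a::linorder, 'f, 'r) fo_structure \<Rightarrow> 'a set \<Rightarrow> bool" where
  "definable_line \<M> S \<longleftrightarrow> definable \<M> 1 {x \<in> cart_power 1. x 0 \<in> S}"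

text \<open>A map from a subset of \<open>M\<^sup>d\<close> to \<open>M\<^sup>n\<close> is definable if its graph, a subset of \<open>M\<^sup>d\<^sup>+\<^sup>n\<close>, is.\<close>

definition concat_point :: "nat \<Rightarrow> nat \<Rightarrow> (nat \<Rightarrow> 'a) \<Rightarrow> (nat \<Rightarrow> 'a) \<Rightarrow> (nat \<Rightarrow> 'a)" where
  "concat_point d n x y = (\<lambda>i\<in>{..<d + n}. if i < d then x i else y (i - d))"

definition definable_map ::
    "('a::linorder, 'f, 'r) fo_structure \<Rightarrow> nat \<Rightarrow> nat \<Rightarrow> (nat \<Rightarrow> 'a) set
      \<Rightarrow> ((nat \<Rightarrow> 'a) \<Rightarrow> (nat \<Rightarrow> 'a)) \<Rightarrow> bool" where
  "definable_map \<M> d n U \<tau> \<longleftrightarrow>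
     U \<subseteq> cart_power d \<and> \<tau> ` U \<subseteq> cart_power n \<and>
     definable \<M> (d + n) ((\<lambda>x. concat_point d n x (\<tau> x)) ` U)"

section \<open>Boxes, coordinate projections, discrete sets\<close>

definition open_box :: "nat \<Rightarrow> (nat \<Rightarrow> 'a::linorder) set \<Rightarrow> bool" where
  "open_box n B \<longleftrightarrow> (\<exists>a b. B = (\<Pi>\<^sub>E i\<in>{..<n}. {a i<..<b i}))"

text \<open>
  \<open>\<sigma>\<close> lists the indices \<open>\<sigma> 0 < \<dots> < \<sigma> (d - 1)\<close>, all below \<open>n\<close>, of the
  coordinates kept by a projection from \<open>M\<^sup>n\<close> to \<open>M\<^sup>d\<close>; in particular \<open>d \<le> n\<close>.
\<close>

definition coord_selection :: "nat \<Rightarrow> nat \<Rightarrow> (nat \<Rightarrow> nat) \<Rightarrow> bool" where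
  "coord_selection n d \<sigma> \<longleftrightarrow> strict_mono_on {..<d} \<sigma> \<and> \<sigma> ` {..<d} \<subseteq> {..<n}"

definition coord_proj :: "nat \<Rightarrow> (nat \<Rightarrow> nat) \<Rightarrow> (nat \<Rightarrow> 'a) \<Rightarrow> (nat \<Rightarrow> 'a)" where
  "coord_proj d \<sigma> x = (\<lambda>k\<in>{..<d}. x (\<sigma> k))"

definition discrete_in_power :: "nat \<Rightarrow> (nat \<Rightarrow> 'a::topological_space) set \<Rightarrow> bool" where
  "discrete_in_power n X \<longleftrightarrow> subtopology (power_topology n) X = discrete_topology X"

section \<open>Conditions on the structure\<close>

definition locally_o_minimal ::
    "('a::unbounded_dense_linorder, 'f, 'r) fo_structure \<Rightarrow> bool" where
  "locally_o_minimal \<M> \<longleftrightarrow>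
     (\<forall>S a. definable_line \<M> S \<longrightarrow>
        (\<exists>b c. a \<in> {b<..<c} \<and>
           (\<exists>F P. finite F \<and> finite P \<and>
              S \<inter> {b<..<c} = F \<union> (\<Union>(u, v)\<in>P. {u<..<v}))))"

definition definably_complete ::
    "('a::unbounded_dense_linorder, 'f, 'r) fo_structure \<Rightarrow> bool" where
  "definably_complete \<M> \<longleftrightarrow>
     (\<forall>S. definable_line \<M> S \<longrightarrow>
        (\<exists>s :: 'a extended. isLub UNIV (Fin ` S) s) \<and>
        (\<exists>t :: 'a extended. isGlb UNIV (Fin ` S) t))"

definition property_a ::
    "('a::{unbounded_dense_linorder, linorder_topology}, 'f, 'r) fo_structure \<Rightarrow> bool" where
  "property_a \<M> \<longleftrightarrow>
     (\<forall>n d \<sigma> X. coord_selection n d \<sigma> \<and> X \<noteq> {} \<and> definable \<M> n X \<and> discrete_in_power n X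
        \<longrightarrow> discrete_in_power d (coord_proj d \<sigma> ` X))"

section \<open>Quasi-special submanifolds and decompositions\<close>

definition proj_quasi_special ::
    "('a::{unbounded_dense_linorder, linorder_topology}, 'f, 'r) fo_structure
      \<Rightarrow> nat \<Rightarrow> nat \<Rightarrow> (nat \<Rightarrow> nat) \<Rightarrow> (nat \<Rightarrow> 'a) set \<Rightarrow> bool" where
  "proj_quasi_special \<M> n d \<sigma> X \<longleftrightarrow>
     definable \<M> n X \<and>
     definable \<M> d (coord_proj d \<sigma> ` X) \<and>
     openin (power_topology d) (coord_proj d \<sigma> ` X) \<and>
     (\<forall>x \<in> coord_proj d \<sigma> ` X.
        \<exists>U. open_box d U \<and> x \<in> U \<and>
          (\<forall>y \<in> X. coord_proj d \<sigma> y = x \<longrightarrow>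
             (\<exists>V \<tau>. open_box n V \<and> y \<in> V \<and>
                definable_map \<M> d n U \<tau> \<and>
                continuous_map (subtopology (power_topology d) U) (power_topology n) \<tau> \<and>
                coord_proj d \<sigma> ` V = U \<and>
                \<tau> ` U = X \<inter> V \<and>
                (\<forall>u \<in> U. coord_proj d \<sigma> (\<tau> u) = u))))"

definition quasi_special ::
    "('a::{unbounded_dense_linorder, linorder_topology}, 'f, 'r) fo_structure
      \<Rightarrow> nat \<Rightarrow> (nat \<Rightarrow> 'a) set \<Rightarrow> bool" where
  "quasi_special \<M> n X \<longleftrightarrow>
     (\<exists>d \<sigma>. coord_selection n d \<sigma> \<and> proj_quasi_special \<M> n d \<sigma> X)"

definition quasi_special_decomposition ::
    "('a::{unbounded_dense_linorder, linorder_topology}, 'f, 'r) fo_structure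
      \<Rightarrow> nat \<Rightarrow> nat \<Rightarrow> (nat \<Rightarrow> (nat \<Rightarrow> 'a) set) \<Rightarrow> nat \<Rightarrow> (nat \<Rightarrow> (nat \<Rightarrow> 'a) set) \<Rightarrow> bool" where
  "quasi_special_decomposition \<M> n m X N C \<longleftrightarrow>
     (\<forall>i\<in>{1..N}. quasi_special \<M> n (C i)) \<and>
     (\<Union>i\<in>{1..N}. C i) = cart_power n \<and>
     (\<forall>i\<in>{1..N}. \<forall>j\<in>{1..N}. i \<noteq> j \<longrightarrow> C i \<inter> C j = {}) \<and>
     (\<forall>i\<in>{1..N}. \<forall>j\<in>{1..m}. C i \<inter> X j = {} \<or> C i \<subseteq> X j)"

end

theory Submission
  imports Defs
begin

text \<open>
  Fix a coordinate projection \<open>\<pi>\<close>, given by the set \<open>I\<close> of kept coordinates, and a definable set \<open>X\<close> none of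
  whose projections to one more coordinate has interior. Call a point of \<open>X\<close> normal if near it \<open>X\<close> is the
  graph of a continuous map on an open box of the \<open>I\<close>-coordinates. The points over the interior of the set
  of those base points all of whose fibre is normal form a quasi-special submanifold, and the projection of
  the rest has empty interior. Doing this once for each of the \<open>2\<^sup>n\<close> sets \<open>I\<close>, larger sets first, exhausts \<open>X\<close>;
  this is applied to the \<open>2\<^sup>m\<close> atoms of the given family.

  Genericity of normal fibres needs neither definable choice nor generic continuity, only the following: if
  for each \<open>x\<close> in a box a condition holds for all \<open>t\<close> in some interval depending on \<open>x\<close>, then on a smaller box it
  holds for one constant \<open>t\<close>. By induction on the dimension this reduces to the plane, where it follows from
  an analysis of one-sided germs in the style of the monotonicity theorem. Property (a) enters there, and
  once more to find one base box for all points of a fibre.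
\<close>

section \<open>Definable predicates\<close>


text \<open>Fibres may be infinite: at best they are discrete, so neither a minimum over a fibre nor
  a uniform bound on its size is at hand, and a common base box has to come from the discreteness of
  all thresholds taken together. The planar lemma goes by contradiction. If no value works on a
  subinterval, take in each set of good values, made open, the first component beyond a fixed
  \<open>c\<close>. These convex sets leave every value, upwards or downwards, on each side of each
  point. After shrinking, the direction is constant over an interval, separately to the left and to
  the right. Up to reversing the order of values two patterns remain. A family that falls away from
  every point on both sides would have jumps in opposite directions at one point. A monotone family
  consists of disjoint sets whose end points form a discrete graph over an interval, and only this
  is what property (a) excludes in the plane. The bound counts pairs of an atom, given by a subset
  of the \<open>m\<close> indices, and a set \<open>I\<close> of coordinates; pieces may be
  empty.\<close>

fun term_vars :: "'f fo_term \<Rightarrow> nat set" where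
  "term_vars (Var i) = {i}"
| "term_vars (App f ts) = (\<Union>t\<in>set ts. term_vars t)"

fun formula_vars :: "('f, 'r) fo_formula \<Rightarrow> nat set" where
  "formula_vars (Eq s t) = term_vars s \<union> term_vars t"
| "formula_vars (Less s t) = term_vars s \<union> term_vars t"
| "formula_vars (Rel r ts) = (\<Union>t\<in>set ts. term_vars t)"
| "formula_vars (Neg \<phi>) = formula_vars \<phi>"
| "formula_vars (Conj \<phi> \<psi>) = formula_vars \<phi> \<union> formula_vars \<psi>"
| "formula_vars (Exi i \<phi>) = insert i (formula_vars \<phi>)"

lemma finite_term_vars [simp]: "finite (term_vars t)"
  by (induction t) auto

lemma finite_formula_vars [simp]: "finite (formula_vars \<phi>)"
  by (induction \<phi>) auto

lemma term_val_cong: "(\<And>v. v \<in> term_vars t \<Longrightarrow> e v = e' v) \<Longrightarrow> term_val \<M> e t = term_val \<M> e' t"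
proof (induction t)
  case (App f ts)
  then have "map (term_val \<M> e) ts = map (term_val \<M> e') ts"
    by auto
  then show ?case by (metis term_val.simps(2))
qed auto

lemma satisfies_cong:
  "(\<And>v. v \<in> formula_vars \<phi> \<Longrightarrow> e v = e' v) \<Longrightarrow> satisfies \<M> e \<phi> \<longleftrightarrow> satisfies \<M> e' \<phi>"
proof (induction \<phi> arbitrary: e e')
  case (Eq s t)
  then show ?case using term_val_cong[of s e e' \<M>] term_val_cong[of t e e' \<M>] by simp
next
  case (Less s t)
  then show ?case using term_val_cong[of s e e' \<M>] term_val_cong[of t e e' \<M>] by simp
next
  case (Rel r ts)
  then have "map (term_val \<M> e) ts = map (term_val \<M> e') ts"
    by (auto intro!: term_val_cong)
  then show ?case by (metis satisfies.simps(3))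
next
  case (Neg \<phi>)
  then show ?case by (metis satisfies.simps(4) formula_vars.simps(4))
next
  case (Conj \<phi> \<psi>)
  then show ?case by (metis satisfies.simps(5) formula_vars.simps(5) UnCI)
next
  case (Exi i \<phi>)
  then have "satisfies \<M> (e(i := a)) \<phi> \<longleftrightarrow> satisfies \<M> (e'(i := a)) \<phi>" for a
    by (intro Exi.IH) auto
  then show ?case by simp
qed

section \<open>Renaming of variables\<close>

fun rename_term :: "(nat \<Rightarrow> nat) \<Rightarrow> 'f fo_term \<Rightarrow> 'f fo_term" where
  "rename_term \<rho> (Var i) = Var (\<rho> i)"
| "rename_term \<rho> (App f ts) = App f (map (rename_term \<rho>) ts)"

text \<open>The renaming need not be injective, so bound variables are replaced by fresh ones.\<close>

fun rename :: "(nat \<Rightarrow> nat) \<Rightarrow> ('f, 'r) fo_formula \<Rightarrow> ('f, 'r) fo_formula" where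
  "rename \<rho> (Eq s t) = Eq (rename_term \<rho> s) (rename_term \<rho> t)"
| "rename \<rho> (Less s t) = Less (rename_term \<rho> s) (rename_term \<rho> t)"
| "rename \<rho> (Rel r ts) = Rel r (map (rename_term \<rho>) ts)"
| "rename \<rho> (Neg \<phi>) = Neg (rename \<rho> \<phi>)"
| "rename \<rho> (Conj \<phi> \<psi>) = Conj (rename \<rho> \<phi>) (rename \<rho> \<psi>)"
| "rename \<rho> (Exi i \<phi>) =
     Exi (Suc (sum \<rho> (formula_vars \<phi>))) (rename (\<rho>(i := Suc (sum \<rho> (formula_vars \<phi>)))) \<phi>)"

lemma wf_rename_term: "wf_term \<M> (rename_term \<rho> t) \<longleftrightarrow> wf_term \<M> t"
  by (induction t) auto

lemma wf_rename: "wf_formula \<M> (rename \<rho> \<phi>) \<longleftrightarrow> wf_formula \<M> \<phi>"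
  by (induction \<phi> arbitrary: \<rho>) (auto simp: wf_rename_term)

lemma term_val_rename: "term_val \<M> e (rename_term \<rho> t) = term_val \<M> (\<lambda>i. e (\<rho> i)) t"
proof (induction t)
  case (App f ts)
  then have "map (\<lambda>t. term_val \<M> e (rename_term \<rho> t)) ts = map (term_val \<M> (\<lambda>i. e (\<rho> i))) ts"
    by auto
  then show ?case by (simp add: comp_def del: map_eq_conv)
qed auto

lemma satisfies_rename: "satisfies \<M> e (rename \<rho> \<phi>) \<longleftrightarrow> satisfies \<M> (\<lambda>i. e (\<rho> i)) \<phi>"
proof (induction \<phi> arbitrary: e \<rho>)
  case (Exi i \<phi>)
  \<comment> \<open>A sum of natural numbers bounds each of its terms, so its successor is not a
    value of the renaming on the variables of the formula.\<close>
  let ?j = "Suc (sum \<rho> (formula_vars \<phi>))"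
  have fresh: "\<rho> v \<noteq> ?j" if "v \<in> formula_vars \<phi>" for v
    using member_le_sum[of v "formula_vars \<phi>" \<rho>] that by auto
  have "satisfies \<M> (e(?j := a)) (rename (\<rho>(i := ?j)) \<phi>)
      \<longleftrightarrow> satisfies \<M> ((\<lambda>k. e (\<rho> k))(i := a)) \<phi>" for a
    unfolding Exi.IH using fresh by (intro satisfies_cong) auto
  then show ?case by simp
qed (auto simp: term_val_rename comp_def)

section \<open>Predicates on infinite assignments, definable with parameters\<close>

definition accessor :: "((nat \<Rightarrow> 'a) \<Rightarrow> 'a) \<Rightarrow> bool" where
  "accessor h \<longleftrightarrow> (\<exists>j. h = (\<lambda>e. e j)) \<or> (\<exists>c. h = (\<lambda>e. c))"

text \<open>Each variable of the formula is read through an accessor, that is, a coordinate or a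
  parameter. Substitution and parameters are thus built in: combining two predicates requires no
  matching of numbers of free variables or of tuples of parameters.\<close>

definition def_pred ::
    "('a::linorder, 'f, 'r) fo_structure \<Rightarrow> ((nat \<Rightarrow> 'a) \<Rightarrow> bool) \<Rightarrow> bool" where
  "def_pred \<M> P \<longleftrightarrow>
     (\<exists>\<phi> h. wf_formula \<M> \<phi> \<and> (\<forall>i. accessor (h i)) \<and> (\<forall>e. P e \<longleftrightarrow> satisfies \<M> (\<lambda>i. h i e) \<phi>))"

lemma accessor_var: "accessor (\<lambda>e. e j)"
  and accessor_const: "accessor (\<lambda>e. c)"
  unfolding accessor_def by auto

lemma accessor_if: "accessor s \<Longrightarrow> accessor t \<Longrightarrow> accessor (\<lambda>e. if b then s e else t e)"
  by (cases b) auto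

lemma accessor_subst:
  assumes "accessor h" "\<And>i. accessor (\<lambda>e. f e i)"
  shows "accessor (\<lambda>e. h (f e))"
  using assms unfolding accessor_def by auto

lemma def_pred_less:
  assumes "accessor s" "accessor t"
  shows "def_pred \<M> (\<lambda>e. s e < t e)"
  unfolding def_pred_def
  by (rule exI[of _ "Less (Var 0) (Var 1)"], rule exI[of _ "\<lambda>i. if i = 0 then s else t"])
    (use assms in auto)

lemma def_pred_eq:
  assumes "accessor s" "accessor t"
  shows "def_pred \<M> (\<lambda>e. s e = t e)"
  unfolding def_pred_def
  by (rule exI[of _ "Eq (Var 0) (Var 1)"], rule exI[of _ "\<lambda>i. if i = 0 then s else t"])
    (use assms in auto)

lemma def_pred_not:
  assumes "def_pred \<M> P"
  shows "def_pred \<M> (\<lambda>e. \<not> P e)"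
proof -
  obtain \<phi> h where "wf_formula \<M> \<phi>" "\<forall>i. accessor (h i)" "\<forall>e. P e \<longleftrightarrow> satisfies \<M> (\<lambda>i. h i e) \<phi>"
    using assms unfolding def_pred_def by blast
  then show ?thesis
    unfolding def_pred_def by (intro exI[of _ "Neg \<phi>"] exI[of _ h]) auto
qed

lemma def_pred_conj:
  assumes "def_pred \<M> P" "def_pred \<M> Q"
  shows "def_pred \<M> (\<lambda>e. P e \<and> Q e)"
proof -
  obtain \<phi> h where 1: "wf_formula \<M> \<phi>" "\<forall>i. accessor (h i)" "\<forall>e. P e \<longleftrightarrow> satisfies \<M> (\<lambda>i. h i e) \<phi>"
    using assms unfolding def_pred_def by blast
  obtain \<psi> k where 2: "wf_formula \<M> \<psi>" "\<forall>i. accessor (k i)" "\<forall>e. Q e \<longleftrightarrow> satisfies \<M> (\<lambda>i. k i e) \<psi>"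
    using assms unfolding def_pred_def by blast
  show ?thesis
    unfolding def_pred_def
    \<comment> \<open>The two formulas may attach different accessors to the same variable, so they
      are moved apart to the even and the odd variables.\<close>
    by (rule exI[of _ "Conj (rename (\<lambda>i. 2 * i) \<phi>) (rename (\<lambda>i. 2 * i + 1) \<psi>)"],
        rule exI[of _ "\<lambda>i. if even i then h (i div 2) else k (i div 2)"])
      (use 1 2 in \<open>auto simp: wf_rename satisfies_rename\<close>)
qed

lemma def_pred_disj:
  assumes "def_pred \<M> P" "def_pred \<M> Q"
  shows "def_pred \<M> (\<lambda>e. P e \<or> Q e)"
  using def_pred_not[OF def_pred_conj[OF assms[THEN def_pred_not]]] by simp

lemma def_pred_imp:
  assumes "def_pred \<M> P" "def_pred \<M> Q"
  shows "def_pred \<M> (\<lambda>e. P e \<longrightarrow> Q e)"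
  using def_pred_disj[OF def_pred_not[OF assms(1)] assms(2)]
  by (simp only: imp_conv_disj)

lemma def_pred_iff:
  assumes "def_pred \<M> P" "def_pred \<M> Q"
  shows "def_pred \<M> (\<lambda>e. P e \<longleftrightarrow> Q e)"
  using def_pred_conj[OF def_pred_imp[OF assms] def_pred_imp[OF assms(2,1)]]
  by (simp only: iff_conv_conj_imp)

lemma def_pred_const: "def_pred \<M> (\<lambda>e. b)"
proof -
  \<comment> \<open>Formulas have no truth constants; \<open>e 0 < e 0\<close> serves as
    falsity.\<close>
  have "def_pred \<M> (\<lambda>e. e 0 < e 0 \<longleftrightarrow> \<not> b)"
    unfolding def_pred_def
    by (cases b; rule exI[of _ "if b then Neg (Less (Var 0) (Var 0)) else Less (Var 0) (Var 0)"],
        rule exI[of _ "\<lambda>i e. e i"]) (auto simp: accessor_def)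
  then show ?thesis by simp
qed

lemma def_pred_subst:
  assumes "def_pred \<M> P" "\<And>i. accessor (\<lambda>e. f e i)"
  shows "def_pred \<M> (\<lambda>e. P (f e))"
proof -
  obtain \<phi> h where 1: "wf_formula \<M> \<phi>" "\<forall>i. accessor (h i)" "\<forall>e. P e \<longleftrightarrow> satisfies \<M> (\<lambda>i. h i e) \<phi>"
    using assms unfolding def_pred_def by blast
  have "accessor (\<lambda>e. h i (f e))" for i
    using 1(2)[rule_format, of i] assms(2) unfolding accessor_def by fastforce
  then show ?thesis
    unfolding def_pred_def
    by (intro exI[of _ \<phi>] exI[of _ "\<lambda>i e. h i (f e)"]) (use 1 in auto)
qed

text \<open>Several variables of the formula may read coordinate \<open>j\<close>. All of them
  collapse to the bound variable \<open>0\<close>, and the others move up by one; it is here that a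
  renaming fails to be injective.\<close>

lemma def_pred_ex_upd:
  assumes "def_pred \<M> P"
  shows "def_pred \<M> (\<lambda>e. \<exists>a. P (e(j := a)))"
proof -
  obtain \<phi> h where 1: "wf_formula \<M> \<phi>" "\<forall>i. accessor (h i)" "\<forall>e. P e \<longleftrightarrow> satisfies \<M> (\<lambda>i. h i e) \<phi>"
    using assms unfolding def_pred_def by blast
  define \<rho> where "\<rho> i = (if h i = (\<lambda>e. e j) then 0 else Suc i)" for i
  define k where "k i = (case i of 0 \<Rightarrow> h 0 | Suc i \<Rightarrow> h i)" for i
  have "h i (e(j := a)) = ((\<lambda>i. k i e)(0 := a)) (\<rho> i)" for i e a
    using 1(2)[rule_format, of i] unfolding \<rho>_def k_def accessor_def by (auto split: nat.split)
  then have "P (e(j := a)) \<longleftrightarrow> satisfies \<M> ((\<lambda>i. k i e)(0 := a)) (rename \<rho> \<phi>)" for e a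
    using 1(3) by (simp add: satisfies_rename)
  then show ?thesis
    unfolding def_pred_def
    by (intro exI[of _ "Exi 0 (rename \<rho> \<phi>)"] exI[of _ k])
      (use 1 in \<open>auto simp: wf_rename k_def split: nat.split\<close>)
qed

text \<open>The quantified value is put in front of the assignment, in the manner of de Bruijn
  indices. In this form the rule applies backwards to a displayed formula, with \<open>Q\<close>
  found by higher-order unification.\<close>

lemma def_pred_ex:
  assumes "def_pred \<M> (\<lambda>e. Q (\<lambda>i. e (Suc i)) (e 0))"
  shows "def_pred \<M> (\<lambda>e. \<exists>a. Q e a)"
  using def_pred_subst[OF def_pred_ex_upd[OF assms, of 0], of "\<lambda>e i. e (i - 1)"]
  by (simp add: accessor_var)

text \<open>Only finitely many coordinates matter to a predicate; this is what reduces a quantifier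
  over infinite assignments to finitely many ordinary ones.\<close>

lemma def_pred_support:
  assumes "def_pred \<M> P"
  obtains N where "\<And>e e'. (\<And>i. i < N \<Longrightarrow> e i = e' i) \<Longrightarrow> P e \<longleftrightarrow> P e'"
proof -
  obtain \<phi> h where 1: "wf_formula \<M> \<phi>" "\<forall>i. accessor (h i)" "\<forall>e. P e \<longleftrightarrow> satisfies \<M> (\<lambda>i. h i e) \<phi>"
    using assms unfolding def_pred_def by blast
  have "\<exists>g. \<forall>i. h i = (\<lambda>e. e (g i)) \<or> (\<exists>c. h i = (\<lambda>e. c))"
    using 1(2) unfolding accessor_def by metis
  then obtain g where g: "\<And>i. h i = (\<lambda>e. e (g i)) \<or> (\<exists>c. h i = (\<lambda>e. c))" by blast
  have "P e \<longleftrightarrow> P e'" if "\<And>i. i < Suc (sum g (formula_vars \<phi>)) \<Longrightarrow> e i = e' i" for e e'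
  proof -
    have "h i e = h i e'" if "i \<in> formula_vars \<phi>" for i
    proof -
      have "e (g i) = e' (g i)"
        using member_le_sum[of i "formula_vars \<phi>" g] that
          \<open>\<And>i. i < Suc (sum g (formula_vars \<phi>)) \<Longrightarrow> e i = e' i\<close> by auto
      then show ?thesis using g[of i] by metis
    qed
    then show ?thesis
      using 1(3) satisfies_cong[of \<phi> "\<lambda>i. h i e" "\<lambda>i. h i e'" \<M>] by simp
  qed
  then show ?thesis using that by blast
qed

text \<open>
  Quantification over whole assignments: the quantified one and the free one are
  interleaved on the even and the odd indices.
\<close>

lemma def_pred_exB:
  fixes Q :: "(nat \<Rightarrow> 'a::linorder) \<Rightarrow> (nat \<Rightarrow> 'a) \<Rightarrow> bool"
  assumes "def_pred \<M> (\<lambda>e. Q (\<lambda>i. e (2 * i + 1)) (\<lambda>i. e (2 * i)))"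
  shows "def_pred \<M> (\<lambda>e. \<exists>y. Q e y)"
proof -
  define P where "P e = Q (\<lambda>i. e (2 * i + 1)) (\<lambda>i. e (2 * i))" for e
  \<comment> \<open>\<open>mix K e y\<close> takes over only the first \<open>K\<close> terms of
    \<open>y\<close>, at the cost of \<open>K\<close> ordinary quantifiers. Once \<open>K\<close>
    reaches the bound \<open>N\<close> on the support of \<open>P\<close>, it cannot be told from
    the full interleaving.\<close>
  define mix where "mix K e y i = (if even i \<and> i < 2 * K then y (i div 2) else e i)"
    for K :: nat and e y :: "nat \<Rightarrow> 'a" and i
  have *: "def_pred \<M> (\<lambda>e. \<exists>y. P (mix K e y))" for K
  proof (induction K)
    case 0
    have "mix 0 e y = e" for e y by (auto simp: mix_def)
    then show ?case using assms by (simp add: P_def)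
  next
    case (Suc K)
    have odd: "2 * b \<noteq> Suc (2 * K)" for b by presburger
    have "mix (Suc K) e y = mix K (e(2 * K := y K)) y" for e y
      by (auto simp: mix_def less_Suc_eq fun_eq_iff odd elim!: evenE)
    moreover have "mix K (e(2 * K := a)) y = mix (Suc K) e (y(K := a))" for e y a
      by (auto simp: mix_def less_Suc_eq fun_eq_iff odd elim!: evenE)
    ultimately have "(\<exists>y. P (mix (Suc K) e y)) \<longleftrightarrow> (\<exists>a y. P (mix K (e(2 * K := a)) y))" for e
      by metis
    then show ?case using def_pred_ex_upd[OF Suc, of "2 * K"] by (simp only: )
  qed
  obtain N where N: "\<And>e e'. (\<And>i. i < N \<Longrightarrow> e i = e' i) \<Longrightarrow> P e \<longleftrightarrow> P e'"
    using def_pred_support[OF assms] unfolding P_def by metis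
  have "P (mix N (\<lambda>i. e (i div 2)) y) \<longleftrightarrow> P (\<lambda>i. if even i then y (i div 2) else e (i div 2))" for e y
    by (rule N) (auto simp: mix_def)
  moreover have "P (\<lambda>i. if even i then y (i div 2) else e (i div 2)) \<longleftrightarrow> Q e y" for e y
    by (simp add: P_def)
  ultimately show ?thesis
    using def_pred_subst[OF *[of N], of "\<lambda>e i. e (i div 2)"] by (simp add: accessor_var)
qed

lemma def_pred_all:
  assumes "def_pred \<M> (\<lambda>e. Q (\<lambda>i. e (Suc i)) (e 0))"
  shows "def_pred \<M> (\<lambda>e. \<forall>a. Q e a)"
  using def_pred_not[OF def_pred_ex[OF def_pred_not[OF assms]]] by simp

lemma def_pred_allB:
  assumes "def_pred \<M> (\<lambda>e. Q (\<lambda>i. e (2 * i + 1)) (\<lambda>i. e (2 * i)))"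
  shows "def_pred \<M> (\<lambda>e. \<forall>y. Q e y)"
  using def_pred_not[OF def_pred_exB[OF def_pred_not[OF assms]]] by simp

lemma def_pred_ball_fin:
  assumes "finite I" "\<And>i. i \<in> I \<Longrightarrow> def_pred \<M> (\<lambda>e. P e i)"
  shows "def_pred \<M> (\<lambda>e. \<forall>i\<in>I. P e i)"
  using assms by (induction I) (auto simp: def_pred_const intro!: def_pred_conj)

lemma def_pred_bex_fin:
  assumes "finite I" "\<And>i. i \<in> I \<Longrightarrow> def_pred \<M> (\<lambda>e. P e i)"
  shows "def_pred \<M> (\<lambda>e. \<exists>i\<in>I. P e i)"
  using assms by (induction I) (auto simp: def_pred_const intro!: def_pred_disj)

text \<open>The bridge between definable sets and the calculus of predicates: from here on
  definability is shown by applying closure rules.\<close>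

lemma definable_iff_def_pred:
  fixes \<M> :: "('a::linorder, 'f, 'r) fo_structure"
  shows "definable \<M> n X \<longleftrightarrow> X \<subseteq> cart_power n \<and> def_pred \<M> (\<lambda>e. restrict e {..<n} \<in> X)"
proof
  assume "definable \<M> n X"
  then obtain \<phi> p where 1: "wf_formula \<M> \<phi>"
    and X: "X = {x \<in> cart_power n. satisfies \<M> (\<lambda>i. if i < n then x i else p i) \<phi>}"
    unfolding definable_def by blast
  have "restrict e {..<n} \<in> X \<longleftrightarrow> satisfies \<M> (\<lambda>i. (if i < n then \<lambda>e. e i else (\<lambda>e. p i)) e) \<phi>" for e
  proof -
    have "satisfies \<M> (\<lambda>i. if i < n then restrict e {..<n} i else p i) \<phi>
      \<longleftrightarrow> satisfies \<M> (\<lambda>i. (if i < n then \<lambda>e. e i else (\<lambda>e. p i)) e) \<phi>"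
      by (rule satisfies_cong) auto
    then show ?thesis unfolding X by auto
  qed
  then have "def_pred \<M> (\<lambda>e. restrict e {..<n} \<in> X)"
    unfolding def_pred_def
    by (intro exI[of _ \<phi>] exI[of _ "\<lambda>i. if i < n then \<lambda>e. e i else (\<lambda>e. p i)"])
      (use 1 in \<open>auto simp: accessor_def\<close>)
  then show "X \<subseteq> cart_power n \<and> def_pred \<M> (\<lambda>e. restrict e {..<n} \<in> X)"
    using X by auto
next
  assume R: "X \<subseteq> cart_power n \<and> def_pred \<M> (\<lambda>e. restrict e {..<n} \<in> X)"
  then obtain \<phi> h where 1: "wf_formula \<M> \<phi>" "\<forall>i. accessor (h i)"
      "\<forall>e. restrict e {..<n} \<in> X \<longleftrightarrow> satisfies \<M> (\<lambda>i. h i e) \<phi>"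
    unfolding def_pred_def by blast
  have "\<exists>g. \<forall>i. h i = (\<lambda>e. e (g i)) \<or> (\<exists>c. h i = (\<lambda>e. c))"
    using 1(2) unfolding accessor_def by metis
  then obtain g where g: "\<And>i. h i = (\<lambda>e. e (g i)) \<or> (\<exists>c. h i = (\<lambda>e. c))" by blast
  \<comment> \<open>A point of \<open>cart_power n\<close> has the value \<open>undefined\<close> at
    every coordinate from \<open>n\<close> on. There an accessor to such a coordinate acts as a
    constant, so it is turned into a parameter.\<close>
  define \<rho> where "\<rho> i = (if h i = (\<lambda>e. e (g i)) \<and> g i < n then g i else n + i)" for i
  define p where "p i = h (i - n) (\<lambda>_. undefined)" for i
  have "satisfies \<M> (\<lambda>i. if i < n then x i else p i) (rename \<rho> \<phi>) \<longleftrightarrow> x \<in> X"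
    if "x \<in> cart_power n" for x
  proof -
    have "(if \<rho> i < n then x (\<rho> i) else p (\<rho> i)) = h i x" for i
      using g[of i] that by (auto simp: \<rho>_def p_def PiE_def extensional_def)
    moreover have "restrict x {..<n} = x" using that by (simp add: PiE_restrict)
    ultimately show ?thesis using 1(3)[rule_format, of x] by (simp add: satisfies_rename)
  qed
  then have "X = {x \<in> cart_power n. satisfies \<M> (\<lambda>i. if i < n then x i else p i) (rename \<rho> \<phi>)}"
    using R by blast
  then show "definable \<M> n X"
    unfolding definable_def using 1(1) wf_rename by blast
qed

lemma definable_line_iff_def_pred: "definable_line \<M> S \<longleftrightarrow> def_pred \<M> (\<lambda>e. e 0 \<in> S)"
  unfolding definable_line_def definable_iff_def_pred by auto

lemma def_pred_app2:
  assumes "def_pred \<M> (\<lambda>e. P (e 0) (e 1))" "accessor s" "accessor t"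
  shows "def_pred \<M> (\<lambda>e. P (s e) (t e))"
  using def_pred_subst[OF assms(1), of "\<lambda>e i. if i = 0 then s e else t e"] assms(2,3)
  by (simp add: accessor_if)

lemma def_pred_appB1:
  assumes "def_pred \<M> (\<lambda>e. Q (\<lambda>i. e (Suc i)) (e 0))" "\<And>i. accessor (\<lambda>e. f e i)" "accessor t"
  shows "def_pred \<M> (\<lambda>e. Q (f e) (t e))"
proof -
  have "accessor (\<lambda>e. case i of 0 \<Rightarrow> t e | Suc i \<Rightarrow> f e i)" for i
    using assms by (cases i) auto
  then show ?thesis
    using def_pred_subst[OF assms(1), of "\<lambda>e i. case i of 0 \<Rightarrow> t e | Suc i \<Rightarrow> f e i"] by simp
qed

lemma def_pred_appBB:
  assumes "def_pred \<M> (\<lambda>e. Q (\<lambda>i. e (2 * i + 1)) (\<lambda>i. e (2 * i)))"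
    "\<And>i. accessor (\<lambda>e. f e i)" "\<And>i. accessor (\<lambda>e. g e i)"
  shows "def_pred \<M> (\<lambda>e. Q (f e) (g e))"
  using def_pred_subst[OF assms(1), of "\<lambda>e i. if even i then g e (i div 2) else f e (i div 2)"]
    assms(2,3) by (simp add: accessor_if)

lemmas def_pred_intros =
  def_pred_conj def_pred_disj def_pred_imp def_pred_iff def_pred_not
  def_pred_ex def_pred_all def_pred_exB def_pred_allB
  def_pred_ball_fin def_pred_bex_fin
  def_pred_less def_pred_eq def_pred_const
  accessor_var accessor_const accessor_if

section \<open>One-sided germs on the line\<close>


locale tame =
  fixes \<M> :: "('a::{unbounded_dense_linorder, linorder_topology}, 'f, 'r) fo_structure"
  assumes locally_o_minimal: "locally_o_minimal \<M>"
    and definably_complete: "definably_complete \<M>"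
    and property_a: "property_a \<M>"

text \<open>The reflexive closure, which lets both orientations instantiate the library's theory of
  dense orders.\<close>

definition weak :: "('a \<Rightarrow> 'a \<Rightarrow> bool) \<Rightarrow> 'a \<Rightarrow> 'a \<Rightarrow> bool" where
  "weak lt x y \<longleftrightarrow> lt x y \<or> x = y"

text \<open>Every argument about one side of a point is made for both orientations of the line at once.\<close>

locale oriented =
  fixes lt :: "'a::unbounded_dense_linorder \<Rightarrow> 'a \<Rightarrow> bool"
  assumes orientation: "lt = (<) \<or> lt = (>)"
begin

sublocale ord: unbounded_dense_linorder "weak lt" lt
proof -
  have w: "weak (<) = ((\<le>) :: 'a \<Rightarrow> _)" "weak (>) = ((\<ge>) :: 'a \<Rightarrow> _)"
    by (auto simp: weak_def fun_eq_iff)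
  have "class.unbounded_dense_linorder (weak (<)) ((<) :: 'a \<Rightarrow> _)"
    unfolding w by unfold_locales
  moreover have "class.unbounded_dense_linorder (weak (>)) ((>) :: 'a \<Rightarrow> _)"
    unfolding w by unfold_locales (use dense in \<open>auto intro: lt_ex gt_ex\<close>)
  ultimately show "class.unbounded_dense_linorder (weak lt) lt"
    using orientation by auto
qed

lemma oriented_converse: "oriented lt\<inverse>\<inverse>"
  using orientation by unfold_locales (auto simp: fun_eq_iff)

lemma def_pred_lt:
  assumes "accessor s" "accessor t"
  shows "def_pred \<M> (\<lambda>e. lt (s e) (t e))"
  using orientation def_pred_less[OF assms] def_pred_less[OF assms(2,1)] by auto

end

text \<open>A condition on the germ of \<open>P\<close> at \<open>p\<close>, on the side given by
  \<open>lt\<close>; the point \<open>p\<close> itself is left out.\<close>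

definition after :: "('a \<Rightarrow> 'a \<Rightarrow> bool) \<Rightarrow> 'a \<Rightarrow> ('a \<Rightarrow> bool) \<Rightarrow> bool" where
  "after lt p P \<longleftrightarrow> (\<exists>q. lt p q \<and> (\<forall>y. lt p y \<longrightarrow> lt y q \<longrightarrow> P y))"

abbreviation before :: "('a \<Rightarrow> 'a \<Rightarrow> bool) \<Rightarrow> 'a \<Rightarrow> ('a \<Rightarrow> bool) \<Rightarrow> bool" where
  "before lt \<equiv> after lt\<inverse>\<inverse>"

context oriented begin

lemma after_mono: "after lt p P \<Longrightarrow> (\<And>y. lt p y \<Longrightarrow> P y \<Longrightarrow> Q y) \<Longrightarrow> after lt p Q"
  unfolding after_def by blast

lemma after_less: "lt p q \<Longrightarrow> after lt p (\<lambda>y. lt p y \<and> lt y q)"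
  unfolding after_def by blast

lemma after_conj:
  assumes "after lt p P" "after lt p Q"
  shows "after lt p (\<lambda>y. P y \<and> Q y)"
proof -
  obtain q r where q: "lt p q" "\<And>y. lt p y \<Longrightarrow> lt y q \<Longrightarrow> P y"
    and r: "lt p r" "\<And>y. lt p y \<Longrightarrow> lt y r \<Longrightarrow> Q y"
    using assms unfolding after_def by blast
  consider "lt q r" | "\<not> lt q r" by blast
  then show ?thesis
  proof cases
    case 1
    then show ?thesis unfolding after_def using q r by (metis ord.less_trans)
  next
    case 2
    then show ?thesis unfolding after_def using q r by (metis ord.less_trans ord.neqE)
  qed
qed

lemma after_ex:
  assumes "after lt p P"
  obtains y where "lt p y" "P y"
  using assms ord.dense unfolding after_def by blast

lemma def_pred_after:
  assumes "def_pred \<M> (\<lambda>e. P (\<lambda>i. e (Suc i)) (e 0))" "accessor p"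
  shows "def_pred \<M> (\<lambda>e. after lt (p e) (P e))"
  unfolding after_def
  by (intro def_pred_intros def_pred_lt)
    (auto intro!: def_pred_appB1[OF assms(1)] accessor_subst[OF assms(2)] accessor_var)


end

locale tame_line = tame \<M> + oriented lt
  for \<M> :: "('a::{unbounded_dense_linorder, linorder_topology}, 'f, 'r) fo_structure"
    and lt :: "'a \<Rightarrow> 'a \<Rightarrow> bool"
begin

lemma finite_union_intervals_after:
  fixes F :: "'a set" and P :: "('a \<times> 'a) set"
  assumes "finite F" "finite P"
  shows "after lt p (\<lambda>y. y \<in> F \<union> (\<Union>(u, v)\<in>P. {u<..<v}))
    \<or> after lt p (\<lambda>y. y \<notin> F \<union> (\<Union>(u, v)\<in>P. {u<..<v}))"
proof -
  have F: "after lt p (\<lambda>y. y \<notin> F)"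
    using assms(1)
  proof induction
    case empty
    then show ?case using ord.gt_ex unfolding after_def by blast
  next
    case (insert x F)
    have "after lt p (\<lambda>y. y \<noteq> x)"
    proof (cases "lt p x")
      case True
      then show ?thesis unfolding after_def by (intro exI[of _ x]) auto
    next
      case False
      then show ?thesis unfolding after_def using ord.gt_ex[of p] by blast
    qed
    then show ?case using after_conj[OF _ insert.IH] by (auto elim: after_mono)
  qed
  have I: "after lt p (\<lambda>y. y \<in> {u<..<v}) \<or> after lt p (\<lambda>y. y \<notin> {u<..<v})" for u v :: 'a
  proof -
    have *: "after lt p (\<lambda>y. lt x y) \<or> after lt p (\<lambda>y. \<not> lt x y)" for x
    proof (cases "lt p x")
      case True
      then show ?thesis unfolding after_def using ord.less_asym by blast
    next
      case False
      then have "lt x y" if "lt p y" for y using that by order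
      then show ?thesis unfolding after_def using ord.gt_ex[of p] by blast
    qed
    have **: "after lt p (\<lambda>y. lt y x) \<or> after lt p (\<lambda>y. \<not> lt y x)" for x
    proof (cases "lt p x")
      case True
      then show ?thesis unfolding after_def by blast
    next
      case False
      then have "\<not> lt y x" if "lt p y" for y using that by order
      then show ?thesis unfolding after_def using ord.gt_ex[of p] by blast
    qed
    obtain a b where ab: "(\<lambda>y. y \<in> {u<..<v}) = (\<lambda>y. lt a y \<and> lt y b)"
      using orientation by (elim disjE) (force simp: fun_eq_iff)+
    have "after lt p (\<lambda>y. lt a y \<and> lt y b) \<or> after lt p (\<lambda>y. \<not> (lt a y \<and> lt y b))"
    proof -
      have "after lt p (\<lambda>y. \<not> (lt a y \<and> lt y b))" if "after lt p (\<lambda>y. \<not> lt a y)"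
        using that by (rule after_mono) simp
      moreover have "after lt p (\<lambda>y. \<not> (lt a y \<and> lt y b))" if "after lt p (\<lambda>y. \<not> lt y b)"
        using that by (rule after_mono) simp
      ultimately show ?thesis
        using *[of a] **[of b] after_conj[of p "\<lambda>y. lt a y" "\<lambda>y. lt y b"] by blast
    qed
    then show ?thesis using fun_cong[OF ab] by simp
  qed
  have "after lt p (\<lambda>y. y \<in> (\<Union>(u, v)\<in>P. {u<..<v})) \<or> after lt p (\<lambda>y. y \<notin> (\<Union>(u, v)\<in>P. {u<..<v}))"
    using assms(2)
  proof induction
    case empty
    then show ?case using ord.gt_ex unfolding after_def by blast
  next
    case (insert x P)
    obtain u v where x: "x = (u, v)" by (cases x)
    let ?A = "\<lambda>y. y \<in> (\<Union>(u, v)\<in>P. {u<..<v})"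
    have eq: "y \<in> (\<Union>(u, v)\<in>insert x P. {u<..<v}) \<longleftrightarrow> y \<in> {u<..<v} \<or> ?A y" for y
      by (simp add: x)
    consider "after lt p (\<lambda>y. y \<in> {u<..<v})" | "after lt p ?A"
      | "after lt p (\<lambda>y. y \<notin> {u<..<v})" "after lt p (\<lambda>y. \<not> ?A y)"
      using insert.IH I[of u v] by blast
    then show ?case
    proof cases
      case 3
      then have "after lt p (\<lambda>y. y \<notin> {u<..<v} \<and> \<not> ?A y)" by (rule after_conj)
      then show ?thesis unfolding eq by simp
    next
      case 1
      then have "after lt p (\<lambda>y. y \<in> (\<Union>(u, v)\<in>insert x P. {u<..<v}))"
        by (rule after_mono) (simp add: x)
      then show ?thesis ..
    next
      case 2
      then have "after lt p (\<lambda>y. y \<in> (\<Union>(u, v)\<in>insert x P. {u<..<v}))"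
        by (rule after_mono) (simp add: x)
      then show ?thesis ..
    qed
  qed
  then show ?thesis
  proof
    assume "after lt p (\<lambda>y. y \<in> (\<Union>(u, v)\<in>P. {u<..<v}))"
    then have "after lt p (\<lambda>y. y \<in> F \<union> (\<Union>(u, v)\<in>P. {u<..<v}))"
      by (rule after_mono) simp
    then show ?thesis ..
  next
    assume "after lt p (\<lambda>y. y \<notin> (\<Union>(u, v)\<in>P. {u<..<v}))"
    then have "after lt p (\<lambda>y. y \<notin> F \<union> (\<Union>(u, v)\<in>P. {u<..<v}))"
      using after_conj[OF F] by simp
    then show ?thesis ..
  qed
qed

text \<open>Local o-minimality enters the argument through this lemma alone: a definable property
  has a constant germ on each side of each point. So a property that holds at points arbitrarily
  close to \<open>p\<close> on one side holds on a whole interval there.\<close>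

lemma after_dichotomy:
  assumes "def_pred \<M> (\<lambda>e. P (e 0))"
  shows "after lt p P \<or> after lt p (\<lambda>y. \<not> P y)"
proof -
  have "definable_line \<M> {x. P x}" using assms by (simp add: definable_line_iff_def_pred)
  then obtain b c F Q where bc: "p \<in> {b<..<c}" and "finite F" "finite Q"
    and eq: "{x. P x} \<inter> {b<..<c} = F \<union> (\<Union>(u, v)\<in>Q. {u<..<v})"
    using locally_o_minimal unfolding locally_o_minimal_def by meson
  have *: "after lt p (\<lambda>y. y \<in> {b<..<c})"
    using orientation bc unfolding after_def by (auto intro: less_trans)
  consider "after lt p (\<lambda>y. y \<in> {x. P x} \<inter> {b<..<c})" | "after lt p (\<lambda>y. y \<notin> {x. P x} \<inter> {b<..<c})"
    unfolding eq using finite_union_intervals_after[OF \<open>finite F\<close> \<open>finite Q\<close>, of p] by blast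
  then show ?thesis
  proof cases
    case 1
    then have "after lt p P" by (rule after_mono) simp
    then show ?thesis ..
  next
    case 2
    then have "after lt p (\<lambda>y. \<not> P y)"
      by (rule after_mono[OF after_conj[OF _ *]]) auto
    then show ?thesis ..
  qed
qed

text \<open>Definable completeness enters through this lemma alone; its instance for the reversed
  order gives infima. The element \<open>a\<close> and the bound \<open>c\<close> exclude infinite
  values.\<close>

lemma definable_Sup:
  assumes "def_pred \<M> (\<lambda>e. S (e 0))" "S a" "\<And>x. S x \<Longrightarrow> \<not> lt c x"
  obtains s where "\<And>x. S x \<Longrightarrow> \<not> lt s x" "\<And>u. lt u s \<Longrightarrow> \<exists>x. S x \<and> lt u x"
proof -
  have d: "definable_line \<M> {x. S x}" using assms(1) by (simp add: definable_line_iff_def_pred)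
  show ?thesis
  proof (cases "lt = (<)")
    case True
    obtain t :: "'a extended" where t: "isLub UNIV (Fin ` {x. S x}) t"
      using d definably_complete unfolding definably_complete_def by blast
    have le: "t \<le> Fin c"
      by (rule isLub_le_isUb[OF t]) (use assms(3) True in \<open>auto simp: isUb_def setle_def not_less\<close>)
    have ge: "Fin x \<le> t" if "S x" for x
      using isLubD2[OF t] that by blast
    obtain s where s: "t = Fin s" using le ge[OF assms(2)] by (cases t) auto
    have "\<exists>x. S x \<and> u < x" if "u < s" for u
    proof (rule ccontr)
      assume "\<not> ?thesis"
      then have "isUb UNIV (Fin ` {x. S x}) (Fin u)" by (auto simp: isUb_def setle_def not_less)
      then show False using isLub_le_isUb[OF t] that s by fastforce
    qed
    then show ?thesis using that[of s] ge s True by (auto simp: not_less)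
  next
    case False
    then have gt: "lt = (>)" using orientation by blast
    obtain t :: "'a extended" where t: "isGlb UNIV (Fin ` {x. S x}) t"
      using d definably_complete unfolding definably_complete_def by blast
    have ge: "Fin c \<le> t"
      by (rule isGlb_le_isLb[OF t]) (use assms(3) gt in \<open>auto simp: isLb_def setge_def not_less\<close>)
    have le: "t \<le> Fin x" if "S x" for x
      using isGlbD2[OF t] that by blast
    obtain s where s: "t = Fin s" using ge le[OF assms(2)] by (cases t) auto
    have "\<exists>x. S x \<and> x < u" if "s < u" for u
    proof (rule ccontr)
      assume "\<not> ?thesis"
      then have "isLb UNIV (Fin ` {x. S x}) (Fin u)" by (auto simp: isLb_def setge_def not_less)
      then show False using isGlb_le_isLb[OF t] that s by fastforce
    qed
    then show ?thesis using that[of s] le s gt by (auto simp: not_less)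
  qed
qed

lemma after_interval:
  assumes R: "after lt p R" and pq: "lt p q"
  obtains q' where "lt p q'" "weak lt q' q" "\<And>x. lt p x \<Longrightarrow> lt x q' \<Longrightarrow> R x \<and> lt x q"
proof -
  obtain r where r: "lt p r" "\<And>x. lt p x \<Longrightarrow> lt x r \<Longrightarrow> R x \<and> lt p x \<and> lt x q"
    using after_conj[OF R after_less[OF pq]] unfolding after_def by blast
  have "weak lt r q"
  proof (rule ccontr)
    assume "\<not> weak lt r q"
    then have "lt q r" by order
    then show False using r(2)[of q] pq ord.less_irrefl by blast
  qed
  then show thesis using that r by blast
qed

text \<open>The germ of \<open>P\<close> at \<open>p\<close> is constant, and if it is false the
  cover leaves \<open>Q\<close>. This makes a pointwise choice between two alternatives the same on
  an initial segment.\<close>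

lemma interval_split:
  assumes "def_pred \<M> (\<lambda>e. P (e 0))" "lt p q"
    and "\<And>x. lt p x \<Longrightarrow> lt x q \<Longrightarrow> P x \<or> Q x"
  obtains q' where "lt p q'" "weak lt q' q"
    "(\<forall>x. lt p x \<longrightarrow> lt x q' \<longrightarrow> P x) \<or> (\<forall>x. lt p x \<longrightarrow> lt x q' \<longrightarrow> Q x)"
proof -
  consider "after lt p P" | "after lt p (\<lambda>y. \<not> P y)"
    using after_dichotomy[OF assms(1), of p] by blast
  then show thesis
  proof cases
    case 1
    then obtain q' where "lt p q'" "weak lt q' q" "\<And>x. lt p x \<Longrightarrow> lt x q' \<Longrightarrow> P x \<and> lt x q"
      using after_interval[OF _ assms(2)] by blast
    then show thesis using that by blast
  next
    case 2
    then obtain q' where "lt p q'" "weak lt q' q" "\<And>x. lt p x \<Longrightarrow> lt x q' \<Longrightarrow> \<not> P x \<and> lt x q"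
      using after_interval[OF _ assms(2)] by blast
    then show thesis using that assms(3) by blast
  qed
qed

end

section \<open>Boxes as bases of the order topology and its powers\<close>

definition box :: "nat set \<Rightarrow> (nat \<Rightarrow> 'a::linorder) \<Rightarrow> (nat \<Rightarrow> 'a) \<Rightarrow> (nat \<Rightarrow> 'a) set" where
  "box I a b = (\<Pi>\<^sub>E i\<in>I. {a i<..<b i})"

lemma mem_box: "x \<in> box I a b \<longleftrightarrow> x \<in> extensional I \<and> (\<forall>i\<in>I. a i < x i \<and> x i < b i)"
  by (auto simp: box_def PiE_def Pi_def)

lemma openin_order_iff:
  fixes S :: "'a::{unbounded_dense_linorder, linorder_topology} set"
  shows "open S \<longleftrightarrow> (\<forall>x\<in>S. \<exists>a b. a < x \<and> x < b \<and> {a<..<b} \<subseteq> S)"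
proof
  assume "open S"
  show "\<forall>x\<in>S. \<exists>a b. a < x \<and> x < b \<and> {a<..<b} \<subseteq> S"
  proof
    fix x assume "x \<in> S"
    obtain l u where "l < x" "x < u" using lt_ex gt_ex by blast
    then obtain a b where "x < b" "{x..<b} \<subseteq> S" "a < x" "{a<..x} \<subseteq> S"
      using open_right[OF \<open>open S\<close> \<open>x \<in> S\<close>] open_left[OF \<open>open S\<close> \<open>x \<in> S\<close>] by metis
    moreover have "{a<..<b} \<subseteq> {a<..x} \<union> {x..<b}" by auto
    ultimately show "\<exists>a b. a < x \<and> x < b \<and> {a<..<b} \<subseteq> S" by blast
  qed
next
  assume R: "\<forall>x\<in>S. \<exists>a b. a < x \<and> x < b \<and> {a<..<b} \<subseteq> S"
  show "open S"
  proof (subst open_subopen, intro ballI)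
    fix x assume "x \<in> S"
    then obtain a b where "a < x" "x < b" "{a<..<b} \<subseteq> S" using R by blast
    then show "\<exists>T. open T \<and> x \<in> T \<and> T \<subseteq> S" by (intro exI[of _ "{a<..<b}"]) auto
  qed
qed

lemma openin_power_iff:
  fixes S :: "(nat \<Rightarrow> 'a::{unbounded_dense_linorder, linorder_topology}) set"
  shows "openin (power_topology n) S \<longleftrightarrow>
    S \<subseteq> cart_power n \<and> (\<forall>x\<in>S. \<exists>a b. x \<in> box {..<n} a b \<and> box {..<n} a b \<subseteq> S)"
proof
  assume S: "openin (power_topology n) S"
  have "\<exists>a b. x \<in> box {..<n} a b \<and> box {..<n} a b \<subseteq> S" if "x \<in> S" for x
  proof -
    have "\<forall>x\<in>S. \<exists>U. finite {i \<in> {..<n}. U i \<noteq> (UNIV :: 'a set)} \<and> (\<forall>i\<in>{..<n}. open (U i)) \<and>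
        x \<in> Pi\<^sub>E {..<n} U \<and> Pi\<^sub>E {..<n} U \<subseteq> S"
      using S unfolding openin_product_topology_alt by simp
    then obtain U where U: "\<And>i. i < n \<Longrightarrow> open (U i)" "x \<in> Pi\<^sub>E {..<n} U" "Pi\<^sub>E {..<n} U \<subseteq> S"
      using \<open>x \<in> S\<close> by (metis lessThan_iff)
    have "\<exists>a b. a < x i \<and> x i < b \<and> {a<..<b} \<subseteq> U i" if "i < n" for i
      using U(1)[OF that] U(2) that unfolding openin_order_iff by (auto simp: PiE_iff)
    then obtain a b where ab: "\<And>i. i < n \<Longrightarrow> a i < x i \<and> x i < b i \<and> {a i<..<b i} \<subseteq> U i"
      by metis
    then have "x \<in> box {..<n} a b" using U(2) by (auto simp: mem_box PiE_iff)
    moreover have "box {..<n} a b \<subseteq> Pi\<^sub>E {..<n} U" unfolding box_def using ab by (intro PiE_mono) auto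
    ultimately show ?thesis using U(3) by blast
  qed
  moreover have "S \<subseteq> cart_power n" using openin_subset[OF S] by simp
  ultimately show "S \<subseteq> cart_power n \<and> (\<forall>x\<in>S. \<exists>a b. x \<in> box {..<n} a b \<and> box {..<n} a b \<subseteq> S)"
    by blast
next
  assume R: "S \<subseteq> cart_power n \<and> (\<forall>x\<in>S. \<exists>a b. x \<in> box {..<n} a b \<and> box {..<n} a b \<subseteq> S)"
  have "openin (power_topology n) (box {..<n} a b)" for a b :: "nat \<Rightarrow> 'a"
    unfolding box_def by (subst openin_PiE_gen) auto
  then show "openin (power_topology n) S"
    by (subst openin_subopen) (use R in blast)
qed

lemma discrete_in_power_iff:
  fixes X :: "(nat \<Rightarrow> 'a::{unbounded_dense_linorder, linorder_topology}) set"
  shows "discrete_in_power n X \<longleftrightarrow>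
    X \<subseteq> cart_power n \<and> (\<forall>x\<in>X. \<exists>a b. x \<in> box {..<n} a b \<and> X \<inter> box {..<n} a b \<subseteq> {x})"
proof
  assume d: "discrete_in_power n X"
  then have "topspace (subtopology (power_topology n) X) = X"
    unfolding discrete_in_power_def by simp
  then have "X \<subseteq> cart_power n" by (auto simp: topspace_subtopology)
  moreover have "\<exists>a b. x \<in> box {..<n} a b \<and> X \<inter> box {..<n} a b \<subseteq> {x}" if "x \<in> X" for x
  proof -
    have "openin (subtopology (power_topology n) X) {x}"
      using d that unfolding discrete_in_power_def by simp
    then obtain T where T: "openin (power_topology n) T" "{x} = T \<inter> X"
      unfolding openin_subtopology by blast
    then have "x \<in> T" by blast
    then obtain a b where "x \<in> box {..<n} a b" "box {..<n} a b \<subseteq> T"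
      using T(1) unfolding openin_power_iff by meson
    moreover from this have "X \<inter> box {..<n} a b \<subseteq> T \<inter> X" by auto
    ultimately show ?thesis using T(2) by metis
  qed
  ultimately show "X \<subseteq> cart_power n \<and> (\<forall>x\<in>X. \<exists>a b. x \<in> box {..<n} a b \<and> X \<inter> box {..<n} a b \<subseteq> {x})"
    by blast
next
  assume R: "X \<subseteq> cart_power n \<and> (\<forall>x\<in>X. \<exists>a b. x \<in> box {..<n} a b \<and> X \<inter> box {..<n} a b \<subseteq> {x})"
  have "openin (subtopology (power_topology n) X) {x}" if x: "x \<in> X" for x
  proof -
    obtain a b where "x \<in> box {..<n} a b" "X \<inter> box {..<n} a b \<subseteq> {x}"
      using R[THEN conjunct2, THEN bspec, OF x] by (elim exE conjE)
    moreover have "openin (power_topology n) (box {..<n} a b)"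
      unfolding box_def by (subst openin_PiE_gen) auto
    ultimately show ?thesis
      unfolding openin_subtopology using x by (intro exI[of _ "box {..<n} a b"]) auto
  qed
  moreover have "topspace (subtopology (power_topology n) X) = X" using R by (auto simp: topspace_subtopology)
  ultimately show "discrete_in_power n X"
    unfolding discrete_in_power_def using discrete_topology_unique by metis
qed

context tame begin

text \<open>Property (a) enters through this lemma alone, and only for projections to one
  coordinate: a discrete subset of a dense line contains no interval.\<close>

lemma discrete_coordinate:
  assumes "definable \<M> n X" "discrete_in_power n X" "j < n" "p < q"
  obtains t where "p < t" "t < q" "t \<notin> (\<lambda>x. x j) ` X"
proof (cases "X = {}")
  case True
  then show ?thesis using that dense[OF assms(4)] by auto
next
  case False
  have "coord_selection n 1 (\<lambda>_. j)"
    using assms(3) by (auto simp: coord_selection_def strict_mono_on_def)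
  then have d: "discrete_in_power 1 (coord_proj 1 (\<lambda>_. j) ` X)"
    using property_a False assms unfolding property_a_def by blast
  note found = that
  show ?thesis
  proof (rule ccontr)
    assume no: "\<not> thesis"
    have all: "(\<lambda>_\<in>{..<1}. t) \<in> coord_proj 1 (\<lambda>_. j) ` X" if "p < t" "t < q" for t
    proof -
      have "t \<in> (\<lambda>x. x j) ` X" using no found[OF that] by blast
      then obtain x where "x \<in> X" "t = x j" by (rule imageE)
      then show ?thesis by (intro image_eqI[of _ _ x]) (simp_all add: coord_proj_def)
    qed
    obtain t where t: "p < t" "t < q" using dense[OF assms(4)] by blast
    obtain a b where ab: "(\<lambda>_\<in>{..<1}. t) \<in> box {..<1} a b"
        "coord_proj 1 (\<lambda>_. j) ` X \<inter> box {..<1} a b \<subseteq> {\<lambda>_\<in>{..<1}. t}"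
      using d all[OF t] unfolding discrete_in_power_iff by meson
    have "t < min q (b 0)" using ab(1) t by (simp add: mem_box)
    then obtain u where u: "t < u" "u < q" "u < b 0" using dense by (metis min_less_iff_conj)
    have "(\<lambda>_\<in>{..<1}. u) \<in> box {..<1} a b"
      using ab(1) u by (auto simp: mem_box intro: less_trans)
    then have "(\<lambda>_\<in>{..<1::nat}. u) = (\<lambda>_\<in>{..<1}. t)"
      using subsetD[OF ab(2) IntI[OF all[OF less_trans[OF t(1) u(1)] u(2)]]] by simp
    then have "u = t" by (drule_tac fun_cong[of _ _ 0]) simp
    then show False using u by simp
  qed
qed

end

section \<open>Families of intervals\<close>


lemma weak_converse: "weak lt\<inverse>\<inverse> x y \<longleftrightarrow> weak lt y x"
  by (auto simp: weak_def)

locale tame_plane = tame \<M> + X: tame_line \<M> ltx + V: tame_line \<M> ltv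
  for \<M> :: "('a::{unbounded_dense_linorder, linorder_topology}, 'f, 'r) fo_structure"
    and ltx ltv :: "'a \<Rightarrow> 'a \<Rightarrow> bool"
begin

lemma flip_x: "tame_plane \<M> ltx\<inverse>\<inverse> ltv"
  using tame_axioms X.oriented_converse V.oriented_axioms
  by (intro tame_plane.intro tame_line.intro)

lemma flip_v: "tame_plane \<M> ltx ltv\<inverse>\<inverse>"
  using tame_axioms V.oriented_converse X.oriented_axioms
  by (intro tame_plane.intro tame_line.intro)

sublocale XC: tame_line \<M> "ltx\<inverse>\<inverse>"
  using tame_axioms X.oriented_converse by (intro tame_line.intro)

sublocale VC: tame_line \<M> "ltv\<inverse>\<inverse>"
  using tame_axioms V.oriented_converse by (intro tame_line.intro)

end

section \<open>Families of convex sets that keep no value over an interval\<close>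

definition below :: "('a \<Rightarrow> 'a \<Rightarrow> bool) \<Rightarrow> ('a \<Rightarrow> 'a \<Rightarrow> bool) \<Rightarrow> 'a \<Rightarrow> 'a \<Rightarrow> bool" where
  "below ltv E y v \<longleftrightarrow> (\<forall>w. E y w \<longrightarrow> ltv w v)"

abbreviation above :: "('a \<Rightarrow> 'a \<Rightarrow> bool) \<Rightarrow> ('a \<Rightarrow> 'a \<Rightarrow> bool) \<Rightarrow> 'a \<Rightarrow> 'a \<Rightarrow> bool" where
  "above ltv \<equiv> below ltv\<inverse>\<inverse>"

text \<open>No such family exists: lemma \<open>no_strip\<close> below.\<close>

definition strip ::
    "('a::linorder, 'f, 'r) fo_structure \<Rightarrow> ('a \<Rightarrow> 'a \<Rightarrow> bool) \<Rightarrow> ('a \<Rightarrow> 'a \<Rightarrow> bool)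
      \<Rightarrow> 'a \<Rightarrow> 'a \<Rightarrow> ('a \<Rightarrow> 'a \<Rightarrow> bool) \<Rightarrow> bool" where
  "strip \<M> ltx ltv p q E \<longleftrightarrow>
     ltx p q \<and> def_pred \<M> (\<lambda>e. E (e 0) (e 1)) \<and>
     (\<forall>x. ltx p x \<longrightarrow> ltx x q \<longrightarrow> (\<exists>v. E x v)) \<and>
     (\<forall>x v. ltx p x \<longrightarrow> ltx x q \<longrightarrow> E x v \<longrightarrow> (\<exists>w. E x w \<and> ltv w v) \<and> (\<exists>w. E x w \<and> ltv v w)) \<and>
     (\<forall>x u v w. ltx p x \<longrightarrow> ltx x q \<longrightarrow> E x u \<longrightarrow> E x w \<longrightarrow> ltv u v \<longrightarrow> ltv v w \<longrightarrow> E x v) \<and>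
     (\<forall>v a b. weak ltx p a \<longrightarrow> ltx a b \<longrightarrow> weak ltx b q \<longrightarrow> (\<exists>x. ltx a x \<and> ltx x b \<and> \<not> E x v))"

text \<open>Local decrease to the right of each point. Reversing \<open>ltx\<close> gives the
  behaviour to the left of each point, reversing \<open>ltv\<close> a rise away from it.\<close>

definition falls ::
    "('a \<Rightarrow> 'a \<Rightarrow> bool) \<Rightarrow> ('a \<Rightarrow> 'a \<Rightarrow> bool) \<Rightarrow> 'a \<Rightarrow> 'a \<Rightarrow> ('a \<Rightarrow> 'a \<Rightarrow> bool) \<Rightarrow> bool" where
  "falls ltx ltv p q E \<longleftrightarrow>
     (\<forall>x v. ltx p x \<longrightarrow> ltx x q \<longrightarrow> E x v \<longrightarrow> after ltx x (\<lambda>y. below ltv E y v))"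

lemma strip_flip_x: "strip \<M> ltx\<inverse>\<inverse> ltv q p E \<longleftrightarrow> strip \<M> ltx ltv p q E"
  unfolding strip_def weak_converse conversep_iff by blast

lemma strip_flip_v: "strip \<M> ltx ltv\<inverse>\<inverse> p q E \<longleftrightarrow> strip \<M> ltx ltv p q E"
  unfolding strip_def conversep_iff by blast

context tame_plane begin

lemma stripD:
  assumes "strip \<M> ltx ltv p q E" "ltx p x" "ltx x q"
  shows "\<exists>v. E x v" "E x v \<Longrightarrow> \<exists>w. E x w \<and> ltv w v" "E x v \<Longrightarrow> \<exists>w. E x w \<and> ltv v w"
    "E x u \<Longrightarrow> E x w \<Longrightarrow> ltv u v \<Longrightarrow> ltv v w \<Longrightarrow> E x v"
  using assms unfolding strip_def by blast+

lemma strip_definable: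
  assumes "strip \<M> ltx ltv p q E" "accessor s" "accessor t"
  shows "def_pred \<M> (\<lambda>e. E (s e) (t e))"
  using def_pred_app2[OF _ assms(2,3)] assms(1) unfolding strip_def by blast

lemma strip_definable_below:
  assumes "strip \<M> ltx ltv p q E" "accessor s" "accessor t"
  shows "def_pred \<M> (\<lambda>e. below ltv E (s e) (t e))"
    "def_pred \<M> (\<lambda>e. above ltv E (s e) (t e))"
  unfolding below_def
  by (intro def_pred_intros V.def_pred_lt VC.def_pred_lt strip_definable[OF assms(1)]
      accessor_subst[OF assms(2)] accessor_subst[OF assms(3)])+

lemma strip_mono:
  assumes "strip \<M> ltx ltv p q E" "weak ltx p p'" "ltx p' q'" "weak ltx q' q"
  shows "strip \<M> ltx ltv p' q' E"
proof -
  have *: "ltx p x" "ltx x q" if "ltx p' x" "ltx x q'" for x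
    using assms(2-4) that by order+
  have **: "weak ltx p a" "weak ltx b q" if "weak ltx p' a" "weak ltx b q'" for a b
    using assms(2-4) that by order+
  show ?thesis
    using assms(1) assms(3) * ** unfolding strip_def by (elim conjE) (intro conjI; meson)
qed

lemma falls_mono:
  assumes "falls ltx ltv p q E" "weak ltx p p'" "weak ltx q' q" "\<And>x v. E' x v \<Longrightarrow> E x v"
  shows "falls ltx ltv p' q' E'"
  unfolding falls_def
proof (intro allI impI)
  fix x v assume x: "ltx p' x" "ltx x q'" "E' x v"
  have "ltx p x" "ltx x q" using assms(2,3) x(1,2) by order+
  then have "after ltx x (\<lambda>y. below ltv E y v)"
    using assms(1,4) x(3) unfolding falls_def by blast
  then show "after ltx x (\<lambda>y. below ltv E' y v)"
    by (rule X.after_mono) (use assms(4) in \<open>auto simp: below_def\<close>)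
qed

text \<open>No value belongs to all fibres along an interval, so by the dichotomy \<open>v\<close>
  lies outside of the fibres just after \<open>x\<close>. Being convex, each of these lies on one
  side of \<open>v\<close>, and the side is constant by the dichotomy again.\<close>

lemma strip_away:
  assumes S: "strip \<M> ltx ltv p q E" and x: "weak ltx p x" "ltx x q"
  shows "after ltx x (\<lambda>y. below ltv E y v) \<or> after ltx x (\<lambda>y. above ltv E y v)"
proof -
  have "\<not> after ltx x (\<lambda>y. E y v)"
  proof
    assume "after ltx x (\<lambda>y. E y v)"
    then obtain b where b: "ltx x b" "weak ltx b q" "\<And>y. ltx x y \<Longrightarrow> ltx y b \<Longrightarrow> E y v \<and> ltx y q"
      using X.after_interval[OF _ x(2)] by blast
    then show False using S x(1) unfolding strip_def by blast
  qed
  then have notE: "after ltx x (\<lambda>y. \<not> E y v)"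
    using X.after_dichotomy[of "\<lambda>y. E y v" x] strip_definable[OF S accessor_var accessor_const]
    by blast
  have "after ltx x (\<lambda>y. below ltv E y v) \<or> after ltx x (\<lambda>y. \<not> below ltv E y v)"
    by (rule X.after_dichotomy) (rule strip_definable_below[OF S accessor_var accessor_const])
  moreover have "after ltx x (\<lambda>y. above ltv E y v)" if "after ltx x (\<lambda>y. \<not> below ltv E y v)"
  proof (rule X.after_mono[OF X.after_conj[OF X.after_conj[OF that notE] X.after_less[OF x(2)]]])
    fix y assume y: "ltx x y" "(\<not> below ltv E y v \<and> \<not> E y v) \<and> ltx x y \<and> ltx y q"
    have py: "ltx p y" using x y(1) by order
    obtain w where w: "E y w" "\<not> ltv w v" using y(2) unfolding below_def by blast
    then have "ltv v w" using y(2) by (metis V.ord.neqE)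
    have "ltv v u" if "E y u" for u
    proof (rule ccontr)
      assume "\<not> ltv v u"
      then have "ltv u v" using that y(2) by (metis V.ord.neqE)
      then show False using stripD(4)[OF S py _ that w(1)] y(2) \<open>ltv v w\<close> by blast
    qed
    then show "above ltv E y v" unfolding below_def by simp
  qed
  ultimately show ?thesis by blast
qed

text \<open>The values below which the family drops just after \<open>x\<close> form an upper part
  of the fibre at \<open>x\<close>. Keeping only those strictly above another such value removes a
  possible least element, so that the result is again a strip.\<close>

lemma strip_shrink:
  assumes S: "strip \<M> ltx ltv p q E"
    and A: "\<And>x. ltx p x \<Longrightarrow> ltx x q \<Longrightarrow> \<exists>v. E x v \<and> after ltx x (\<lambda>y. below ltv E y v)"
  obtains E' where "strip \<M> ltx ltv p q E'" "falls ltx ltv p q E'" "\<And>x v. E' x v \<Longrightarrow> E x v"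
proof -
  define E' where "E' x v \<longleftrightarrow> E x v \<and> (\<exists>w. E x w \<and> ltv w v \<and> after ltx x (\<lambda>y. below ltv E y w))"
    for x v
  have sub: "E' x v \<Longrightarrow> E x v" for x v unfolding E'_def by blast
  have "def_pred \<M> (\<lambda>e. E' (e 0) (e 1))"
    unfolding E'_def
    by (intro def_pred_intros V.def_pred_lt X.def_pred_after
        strip_definable[OF S] strip_definable_below[OF S])
  moreover have "\<exists>v. E' x v" if "ltx p x" "ltx x q" for x
    using A[OF that] stripD(3)[OF S that] unfolding E'_def by blast
  moreover have "(\<exists>w. E' x w \<and> ltv w v) \<and> (\<exists>w. E' x w \<and> ltv v w)"
    if x: "ltx p x" "ltx x q" and v: "E' x v" for x v
  proof -
    obtain w where w: "E x w" "ltv w v" "after ltx x (\<lambda>y. below ltv E y w)"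
      using v unfolding E'_def by blast
    obtain t where t: "ltv w t" "ltv t v" using V.ord.dense[OF w(2)] by blast
    then have "E' x t"
      using stripD(4)[OF S x w(1) sub[OF v]] w unfolding E'_def by blast
    moreover obtain u where "E x u" "ltv v u" using stripD(3)[OF S x sub[OF v]] by blast
    moreover have "E' x u"
      using \<open>E x u\<close> \<open>ltv v u\<close> w V.ord.less_trans unfolding E'_def by blast
    ultimately show ?thesis using t by blast
  qed
  moreover have "E' x v"
    if x: "ltx p x" "ltx x q" and "E' x u" "E' x w" "ltv u v" "ltv v w" for x u v w
    using stripD(4)[OF S x sub[OF that(3)] sub[OF that(4)] that(5,6)] that(3,5) V.ord.less_trans
    unfolding E'_def by blast
  ultimately have "strip \<M> ltx ltv p q E'"
    using S sub unfolding strip_def by (elim conjE) (intro conjI; meson)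
  moreover have "falls ltx ltv p q E'"
    unfolding falls_def
  proof (intro allI impI)
    fix x v assume "E' x v"
    then obtain w where w: "ltv w v" "after ltx x (\<lambda>y. below ltv E y w)"
      unfolding E'_def by blast
    show "after ltx x (\<lambda>y. below ltv E' y v)"
      using w(2) by (rule X.after_mono) (use sub w(1) V.ord.less_trans in \<open>unfold below_def, blast\<close>)
  qed
  ultimately show thesis using that sub by blast
qed

text \<open>By \<open>strip_away\<close> the family leaves some value of each fibre in a definite
  direction, and \<open>interval_split\<close> makes the direction constant near \<open>p\<close>.
  If it is upwards, \<open>strip_shrink\<close> is used with the order of values reversed.\<close>

lemma strip_one_side:
  assumes S: "strip \<M> ltx ltv p q E"
  obtains q' E' where "ltx p q'" "weak ltx q' q" "strip \<M> ltx ltv p q' E'" "\<And>x v. E' x v \<Longrightarrow> E x v"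
    "falls ltx ltv p q' E' \<or> falls ltx ltv\<inverse>\<inverse> p q' E'"
proof -
  interpret F: tame_plane \<M> ltx "ltv\<inverse>\<inverse>" by (rule flip_v)
  have pq: "ltx p q" using S unfolding strip_def by blast
  let ?P = "\<lambda>x. \<exists>v. E x v \<and> after ltx x (\<lambda>y. below ltv E y v)"
  let ?Q = "\<lambda>x. \<exists>v. E x v \<and> after ltx x (\<lambda>y. above ltv E y v)"
  have "def_pred \<M> (\<lambda>e. ?P (e 0))"
    by (intro def_pred_intros V.def_pred_lt X.def_pred_after
        strip_definable[OF S] strip_definable_below[OF S])
  moreover have "?P x \<or> ?Q x" if "ltx p x" "ltx x q" for x
    using stripD(1)[OF S that] strip_away[OF S, of x] that unfolding weak_def by blast
  ultimately obtain q' where q': "ltx p q'" "weak ltx q' q"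
      "(\<forall>x. ltx p x \<longrightarrow> ltx x q' \<longrightarrow> ?P x) \<or> (\<forall>x. ltx p x \<longrightarrow> ltx x q' \<longrightarrow> ?Q x)"
    using X.interval_split[of ?P p q ?Q] pq by blast
  have S': "strip \<M> ltx ltv p q' E" by (rule strip_mono[OF S _ q'(1,2)]) order
  from q'(3) show thesis
  proof
    assume "\<forall>x. ltx p x \<longrightarrow> ltx x q' \<longrightarrow> ?P x"
    then obtain E' where "strip \<M> ltx ltv p q' E'" "falls ltx ltv p q' E'" "\<And>x v. E' x v \<Longrightarrow> E x v"
      using strip_shrink[OF S'] by blast
    then show thesis using that q' by blast
  next
    assume "\<forall>x. ltx p x \<longrightarrow> ltx x q' \<longrightarrow> ?Q x"
    then obtain E' where "strip \<M> ltx ltv\<inverse>\<inverse> p q' E'" "falls ltx ltv\<inverse>\<inverse> p q' E'" "\<And>x v. E' x v \<Longrightarrow> E x v"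
      using F.strip_shrink[of p q' E] S' unfolding strip_flip_v by blast
    then show thesis using that q' unfolding strip_flip_v by blast
  qed
qed

text \<open>
  The family falls on both sides of every point. If it stayed above its one-sided limit at \<open>p\<close>, then
  the points where it attains a record would accumulate at \<open>p\<close>, hence fill a one-sided neighbourhood,
  which is absurd. So it stays below, and therefore has jumps downwards accumulating at \<open>p\<close>.
\<close>

lemma strip_jump:
  assumes S: "strip \<M> ltx ltv p q E"
    and F: "falls ltx ltv p q E" and G: "falls ltx\<inverse>\<inverse> ltv q p E"
  obtains r where "ltx p r" "weak ltx r q"
    "\<And>z. ltx p z \<Longrightarrow> ltx z r \<Longrightarrow>
      \<exists>v. before ltx z (\<lambda>y. above ltv E y v) \<and> after ltx z (\<lambda>y. below ltv E y v)"
proof -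
  have pq: "ltx p q" using S unfolding strip_def by blast
  note dE = strip_definable[OF S] strip_definable_below[OF S]
  let ?L = "\<lambda>v. after ltx p (\<lambda>y. above ltv E y v)"
  let ?R = "\<lambda>v. after ltx p (\<lambda>y. below ltv E y v)"
  have LR: "?L v \<or> ?R v" for v using strip_away[OF S _ pq, of v] by (auto simp: weak_def)
  have notA: "\<not> after ltx p (\<lambda>y. \<not> (\<exists>v. E y v \<and> ?L v))"
  proof
    \<comment> \<open>Together with \<open>LR\<close> this says that each value of a fibre near
      \<open>p\<close> is above all fibres sufficiently close to \<open>p\<close>: the family stays
      above its limit.\<close>
    assume A: "after ltx p (\<lambda>y. \<not> (\<exists>v. E y v \<and> ?L v))"
    define Rec where "Rec s \<longleftrightarrow> (\<exists>w. E s w \<and> (\<forall>y. ltx p y \<longrightarrow> ltx y s \<longrightarrow> below ltv E y w))" for s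
    have "def_pred \<M> (\<lambda>e. Rec (e 0))"
      unfolding Rec_def by (intro def_pred_intros X.def_pred_lt dE)
    moreover have "\<not> after ltx p (\<lambda>y. \<not> Rec y)"
    proof
      assume "after ltx p (\<lambda>y. \<not> Rec y)"
      from X.after_interval[OF X.after_conj[OF A this] pq]
      obtain r where r: "ltx p r" "weak ltx r q"
          "\<And>y. ltx p y \<Longrightarrow> ltx y r \<Longrightarrow> (\<not> (\<exists>v. E y v \<and> ?L v) \<and> \<not> Rec y) \<and> ltx y q"
        by blast
      obtain x where x: "ltx p x" "ltx x r" using X.ord.dense[OF r(1)] by blast
      obtain v where v: "E x v" using stripD(1)[OF S x(1)] r(3)[OF x] by blast
      then have "?R v" using LR r(3)[OF x] by blast
      then obtain t where t: "ltx p t" "\<And>y. ltx p y \<Longrightarrow> ltx y t \<Longrightarrow> below ltv E y v"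
        unfolding after_def by blast
      \<comment> \<open>The record is at the infimum \<open>s\<close> of the points up to
        \<open>x\<close> whose fibre is not below \<open>v\<close>. If the fibre at \<open>s\<close>
        itself were below \<open>v\<close>, the fall after \<open>s\<close> would keep the next
        fibres below \<open>v\<close> as well.\<close>
      let ?S = "\<lambda>y. ltx p y \<and> \<not> ltx x y \<and> \<not> below ltv E y v"
      have Sx: "?S x" using x(1) v unfolding below_def by auto
      have "def_pred \<M> (\<lambda>e. ?S (e 0))"
        by (intro def_pred_intros X.def_pred_lt dE)
      then obtain s where s: "\<And>y. ?S y \<Longrightarrow> \<not> ltx y s" "\<And>u. ltx s u \<Longrightarrow> \<exists>y. ?S y \<and> ltx y u"
        using XC.definable_Sup[of ?S x p] Sx X.ord.less_asym unfolding conversep_iff by blast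
      have ps: "ltx p s"
      proof (rule ccontr)
        assume "\<not> ltx p s"
        then have "ltx s t" using t(1) by order
        then show False using s(2) t(2) by blast
      qed
      have "\<not> ltx x s" using s(1) Sx by blast
      then have sr: "ltx s r" using x(2) by order
      have "\<not> below ltv E s v"
      proof
        assume b: "below ltv E s v"
        obtain w where w: "E s w" using stripD(1)[OF S ps] r(3)[OF ps sr] by blast
        then have "ltv w v" using b unfolding below_def by blast
        obtain u where u: "ltx s u" "\<And>y. ltx s y \<Longrightarrow> ltx y u \<Longrightarrow> below ltv E y w"
          using F ps r(3)[OF ps sr] w unfolding falls_def after_def by blast
        obtain y where y: "?S y" "ltx y u" using s(2)[OF u(1)] by blast
        then have "ltx s y" using s(1)[OF y(1)] b by (metis X.ord.neqE)
        then have "below ltv E y w" using u(2) y(2) by blast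
        then have "below ltv E y v" using \<open>ltv w v\<close> V.ord.less_trans unfolding below_def by blast
        then show False using y(1) by blast
      qed
      then obtain w where w: "E s w" "\<not> ltv w v" unfolding below_def by blast
      have "below ltv E y w" if "ltx p y" "ltx y s" for y
      proof -
        have "ltx y x" using that(2) \<open>\<not> ltx x s\<close> by order
        then have "below ltv E y v" using s(1)[of y] that X.ord.less_asym by blast
        then show ?thesis unfolding below_def using w(2) by (metis V.ord.less_trans V.ord.neqE)
      qed
      then have "Rec s" using w(1) unfolding Rec_def by blast
      then show False using r(3)[OF ps sr] by blast
    qed
    ultimately have "after ltx p Rec" using X.after_dichotomy[of Rec p] by blast
    then obtain r where r: "ltx p r" "\<And>y. ltx p y \<Longrightarrow> ltx y r \<Longrightarrow> Rec y \<and> ltx y q"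
      using X.after_interval[OF _ pq] by blast
    \<comment> \<open>The points just after \<open>z\<close> are records too, and yet their fibres
      lie below a value of the fibre at \<open>z\<close>.\<close>
    obtain z where z: "ltx p z" "ltx z r" using X.ord.dense[OF r(1)] by blast
    have zq: "ltx z q" using r(2)[OF z] by blast
    obtain v where v: "E z v" using stripD(1)[OF S z(1) zq] by blast
    then have "after ltx z (\<lambda>y. below ltv E y v)" using F z(1) zq unfolding falls_def by blast
    from X.after_conj[OF this X.after_less[OF z(2)]]
    obtain y where y: "ltx z y" "below ltv E y v" "ltx y r" using X.after_ex by blast
    have "ltx p y" using z(1) y(1) by order
    then obtain w where "E y w" "below ltv E z w" using r(2)[of y] y z(1) unfolding Rec_def by blast
    then have "ltv w v" "ltv v w" using y(2) v unfolding below_def by blast+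
    then show False by order
  qed
  have "def_pred \<M> (\<lambda>e. \<exists>v. E (e 0) v \<and> ?L v)"
    by (intro def_pred_intros X.def_pred_after dE)
  then have B: "after ltx p (\<lambda>y. \<exists>v. E y v \<and> ?L v)"
    using X.after_dichotomy[of "\<lambda>y. \<exists>v. E y v \<and> ?L v" p] notA by blast
  define Good where "Good z \<longleftrightarrow>
    (\<exists>v. before ltx z (\<lambda>y. above ltv E y v) \<and> after ltx z (\<lambda>y. below ltv E y v))" for z
  have "def_pred \<M> (\<lambda>e. Good (e 0))"
    unfolding Good_def
    by (intro def_pred_intros X.def_pred_after XC.def_pred_after dE)
  moreover have "\<not> after ltx p (\<lambda>y. \<not> Good y)"
  proof
    assume "after ltx p (\<lambda>y. \<not> Good y)"
    from X.after_interval[OF X.after_conj[OF B this] pq]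
    obtain r where r: "ltx p r" "weak ltx r q"
        "\<And>y. ltx p y \<Longrightarrow> ltx y r \<Longrightarrow> ((\<exists>v. E y v \<and> ?L v) \<and> \<not> Good y) \<and> ltx y q"
      by blast
    obtain x where x: "ltx p x" "ltx x r" using X.ord.dense[OF r(1)] by blast
    obtain v where v: "E x v" "?L v" using r(3)[OF x] by blast
    then obtain t where t: "ltx p t" "\<And>y. ltx p y \<Longrightarrow> ltx y t \<Longrightarrow> above ltv E y v"
      unfolding after_def by blast
    let ?S = "\<lambda>y. ltx p y \<and> \<not> ltx x y \<and> \<not> above ltv E y v"
    have Sx: "?S x" using x(1) v unfolding below_def by auto
    have "def_pred \<M> (\<lambda>e. ?S (e 0))"
      by (intro def_pred_intros X.def_pred_lt dE)
    then obtain b where b: "\<And>y. ?S y \<Longrightarrow> \<not> ltx y b" "\<And>u. ltx b u \<Longrightarrow> \<exists>y. ?S y \<and> ltx y u"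
      using XC.definable_Sup[of ?S x p] Sx X.ord.less_asym unfolding conversep_iff by blast
    have pb: "ltx p b"
    proof (rule ccontr)
      assume "\<not> ltx p b"
      then have "ltx b t" using t(1) by order
      then show False using b(2) t(2) by blast
    qed
    have xb: "\<not> ltx x b" using b(1) Sx by blast
    then have br: "ltx b r" using x(2) by order
    then have bq: "ltx b q" using r(3)[OF pb] by blast
    have left: "above ltv E y v" if "ltx p y" "ltx y b" for y
    proof -
      have "\<not> ltx x y" using that(2) xb by order
      then show ?thesis using b(1)[of y] that by blast
    qed
    then have left': "before ltx b (\<lambda>y. ltx p y \<and> above ltv E y v)"
      unfolding after_def conversep_iff using pb by blast
    have bv: "above ltv E b v"
      unfolding below_def conversep_iff
    proof (intro allI impI, rule ccontr)
      fix w assume w: "E b w" "\<not> ltv v w"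
      have "before ltx b (\<lambda>y. below ltv E y w)"
        using G pb bq w(1) unfolding falls_def conversep_iff by blast
      from XC.after_conj[OF this left']
      obtain y where y: "ltx y b" "below ltv E y w" "ltx p y" "above ltv E y v"
        by (rule XC.after_ex) auto
      have "ltx y q" using y(1) bq by order
      then obtain u where "E y u" using stripD(1)[OF S y(3)] by blast
      then have "ltv u w" "ltv v u" using y(2,4) unfolding below_def by auto
      then show False using w(2) by order
    qed
    have "\<not> after ltx b (\<lambda>y. above ltv E y v)"
    proof
      assume "after ltx b (\<lambda>y. above ltv E y v)"
      then obtain u where u: "ltx b u" "\<And>y. ltx b y \<Longrightarrow> ltx y u \<Longrightarrow> above ltv E y v"
        unfolding after_def by blast
      obtain y where y: "?S y" "ltx y u" using b(2)[OF u(1)] by blast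
      then have "ltx b y" using b(1)[OF y(1)] bv by (metis X.ord.neqE)
      then show False using u(2) y by blast
    qed
    then have "after ltx b (\<lambda>y. below ltv E y v)"
      using strip_away[OF S _ bq, of v] pb unfolding weak_def by blast
    moreover have "before ltx b (\<lambda>y. above ltv E y v)"
      using left' by (rule XC.after_mono) blast
    ultimately have "Good b" unfolding Good_def by blast
    then show False using r(3)[OF pb br] by blast
  qed
  ultimately have "after ltx p Good" using X.after_dichotomy[of Good p] by blast
  then obtain r where r: "ltx p r" "weak ltx r q" "\<And>y. ltx p y \<Longrightarrow> ltx y r \<Longrightarrow> Good y \<and> ltx y q"
    by (rule X.after_interval[OF _ pq]) auto
  show thesis
    by (rule that[OF r(1,2)]) (use r(3) in \<open>simp add: Good_def\<close>)
qed

text \<open>Applied from both ends, \<open>strip_jump\<close> gives jumps in opposite directions at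
  a common point \<open>z\<close>, across values \<open>v\<close> and \<open>v'\<close>. In the
  order \<open>ltv\<close>, a fibre after \<open>z\<close> forces \<open>v'\<close> before
  \<open>v\<close>, and a fibre before \<open>z\<close> forces \<open>v\<close> before
  \<open>v'\<close>.\<close>

lemma strip_not_falls_both:
  assumes S: "strip \<M> ltx ltv p q E"
    and F: "falls ltx ltv p q E" and G: "falls ltx\<inverse>\<inverse> ltv q p E"
  shows False
proof -
  interpret F: tame_plane \<M> "ltx\<inverse>\<inverse>" ltv by (rule flip_x)
  obtain r where r: "ltx p r" "weak ltx r q"
    "\<And>z. ltx p z \<Longrightarrow> ltx z r \<Longrightarrow>
      \<exists>v. before ltx z (\<lambda>y. above ltv E y v) \<and> after ltx z (\<lambda>y. below ltv E y v)"
    using strip_jump[OF assms] by blast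
  have pp: "weak ltx p p" by (simp add: weak_def)
  have st: "strip \<M> ltx\<inverse>\<inverse> ltv r p E"
    unfolding strip_flip_x using strip_mono[OF S pp r(1,2)] .
  have fa: "falls ltx\<inverse>\<inverse> ltv r p E"
    using F.falls_mono[OF G, of r p E] r(2) pp by (simp add: weak_converse)
  have fb: "falls ltx ltv p r E" using falls_mono[OF F pp r(2)] by blast
  obtain r' where r': "ltx r' r" "weak ltx p r'"
    "\<And>z. ltx r' z \<Longrightarrow> ltx z r \<Longrightarrow>
      \<exists>v. after ltx z (\<lambda>y. above ltv E y v) \<and> before ltx z (\<lambda>y. below ltv E y v)"
    by (rule F.strip_jump[of r p E, unfolded conversep_conversep, OF st fa fb])
      (simp add: weak_converse)
  obtain z where z: "ltx r' z" "ltx z r" using X.ord.dense[OF r'(1)] by blast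
  have pz: "ltx p z" and zq: "ltx z q" using z r'(2) r(2) by order+
  obtain v where v: "before ltx z (\<lambda>y. above ltv E y v)" "after ltx z (\<lambda>y. below ltv E y v)"
    using r(3)[OF pz z(2)] by blast
  obtain v' where v': "after ltx z (\<lambda>y. above ltv E y v')" "before ltx z (\<lambda>y. below ltv E y v')"
    using r'(3)[OF z] by blast
  obtain y where y: "ltx z y" "below ltv E y v" "above ltv E y v'" "ltx y q"
    by (rule X.after_ex[OF X.after_conj[OF X.after_conj[OF v(2) v'(1)] X.after_less[OF zq]]]) auto
  have "ltx p y" using pz y(1) by order
  then obtain w where "E y w" using stripD(1)[OF S _ y(4)] by blast
  then have 1: "ltv w v" "ltv v' w" using y(2,3) unfolding below_def by auto
  have "before ltx z (\<lambda>y. ltx p y)" unfolding after_def conversep_iff using pz by blast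
  from XC.after_conj[OF XC.after_conj[OF v(1) v'(2)] this]
  obtain y where y: "ltx y z" "below ltv E y v'" "above ltv E y v" "ltx p y"
    by (rule XC.after_ex) auto
  have "ltx y q" using zq y(1) by order
  then obtain w where "E y w" using stripD(1)[OF S y(4)] by blast
  then have "ltv w v'" "ltv v w" using y(2,3) unfolding below_def by auto
  then show False using 1 by order
qed

end



section \<open>Graphs over an interval are not discrete\<close>

context tame begin

text \<open>Each point of the graph is alone in a horizontal band, so the graph is a discrete subset
  of the plane; but its first coordinates fill an interval, against
  \<open>discrete_coordinate\<close>.\<close>

lemma no_isolated_graph:
  assumes "def_pred \<M> (\<lambda>e. G (e 0) (e 1))" "p < q"
    and "\<And>x. p < x \<Longrightarrow> x < q \<Longrightarrow> \<exists>v. G x v"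
    and "\<And>x v. G x v \<Longrightarrow> p < x \<and> x < q"
    and "\<And>x v. G x v \<Longrightarrow> \<exists>k l. k < v \<and> v < l \<and> (\<forall>y w. G y w \<longrightarrow> k < w \<longrightarrow> w < l \<longrightarrow> y = x \<and> w = v)"
  shows False
proof -
  define X where "X = {x \<in> cart_power 2. G (x 0) (x 1)}"
  have "restrict e {..<2} \<in> X \<longleftrightarrow> G (e 0) (e 1)" for e by (simp add: X_def)
  then have "definable \<M> 2 X"
    using assms(1) unfolding definable_iff_def_pred by (auto simp: X_def)
  moreover have "discrete_in_power 2 X"
    unfolding discrete_in_power_iff
  proof (intro conjI ballI)
    fix x assume x: "x \<in> X"
    then have "G (x 0) (x 1)" by (simp add: X_def)
    from assms(5)[OF this] obtain k l where kl: "k < x 1" "x 1 < l"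
        "\<And>y w. G y w \<Longrightarrow> k < w \<Longrightarrow> w < l \<Longrightarrow> y = x 0 \<and> w = x 1"
      by blast
    have px: "p < x 0" "x 0 < q" using assms(4)[of "x 0" "x 1"] x unfolding X_def by auto
    let ?a = "\<lambda>i::nat. if i = 0 then p else k" and ?b = "\<lambda>i::nat. if i = 0 then q else l"
    have two: "i \<in> {..<2} \<longleftrightarrow> i = 0 \<or> i = 1" for i :: nat by auto
    have "x \<in> extensional {..<2}" using x by (auto simp: X_def PiE_iff)
    then have "x \<in> box {..<2} ?a ?b"
      using px kl(1,2) by (auto simp: mem_box less_2_cases_iff)
    moreover have "y = x" if "y \<in> X" "y \<in> box {..<2} ?a ?b" for y
    proof
      fix i
      have "\<forall>i\<in>{..<2}. ?a i < y i \<and> y i < ?b i" using that(2) by (simp add: mem_box)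
      from this[THEN bspec, of 1] have "G (y 0) (y 1)" "k < y 1" "y 1 < l"
        using that(1) by (auto simp: X_def)
      then have "y 0 = x 0" "y 1 = x 1" using kl(3) by blast+
      moreover have "y i = x i" if "i \<notin> {..<2}"
        using that x \<open>y \<in> X\<close> by (auto simp: X_def PiE_iff extensional_def)
      ultimately show "y i = x i" using two[of i] by fastforce
    qed
    ultimately show "\<exists>a b. x \<in> box {..<2} a b \<and> X \<inter> box {..<2} a b \<subseteq> {x}" by blast
  qed (auto simp: X_def)
  ultimately obtain t where t: "p < t" "t < q" "t \<notin> (\<lambda>x. x 0) ` X"
    by (rule discrete_coordinate[of 2 X 0 p q]) (use assms(2) in auto)
  then obtain v where "G t v" using assms(3) by blast
  then have "(\<lambda>i\<in>{..<2::nat}. if i = 0 then t else v) \<in> X" by (auto simp: X_def)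
  then have "t \<in> (\<lambda>x. x 0) ` X" by (rule rev_image_eqI) simp
  then show False using t(3) by blast
qed

end

context tame_plane begin

lemma no_isolated_oriented_graph:
  assumes "def_pred \<M> (\<lambda>e. G (e 0) (e 1))" "ltx p q"
    and "\<And>x. ltx p x \<Longrightarrow> ltx x q \<Longrightarrow> \<exists>v. G x v"
    and "\<And>x v. G x v \<Longrightarrow> ltx p x \<and> ltx x q"
    and "\<And>x v. G x v \<Longrightarrow> \<exists>k l. ltv k v \<and> ltv v l \<and> (\<forall>y w. G y w \<longrightarrow> ltv k w \<longrightarrow> ltv w l \<longrightarrow> y = x \<and> w = v)"
  shows False
proof -
  have 5: "\<exists>k l. k < v \<and> v < l \<and> (\<forall>y w. G y w \<longrightarrow> k < w \<longrightarrow> w < l \<longrightarrow> y = x \<and> w = v)" if "G x v" for x v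
    using V.orientation
  proof
    assume "ltv = (<)"
    then show ?thesis using assms(5)[OF that] by simp
  next
    assume "ltv = (>)"
    then show ?thesis using assms(5)[OF that] by blast
  qed
  show False
    using X.orientation
  proof
    assume "ltx = (<)"
    then show False using no_isolated_graph[OF assms(1), of p q] assms(2-4) 5 by simp
  next
    assume "ltx = (>)"
    then show False using no_isolated_graph[OF assms(1), of q p] assms(2-4) 5 by simp
  qed
qed

text \<open>
  Here the members of the family are pairwise disjoint and decreasing, so their end points form a
  definable graph which is a discrete set.
\<close>

lemma strip_not_monotone:
  assumes S: "strip \<M> ltx ltv p q E"
    and F: "falls ltx ltv p q E" and G: "falls ltx\<inverse>\<inverse> ltv\<inverse>\<inverse> q p E"
  shows False
proof -
  have pq: "ltx p q" using S unfolding strip_def by blast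
  note dE = strip_definable[OF S] strip_definable_below[OF S]
  \<comment> \<open>Local decrease becomes global: consider the infimum \<open>b\<close> of the
    exceptions. Just before \<open>b\<close> the fibres are above the values of the fibre at
    \<open>b\<close> and still below \<open>v\<close>, so the fibre at \<open>b\<close> is below
    \<open>v\<close>; the fall after \<open>b\<close> then leaves no exceptions near
    \<open>b\<close>.\<close>
  have decr: "below ltv E y v" if x: "ltx p x" "ltx x y" "ltx y q" "E x v" for x y v
  proof (rule ccontr)
    assume neg: "\<not> below ltv E y v"
    let ?S = "\<lambda>z. ltx x z \<and> \<not> below ltv E z v"
    have "def_pred \<M> (\<lambda>e. ?S (e 0))"
      by (intro def_pred_intros X.def_pred_lt dE)
    then obtain b where b: "\<And>y. ?S y \<Longrightarrow> \<not> ltx y b" "\<And>u. ltx b u \<Longrightarrow> \<exists>y. ?S y \<and> ltx y u"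
      using XC.definable_Sup[of ?S y x] neg x(2) X.ord.less_asym unfolding conversep_iff by blast
    have xq: "ltx x q" using x by order
    obtain t where t: "ltx x t" "\<And>y. ltx x y \<Longrightarrow> ltx y t \<Longrightarrow> below ltv E y v"
      using F x(1,4) xq unfolding falls_def after_def by blast
    have xb: "ltx x b"
    proof (rule ccontr)
      assume "\<not> ltx x b"
      then have "ltx b t" using t(1) by order
      then show False using b(2) t(2) by blast
    qed
    have "\<not> ltx y b" using b(1) neg x(2) by blast
    then have bq: "ltx b q" using x(3) by order
    have pb: "ltx p b" using x(1) xb by order
    have left: "before ltx b (\<lambda>y. ltx x y \<and> ltx y b \<and> below ltv E y v)"
      unfolding after_def conversep_iff using xb b(1) by blast
    have bv: "below ltv E b v"
      unfolding below_def
    proof (intro allI impI)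
      fix w assume w: "E b w"
      have "before ltx b (\<lambda>y. above ltv E y w)"
        using G pb bq w unfolding falls_def conversep_iff by blast
      from XC.after_conj[OF this left]
      obtain z where z: "above ltv E z w" "ltx x z" "ltx z b" "below ltv E z v"
        by (rule XC.after_ex) auto
      have "ltx p z" "ltx z q" using x(1) z(2,3) bq by order+
      then obtain u where "E z u" using stripD(1)[OF S] by blast
      then have "ltv w u" "ltv u v" using z(1,4) unfolding below_def by auto
      then show "ltv w v" by order
    qed
    obtain w where w: "E b w" using stripD(1)[OF S pb bq] by blast
    then have wv: "ltv w v" using bv unfolding below_def by blast
    obtain u where u: "ltx b u" "\<And>y. ltx b y \<Longrightarrow> ltx y u \<Longrightarrow> below ltv E y w"
      using F pb bq w unfolding falls_def after_def by blast
    obtain z where z: "?S z" "ltx z u" using b(2)[OF u(1)] by blast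
    then have "ltx b z" using b(1)[OF z(1)] bv by (metis X.ord.neqE)
    then have "below ltv E z w" using u(2) z(2) by blast
    then have "below ltv E z v" using wv V.ord.less_trans unfolding below_def by blast
    then show False using z(1) by blast
  qed
  \<comment> \<open>\<open>A x v\<close> will say that \<open>v\<close> is the lower end point of
    the fibre at \<open>x\<close>. For \<open>x\<close> before \<open>c\<close> it exists, because
    by \<open>decr\<close> the fibre at \<open>c\<close> provides a lower bound.\<close>
  obtain c where c: "ltx p c" "ltx c q" using X.ord.dense[OF pq] by blast
  define A where "A x v \<longleftrightarrow> ltx p x \<and> ltx x c \<and> (\<forall>w. E x w \<longrightarrow> \<not> ltv w v)
    \<and> (\<forall>u. ltv v u \<longrightarrow> (\<exists>w. E x w \<and> ltv w u))" for x v
  have dA: "def_pred \<M> (\<lambda>e. A (e 0) (e 1))"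
    unfolding A_def by (intro def_pred_intros X.def_pred_lt V.def_pred_lt dE)
  have xq: "ltx x q" if "ltx x c" for x using that c(2) by order
  have A_ge: "\<not> ltv w v" if "A x v" "E x w" for x v w using that unfolding A_def by blast
  have A_lim: "\<exists>w. E x w \<and> ltv w u" if "A x v" "ltv v u" for x v u using that unfolding A_def by blast
  have A_dom: "ltx p x" "ltx x q" if "A x v" for x v using that xq unfolding A_def by blast+
  have ex: "\<exists>v. A x v" if x: "ltx p x" "ltx x c" for x
  proof -
    obtain w where w: "E x w" using stripD(1)[OF S x(1) xq[OF x(2)]] by blast
    obtain u where u: "E c u" using stripD(1)[OF S c] by blast
    have "\<not> ltv z u" if "E x z" for z
      using decr[OF x c(2) that] u V.ord.less_asym unfolding below_def by blast
    moreover have "def_pred \<M> (\<lambda>e. E x (e 0))" by (intro dE accessor_const accessor_var)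
    ultimately obtain v where "\<And>w. E x w \<Longrightarrow> \<not> ltv w v" "\<And>u. ltv v u \<Longrightarrow> \<exists>w. E x w \<and> ltv w u"
      using VC.definable_Sup[of "E x" w u] w unfolding conversep_iff by blast
    then show ?thesis using x unfolding A_def by blast
  qed
  have less_A: False if xy: "A x v" "A y w" "ltx x y" and vw: "weak ltv v w" for x y v w
  proof -
    obtain u where "E y u" using stripD(1)[OF S A_dom[OF xy(2)]] by blast
    then obtain u where u: "E y u" "ltv w u"
      using stripD(3)[OF S A_dom[OF xy(2)]] A_ge[OF xy(2)] by (metis V.ord.neqE V.ord.less_trans)
    have "ltv v u" using u(2) vw by order
    then obtain t where t: "E x t" "ltv t u" using A_lim[OF xy(1)] by blast
    have "below ltv E y t" using decr[OF A_dom(1)[OF xy(1)] xy(3) A_dom(2)[OF xy(2)] t(1)] .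
    then have "ltv u t" using u(1) unfolding below_def by blast
    then show False using t(2) by order
  qed
  have A_fun: "v = w" if "A x v" "A x w" for x v w
    using A_lim A_ge that by (metis V.ord.neqE)
  have A_inj: "x = y" if "A x v" "A y v" for x y v
    using less_A[OF that, unfolded weak_def] less_A[OF that(2,1), unfolded weak_def]
    by (metis X.ord.neqE)
  let ?Im = "\<lambda>v. \<exists>x. A x v"
  have dI: "def_pred \<M> (\<lambda>e. ?Im (e 0))"
    by (intro def_pred_intros def_pred_app2[OF dA])
  \<comment> \<open>An end point \<open>w\<close> of another fibre just above \<open>v\<close> would
    lie in the fibre at \<open>x\<close>; then this fibre would overlap the fibre ending at
    \<open>w\<close>, while \<open>decr\<close> keeps the two apart.\<close>
  have right: "after ltv v (\<lambda>w. \<not> ?Im w)" if xv: "A x v" for x v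
  proof (rule ccontr)
    assume "\<not> ?thesis"
    then have I: "after ltv v ?Im" using V.after_dichotomy[OF dI] by blast
    obtain u0 where "E x u0" using stripD(1)[OF S A_dom[OF xv]] by blast
    then obtain u where u: "E x u" "ltv v u"
      using stripD(3)[OF S A_dom[OF xv]] A_ge[OF xv] by (metis V.ord.neqE V.ord.less_trans)
    from V.after_conj[OF I V.after_less[OF u(2)]]
    obtain w y where w: "A y w" "ltv v w" "ltv w u" using V.after_ex by blast
    have "ltx y x"
    proof (rule ccontr)
      assume "\<not> ltx y x"
      moreover have "y \<noteq> x" using A_fun xv w by (metis V.ord.less_irrefl)
      ultimately show False using less_A[OF xv w(1)] w(2) by (metis X.ord.neqE weak_def)
    qed
    obtain t where "E x t" "ltv t w" using A_lim[OF xv w(2)] by blast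
    then have Exw: "E x w" using stripD(4)[OF S A_dom[OF xv] _ u(1) _ w(3)] by blast
    then obtain t where t: "E x t" "ltv w t" using stripD(3)[OF S A_dom[OF xv]] by blast
    then obtain s where s: "E y s" "ltv s t" using A_lim[OF w(1)] by blast
    have "below ltv E x s" using decr[OF A_dom(1)[OF w(1)] \<open>ltx y x\<close> A_dom(2)[OF xv] s(1)] .
    then have "ltv t s" using t(1) unfolding below_def by blast
    then show False using s(2) by order
  qed
  \<comment> \<open>Otherwise end points fill an interval just below \<open>v\<close>; but by
    \<open>right\<close> none of them has further end points immediately above it.\<close>
  have left: "before ltv v (\<lambda>w. \<not> ?Im w)" for v
  proof (rule ccontr)
    assume "\<not> ?thesis"
    then have "before ltv v ?Im" using VC.after_dichotomy[OF dI] by blast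
    then obtain k where k: "ltv k v" "\<And>w. ltv k w \<Longrightarrow> ltv w v \<Longrightarrow> ?Im w"
      unfolding after_def conversep_iff by blast
    obtain w where w: "ltv k w" "ltv w v" using V.ord.dense[OF k(1)] by blast
    then have R: "after ltv w (\<lambda>w. \<not> ?Im w)" using right k(2) by blast
    obtain u where "ltv w u" "\<not> ?Im u" "ltv u v"
      using V.after_ex[OF V.after_conj[OF R V.after_less[OF w(2)]]] by blast
    moreover have "ltv k u" using w(1) \<open>ltv w u\<close> by order
    ultimately show False using k(2) by blast
  qed
  show False
  proof (rule no_isolated_oriented_graph[OF dA c(1) ex])
    fix x v assume xv: "A x v"
    then show "ltx p x \<and> ltx x c" unfolding A_def by blast
    obtain k where k: "ltv k v" "\<And>w. ltv k w \<Longrightarrow> ltv w v \<Longrightarrow> \<not> ?Im w"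
      using left[of v] unfolding after_def conversep_iff by blast
    obtain l where l: "ltv v l" "\<And>w. ltv v w \<Longrightarrow> ltv w l \<Longrightarrow> \<not> ?Im w"
      using right[OF xv] unfolding after_def by blast
    have "y = x \<and> w = v" if w: "A y w" "ltv k w" "ltv w l" for y w
    proof -
      have "w = v" using k(2)[of w] l(2)[of w] w by (metis V.ord.neqE)
      then show ?thesis using A_inj[OF w(1)] xv by blast
    qed
    then show "\<exists>k l. ltv k v \<and> ltv v l \<and> (\<forall>y w. A y w \<longrightarrow> ltv k w \<longrightarrow> ltv w l \<longrightarrow> y = x \<and> w = v)"
      using k(1) l(1) by blast
  qed
qed

text \<open>Fixing the direction to the right of the points and then, on a smaller interval, to the
  left leaves four patterns. Reversing the order of values reduces them to the two already
  excluded.\<close>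

lemma no_strip: "\<not> strip \<M> ltx ltv p q E"
proof
  assume S: "strip \<M> ltx ltv p q E"
  interpret Fx: tame_plane \<M> "ltx\<inverse>\<inverse>" ltv by (rule flip_x)
  interpret Fv: tame_plane \<M> ltx "ltv\<inverse>\<inverse>" by (rule flip_v)
  obtain q' E' where 1: "strip \<M> ltx ltv p q' E'" "falls ltx ltv p q' E' \<or> falls ltx ltv\<inverse>\<inverse> p q' E'"
    by (rule strip_one_side[OF S]) (rule that)
  then have Sx: "strip \<M> ltx\<inverse>\<inverse> ltv q' p E'" unfolding strip_flip_x by blast
  obtain p' E'' where 2: "ltx\<inverse>\<inverse> q' p'" "weak ltx\<inverse>\<inverse> p' p" "strip \<M> ltx\<inverse>\<inverse> ltv q' p' E''"
      "\<And>x v. E'' x v \<Longrightarrow> E' x v"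
      "falls ltx\<inverse>\<inverse> ltv q' p' E'' \<or> falls ltx\<inverse>\<inverse> ltv\<inverse>\<inverse> q' p' E''"
    by (rule Fx.strip_one_side[OF Sx]) (rule that)
  have S: "strip \<M> ltx ltv p' q' E''" using 2(3) unfolding strip_flip_x .
  then have Sv: "strip \<M> ltx ltv\<inverse>\<inverse> p' q' E''" unfolding strip_flip_v .
  have w: "weak ltx p p'" "weak ltx q' q'" using 2(2) unfolding weak_converse by (auto simp: weak_def)
  have "falls ltx ltv p' q' E'' \<or> falls ltx ltv\<inverse>\<inverse> p' q' E''"
    using 1(2) falls_mono[of p q' E' p' q' E''] Fv.falls_mono[of p q' E' p' q' E''] w 2(4) by blast
  then show False
    using 2(5) strip_not_falls_both[OF S] strip_not_monotone[OF S]
      Fv.strip_not_falls_both[OF Sv] Fv.strip_not_monotone[OF Sv]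
    unfolding conversep_conversep by blast
qed

text \<open>If no value lasted over an interval, the first components of the sets \<open>U x\<close>
  beyond \<open>c\<close> would form a strip. The bound \<open>c\<close> guarantees that there is a
  first component, and openness leaves it without end points. \<open>E\<close> expresses it without
  connectedness: \<open>v\<close> is joined inside \<open>U x\<close> to every member of
  \<open>U x\<close> between \<open>c\<close> and \<open>v\<close>.\<close>

lemma first_component_contains_constant:
  assumes dO: "def_pred \<M> (\<lambda>e. U (e 0) (e 1))" and pq: "ltx p q"
    and U_open: "\<And>x v. U x v \<Longrightarrow> after ltv v (U x) \<and> before ltv v (U x)"
    and ex: "\<And>x. ltx p x \<Longrightarrow> ltx x q \<Longrightarrow> \<exists>v. ltv c v \<and> U x v"
  obtains v a b where "weak ltx p a" "ltx a b" "weak ltx b q" "\<And>x. ltx a x \<Longrightarrow> ltx x b \<Longrightarrow> U x v"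
proof (rule ccontr)
  assume "\<not> thesis"
  then have no: "\<exists>x. ltx a x \<and> ltx x b \<and> \<not> U x v"
    if "weak ltx p a" "ltx a b" "weak ltx b q" for v a b
    using that \<open>\<And>v a b. \<lbrakk>weak ltx p a; ltx a b; weak ltx b q; \<And>x. ltx a x \<Longrightarrow> ltx x b \<Longrightarrow> U x v\<rbrakk> \<Longrightarrow> thesis\<close>
    by meson
  note dU = def_pred_app2[OF dO]
  define E where "E x v \<longleftrightarrow> ltv c v \<and> U x v \<and>
    (\<forall>u. ltv c u \<longrightarrow> ltv u v \<longrightarrow> U x u \<longrightarrow> (\<forall>w. ltv u w \<longrightarrow> ltv w v \<longrightarrow> U x w))" for x v
  have "def_pred \<M> (\<lambda>e. E (e 0) (e 1))"
    unfolding E_def by (intro def_pred_intros V.def_pred_lt dU)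
  moreover have "\<exists>v. E x v" if x: "ltx p x" "ltx x q" for x
  proof -
    let ?S = "\<lambda>v. ltv c v \<and> U x v"
    have dS: "def_pred \<M> (\<lambda>e. ?S (e 0))"
      by (intro def_pred_intros V.def_pred_lt dU)
    obtain v0 where "?S v0" using ex[OF x] by blast
    then obtain s where s: "\<And>v. ?S v \<Longrightarrow> \<not> ltv v s" "\<And>u. ltv s u \<Longrightarrow> \<exists>v. ?S v \<and> ltv v u"
      using VC.definable_Sup[OF dS, of v0 c] V.ord.less_asym unfolding conversep_iff by blast
    have "after ltv s ?S"
    proof (rule ccontr)
      assume "\<not> ?thesis"
      then obtain u where u: "ltv s u" "\<And>w. ltv s w \<Longrightarrow> ltv w u \<Longrightarrow> \<not> ?S w"
        using V.after_dichotomy[OF dS, of s] unfolding after_def by blast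
      obtain v where v: "?S v" "ltv v u" using s(2)[OF u(1)] by blast
      then have vs: "v = s" using s(1)[OF v(1)] u(2) by (metis V.ord.neqE)
      then have "after ltv s (U x)" using U_open v(1) by blast
      from V.after_conj[OF this V.after_less[OF u(1)]]
      obtain w where w: "ltv s w" "U x w" "ltv w u" by (rule V.after_ex) auto
      moreover have "ltv c w" using w(1) v(1)[THEN conjunct1] vs by order
      ultimately show False using u(2) by blast
    qed
    then obtain t where t: "ltv s t" "\<And>w. ltv s w \<Longrightarrow> ltv w t \<Longrightarrow> ?S w" unfolding after_def by blast
    obtain v where v: "ltv s v" "ltv v t" using V.ord.dense[OF t(1)] by blast
    have "U x w" if u: "ltv c u" "ltv u v" "U x u" "ltv u w" "ltv w v" for u w
    proof -
      have "\<not> ltv u s" using s(1) u by blast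
      then have "ltv s w" "ltv w t" using u v by order+
      then show ?thesis using t(2) by blast
    qed
    then have "E x v" using t(2)[OF v] unfolding E_def by blast
    then show ?thesis by blast
  qed
  moreover have "(\<exists>w. E x w \<and> ltv w v) \<and> (\<exists>w. E x w \<and> ltv v w)" if v: "E x v" for x v
  proof
    have c: "ltv c v" "U x v" using v unfolding E_def by blast+
    have "before ltv v (\<lambda>w. ltv c w)" unfolding after_def conversep_iff using c by blast
    from VC.after_conj[OF U_open[OF c(2), THEN conjunct2] this]
    obtain w where w: "ltv w v" "U x w" "ltv c w" by (rule VC.after_ex) auto
    have "E x w"
      using v w V.ord.less_trans unfolding E_def by blast
    then show "\<exists>w. E x w \<and> ltv w v" using w by blast
    obtain t where t: "ltv v t" "\<And>w. ltv v w \<Longrightarrow> ltv w t \<Longrightarrow> U x w"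
      using U_open[OF c(2)] unfolding after_def by blast
    obtain w where w: "ltv v w" "ltv w t" using V.ord.dense[OF t(1)] by blast
    have "U x z" if u: "ltv c u" "ltv u w" "U x u" "ltv u z" "ltv z w" for u z
    proof (cases "ltv v z")
      case True
      then show ?thesis using t(2) u(5) w(2) V.ord.less_trans by blast
    next
      case False
      show ?thesis
      proof (cases "z = v")
        case True
        then show ?thesis using c(2) by simp
      next
        case neq: False
        then have "ltv z v" "ltv u v" using False u(4) by order+
        then show ?thesis using v u unfolding E_def by blast
      qed
    qed
    moreover have "ltv c w" using c(1) w(1) by order
    ultimately have "E x w" using t(2)[OF w] unfolding E_def by blast
    then show "\<exists>w. E x w \<and> ltv v w" using w by blast
  qed
  moreover have "E x v" if E: "E x u" "E x w" "ltv u v" "ltv v w" for x u v w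
  proof -
    have c: "ltv c u" "U x u" using E(1) unfolding E_def by blast+
    have uw: "ltv u w" "ltv c v" using E(3,4) c(1) by order+
    then have "U x v" using E(2) c E(3,4) unfolding E_def by blast
    moreover have "U x z" if "ltv c t" "ltv t v" "U x t" "ltv t z" "ltv z v" for t z
    proof -
      have "ltv t w" "ltv z w" using that E(4) by order+
      then show ?thesis using E(2) that unfolding E_def by blast
    qed
    ultimately show ?thesis using uw(2) unfolding E_def by blast
  qed
  moreover have "\<exists>x. ltx a x \<and> ltx x b \<and> \<not> E x v"
    if "weak ltx p a" "ltx a b" "weak ltx b q" for v a b
    using no[OF that, of v] unfolding E_def by blast
  ultimately have "strip \<M> ltx ltv p q E"
    unfolding strip_def using pq by (intro conjI; blast)
  then show False using no_strip by blast
qed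

end

context tame begin

text \<open>The fibres of \<open>Q\<close> are replaced by their interiors, which are open. Since
  these may be unbounded on both sides, the line is cut at an arbitrary \<open>c\<close>. Near
  \<open>p\<close> all interiors have points on one and the same side of \<open>c\<close>, and first
  components are counted from \<open>c\<close> in that direction.\<close>

lemma constant_on_interval:
  assumes dQ: "def_pred \<M> (\<lambda>e. Q (e 0) (e 1))" and pq: "p < q"
    and int: "\<And>x. p < x \<Longrightarrow> x < q \<Longrightarrow> \<exists>a b. a < b \<and> (\<forall>v. a < v \<and> v < b \<longrightarrow> Q x v)"
  obtains v a b where "p \<le> a" "a < b" "b \<le> q" "\<And>x. a < x \<Longrightarrow> x < b \<Longrightarrow> Q x v"
proof -
  interpret U: tame_plane \<M> "(<)" "(<)" by unfold_locales auto
  interpret D: tame_plane \<M> "(<)" "(>)" by unfold_locales auto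
  have w: "weak (<) = ((\<le>) :: 'a \<Rightarrow> _)" by (auto simp: weak_def fun_eq_iff)
  define U where "U x v \<longleftrightarrow> (\<exists>a b. a < v \<and> v < b \<and> (\<forall>w. a < w \<and> w < b \<longrightarrow> Q x w))" for x v
  note dQ' = def_pred_app2[OF dQ]
  have dU: "def_pred \<M> (\<lambda>e. U (e 0) (e 1))"
    unfolding U_def by (intro def_pred_intros dQ')
  have op: "after (<) v (U x) \<and> after (>) v (U x)" if Uxv: "U x v" for x v
  proof -
    obtain a b where ab: "a < v" "v < b" "\<forall>w. a < w \<and> w < b \<longrightarrow> Q x w" using Uxv unfolding U_def by blast
    then have "U x w" if "a < w" "w < b" for w using that unfolding U_def by blast
    then show ?thesis unfolding after_def using ab less_trans by blast
  qed
  have gt: "((<) :: 'a \<Rightarrow> _)\<inverse>\<inverse> = (>)" "((>) :: 'a \<Rightarrow> _)\<inverse>\<inverse> = (<)" by (auto simp: fun_eq_iff)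
  have UQ: "U x v \<Longrightarrow> Q x v" for x v unfolding U_def by blast
  fix c :: 'a
  let ?P = "\<lambda>x. \<exists>v. c < v \<and> U x v" and ?N = "\<lambda>x. \<exists>v. v < c \<and> U x v"
  have "def_pred \<M> (\<lambda>e. ?P (e 0))" by (intro def_pred_intros def_pred_app2[OF dU])
  moreover have "?P x \<or> ?N x" if x: "p < x" "x < q" for x
  proof -
    obtain a b where ab: "a < b" "\<forall>v. a < v \<and> v < b \<longrightarrow> Q x v" using int[OF x] by blast
    obtain v where v: "a < v" "v < b" using dense[OF ab(1)] by blast
    obtain u where u: "v < u" "u < b" using dense[OF v(2)] by blast
    have "U x v" "U x u" using ab v u less_trans unfolding U_def by blast+
    then show ?thesis using u(1) by (metis neqE)
  qed
  ultimately obtain q' where q': "p < q'" "q' \<le> q"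
      "(\<forall>x. p < x \<longrightarrow> x < q' \<longrightarrow> ?P x) \<or> (\<forall>x. p < x \<longrightarrow> x < q' \<longrightarrow> ?N x)"
    using U.X.interval_split[of ?P p q ?N] pq unfolding w by blast
  from q'(3) show thesis
  proof
    assume P: "\<forall>x. p < x \<longrightarrow> x < q' \<longrightarrow> ?P x"
    show thesis
    proof (rule U.first_component_contains_constant[OF dU q'(1), of c])
      fix x v assume "U x v"
      then show "after (<) v (U x) \<and> before (<) v (U x)" using op unfolding gt by blast
    next
      fix x assume "p < x" "x < q'"
      then show "\<exists>v. c < v \<and> U x v" using P by blast
    next
      fix v a b
      assume ab: "weak (<) p a" "a < b" "weak (<) b q'" and U: "\<And>x. a < x \<Longrightarrow> x < b \<Longrightarrow> U x v"
      show thesis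
        by (rule that[of a b v]) (use ab q'(2) UQ[OF U] in \<open>auto simp: w\<close>)
    qed
  next
    assume P: "\<forall>x. p < x \<longrightarrow> x < q' \<longrightarrow> ?N x"
    show thesis
    proof (rule D.first_component_contains_constant[OF dU q'(1), of c])
      fix x v assume "U x v"
      then show "after (>) v (U x) \<and> before (>) v (U x)" using op unfolding gt by blast
    next
      fix x assume "p < x" "x < q'"
      then show "\<exists>v. v < c \<and> U x v" using P by blast
    next
      fix v a b
      assume ab: "weak (<) p a" "a < b" "weak (<) b q'" and U: "\<And>x. a < x \<Longrightarrow> x < b \<Longrightarrow> U x v"
      show thesis
        by (rule that[of a b v]) (use ab q'(2) UQ[OF U] in \<open>auto simp: w\<close>)
    qed
  qed
qed

end

section \<open>Constants on boxes\<close>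


definition subbox ::
    "nat set \<Rightarrow> (nat \<Rightarrow> 'a::linorder) \<Rightarrow> (nat \<Rightarrow> 'a) \<Rightarrow> (nat \<Rightarrow> 'a) \<Rightarrow> (nat \<Rightarrow> 'a) \<Rightarrow> bool" where
  "subbox I a b a' b' \<longleftrightarrow> (\<forall>i\<in>I. a i \<le> a' i \<and> a' i < b' i \<and> b' i \<le> b i)"

lemma subbox_refl: "(\<And>i. i \<in> I \<Longrightarrow> a i < b i) \<Longrightarrow> subbox I a b a b"
  by (simp add: subbox_def)

lemma subbox_trans: "subbox I a b a' b' \<Longrightarrow> subbox I a' b' a'' b'' \<Longrightarrow> subbox I a b a'' b''"
  unfolding subbox_def by (meson order_trans)

lemma subbox_less: "subbox I a b a' b' \<Longrightarrow> i \<in> I \<Longrightarrow> a' i < b' i"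
  unfolding subbox_def by blast

lemma subbox_mem: "subbox I a b a' b' \<Longrightarrow> x \<in> box I a' b' \<Longrightarrow> x \<in> box I a b"
  unfolding subbox_def mem_box by (meson le_less_trans less_le_trans)

lemma box_empty: "box {} a b = {\<lambda>_. undefined}"
  by (simp add: box_def)

lemma box_insert:
  "x \<in> box I a b \<Longrightarrow> l < s \<Longrightarrow> s < u \<Longrightarrow> j \<notin> I \<Longrightarrow>
    (\<lambda>i. if i = j then s else x i) \<in> box (insert j I) (a(j := l)) (b(j := u))"
  by (auto simp: mem_box extensional_def)

lemma box_insertE:
  assumes "y \<in> box (insert j I) (a(j := l)) (b(j := u))" "j \<notin> I"
  obtains x s where "x \<in> box I a b" "l < s" "s < u" "y = (\<lambda>i. if i = j then s else x i)"
proof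
  have "a i < y i \<and> y i < b i" if "i \<in> I" for i
  proof -
    have "i \<noteq> j" using that assms(2) by blast
    moreover have "(a(j := l)) i < y i \<and> y i < (b(j := u)) i"
      using assms(1) that unfolding mem_box by blast
    ultimately show ?thesis by simp
  qed
  then show "restrict y I \<in> box I a b" by (simp add: mem_box)
  show "l < y j" "y j < u" using assms(1) by (simp_all add: mem_box)
  show "y = (\<lambda>i. if i = j then y j else restrict y I i)"
    using assms(1) by (auto simp: mem_box extensional_def fun_eq_iff)
qed

lemma box_nonempty:
  fixes a b :: "nat \<Rightarrow> 'a::dense_linorder"
  assumes "\<And>i. i \<in> I \<Longrightarrow> a i < b i"
  obtains x where "x \<in> box I a b"
proof -
  have "\<forall>i\<in>I. \<exists>x. a i < x \<and> x < b i" using assms dense by blast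
  then obtain f where "\<forall>i\<in>I. a i < f i \<and> f i < b i" by metis
  then have "restrict f I \<in> box I a b" by (simp add: mem_box)
  then show thesis using that by blast
qed

context tame begin

text \<open>The end points of an interval inside a fibre can be moved within intervals of their own.
  So \<open>constant_on_interval\<close> applies to the lower end point first and, once that is
  fixed, to the upper one.\<close>

lemma rectangle_in_plane:
  assumes dQ: "def_pred \<M> (\<lambda>e. Q (e 0) (e 1))" and pq: "p < q"
    and int: "\<And>x. p < x \<Longrightarrow> x < q \<Longrightarrow> \<exists>a b. a < b \<and> (\<forall>v. a < v \<and> v < b \<longrightarrow> Q x v)"
  obtains a b l u where "p \<le> a" "a < b" "b \<le> q" "l < u"
    "\<And>x v. a < x \<Longrightarrow> x < b \<Longrightarrow> l < v \<Longrightarrow> v < u \<Longrightarrow> Q x v"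
proof -
  note dQ' = def_pred_app2[OF dQ]
  define Q1 where "Q1 x l \<longleftrightarrow> (\<exists>u. l < u \<and> (\<forall>v. l < v \<and> v < u \<longrightarrow> Q x v))" for x l
  have d: "def_pred \<M> (\<lambda>e. Q1 (e 0) (e 1))"
    unfolding Q1_def by (intro def_pred_intros dQ')
  have "\<exists>a b. a < b \<and> (\<forall>l. a < l \<and> l < b \<longrightarrow> Q1 x l)" if x: "p < x" "x < q" for x
    using int[OF x] less_trans unfolding Q1_def by metis
  from constant_on_interval[OF d pq this]
  obtain l a1 b1 where 1: "p \<le> a1" "a1 < b1" "b1 \<le> q" "\<And>x. a1 < x \<Longrightarrow> x < b1 \<Longrightarrow> Q1 x l"
    by metis
  define Q2 where "Q2 x u \<longleftrightarrow> l < u \<and> (\<forall>v. l < v \<and> v < u \<longrightarrow> Q x v)" for x u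
  have d: "def_pred \<M> (\<lambda>e. Q2 (e 0) (e 1))"
    unfolding Q2_def by (intro def_pred_intros dQ')
  have "\<exists>a b. a < b \<and> (\<forall>u. a < u \<and> u < b \<longrightarrow> Q2 x u)" if x: "a1 < x" "x < b1" for x
    using 1(4)[OF x] less_trans unfolding Q1_def Q2_def by metis
  from constant_on_interval[OF d 1(2) this]
  obtain u a b where 2: "a1 \<le> a" "a < b" "b \<le> b1" "\<And>x. a < x \<Longrightarrow> x < b \<Longrightarrow> Q2 x u"
    by metis
  obtain x where "a < x" "x < b" using dense[OF 2(2)] by blast
  then have "l < u" using 2(4) unfolding Q2_def by blast
  then show thesis
    using that[of a b l u] 1(1,3) 2 order_trans unfolding Q2_def by blast
qed

text \<open>Over a point of the smaller box, \<open>rectangle_in_plane\<close> deals with the new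
  coordinate \<open>s\<close> and the value \<open>v\<close>. The rectangle depends on the point;
  three uses of the induction hypothesis fix first \<open>v\<close>, then the lower and the upper
  end of the range of \<open>s\<close>.\<close>

lemma constant_on_box:
  assumes "finite I" and "def_pred \<M> (\<lambda>e. Q (\<lambda>i. e (Suc i)) (e 0))"
    and "\<And>i. i \<in> I \<Longrightarrow> a i < b i"
    and "\<And>x. x \<in> box I a b \<Longrightarrow> \<exists>l u. l < u \<and> (\<forall>v. l < v \<and> v < u \<longrightarrow> Q x v)"
  shows "\<exists>a' b' v. subbox I a b a' b' \<and> (\<forall>x\<in>box I a' b'. Q x v)"
  using assms
proof (induction I arbitrary: Q a b)
  case empty
  obtain l u where "l < u" "\<forall>v. l < v \<and> v < u \<longrightarrow> Q (\<lambda>_. undefined) v"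
    using empty.prems(3)[of "\<lambda>_. undefined"] unfolding box_empty by blast
  then obtain v where "Q (\<lambda>_. undefined) v" using dense by blast
  then show ?case unfolding box_empty subbox_def by blast
next
  case (insert j I)
  note dQ = def_pred_appB1[OF insert.prems(1)]
  have ab: "a j < b j" "\<And>i. i \<in> I \<Longrightarrow> a i < b i" using insert.prems(2) by auto
  let ?Q = "\<lambda>x s v. Q (\<lambda>i. if i = j then s else x i) v"
  \<comment> \<open>Weak inequalities are written as negated strict ones, the form in which
    \<open>def_pred_intros\<close> treats them.\<close>
  let ?R1 = "\<lambda>x v. \<exists>l u. \<not> l < a j \<and> l < u \<and> \<not> b j < u \<and> (\<forall>s. l < s \<and> s < u \<longrightarrow> ?Q x s v)"
  have "def_pred \<M> (\<lambda>e. ?R1 (\<lambda>i. e (Suc i)) (e 0))"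
    by (intro def_pred_intros dQ)
  moreover have "\<exists>l u. l < u \<and> (\<forall>v. l < v \<and> v < u \<longrightarrow> ?R1 x v)" if x: "x \<in> box I a b" for x
  proof -
    define E where "E s v \<longleftrightarrow> ?Q x s v" for s v
    have d: "def_pred \<M> (\<lambda>e. E (e 0) (e 1))"
      unfolding E_def by (intro def_pred_intros dQ)
    have i: "\<exists>l u. l < u \<and> (\<forall>v. l < v \<and> v < u \<longrightarrow> E s v)" if s: "a j < s" "s < b j" for s
      using insert.prems(3) box_insert[OF x s \<open>j \<notin> I\<close>] unfolding E_def by simp
    obtain l u l' u' where r: "a j \<le> l" "l < u" "u \<le> b j" "l' < u'"
      "\<And>s v. l < s \<Longrightarrow> s < u \<Longrightarrow> l' < v \<Longrightarrow> v < u' \<Longrightarrow> E s v"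
      by (rule rectangle_in_plane[OF d ab(1) i], assumption, assumption, rule that)
    have "?R1 x v" if "l' < v" "v < u'" for v
      by (rule exI[of _ l], rule exI[of _ u]) (use r that in \<open>auto simp: E_def\<close>)
    then show ?thesis using r(4) by blast
  qed
  ultimately obtain a1 b1 v where 1: "subbox I a b a1 b1" "\<And>x. x \<in> box I a1 b1 \<Longrightarrow> ?R1 x v"
    using insert.IH[of ?R1 a b] ab(2) by blast
  let ?R2 = "\<lambda>x l. \<exists>u. \<not> l < a j \<and> l < u \<and> \<not> b j < u \<and> (\<forall>s. l < s \<and> s < u \<longrightarrow> ?Q x s v)"
  have "def_pred \<M> (\<lambda>e. ?R2 (\<lambda>i. e (Suc i)) (e 0))"
    by (intro def_pred_intros dQ)
  moreover have "\<exists>p q. p < q \<and> (\<forall>l. p < l \<and> l < q \<longrightarrow> ?R2 x l)" if x: "x \<in> box I a1 b1" for x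
  proof -
    obtain l u where lu: "\<not> l < a j" "l < u" "\<not> b j < u" "\<forall>s. l < s \<and> s < u \<longrightarrow> ?Q x s v"
      using 1(2)[OF x] by blast
    have "?R2 x l'" if "l < l'" "l' < u" for l'
      using lu that by (intro exI[of _ u]) auto
    then show ?thesis using lu(2) by blast
  qed
  ultimately obtain a2 b2 l where 2: "subbox I a1 b1 a2 b2" "\<And>x. x \<in> box I a2 b2 \<Longrightarrow> ?R2 x l"
    using insert.IH[of ?R2 a1 b1] subbox_less[OF 1(1)] by blast
  let ?R3 = "\<lambda>x u. \<not> l < a j \<and> l < u \<and> \<not> b j < u \<and> (\<forall>s. l < s \<and> s < u \<longrightarrow> ?Q x s v)"
  have "def_pred \<M> (\<lambda>e. ?R3 (\<lambda>i. e (Suc i)) (e 0))"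
    by (intro def_pred_intros dQ)
  moreover have "\<exists>p q. p < q \<and> (\<forall>u. p < u \<and> u < q \<longrightarrow> ?R3 x u)" if x: "x \<in> box I a2 b2" for x
  proof -
    obtain u where u: "\<not> l < a j" "l < u" "\<not> b j < u" "\<forall>s. l < s \<and> s < u \<longrightarrow> ?Q x s v"
      using 2(2)[OF x] by blast
    have "?R3 x u'" if "l < u'" "u' < u" for u'
      using u that by auto
    then show ?thesis using u(2) by blast
  qed
  ultimately obtain a3 b3 u where 3: "subbox I a2 b2 a3 b3" "\<And>x. x \<in> box I a3 b3 \<Longrightarrow> ?R3 x u"
    using insert.IH[of ?R3 a2 b2] subbox_less[OF 2(1)] by blast
  have sub: "subbox I a b a3 b3" using subbox_trans 1(1) 2(1) 3(1) by blast
  obtain x where "x \<in> box I a3 b3" using box_nonempty subbox_less[OF sub] by metis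
  then have "\<not> l < a j" "l < u" "\<not> b j < u" using 3(2) by blast+
  then have "subbox (insert j I) a b (a3(j := l)) (b3(j := u))"
    using sub \<open>j \<notin> I\<close> unfolding subbox_def by auto
  moreover have "Q y v" if "y \<in> box (insert j I) (a3(j := l)) (b3(j := u))" for y
    using box_insertE[OF that \<open>j \<notin> I\<close>] 3(2) by metis
  ultimately show ?case by blast
qed

text \<open>As in the plane, the two end points of the interval are made constant one after the
  other.\<close>

lemma box_in_fibres:
  assumes I: "finite I" and dQ: "def_pred \<M> (\<lambda>e. Q (\<lambda>i. e (Suc i)) (e 0))"
    and ab: "\<And>i. i \<in> I \<Longrightarrow> a i < b i"
    and int: "\<And>x. x \<in> box I a b \<Longrightarrow> \<exists>l u. l < u \<and> (\<forall>v. l < v \<and> v < u \<longrightarrow> Q x v)"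
  obtains a' b' l u where "subbox I a b a' b'" "l < u"
    "\<And>x v. x \<in> box I a' b' \<Longrightarrow> l < v \<Longrightarrow> v < u \<Longrightarrow> Q x v"
proof -
  note dQ' = def_pred_appB1[OF dQ]
  define Q1 where "Q1 x l \<longleftrightarrow> (\<exists>u. l < u \<and> (\<forall>v. l < v \<and> v < u \<longrightarrow> Q x v))" for x l
  have d: "def_pred \<M> (\<lambda>e. Q1 (\<lambda>i. e (Suc i)) (e 0))"
    unfolding Q1_def by (intro def_pred_intros dQ')
  have "\<exists>a b. a < b \<and> (\<forall>l. a < l \<and> l < b \<longrightarrow> Q1 x l)" if x: "x \<in> box I a b" for x
    using int[OF x] less_trans unfolding Q1_def by metis
  from constant_on_box[of I Q1 a b, OF I d ab this]
  obtain l a1 b1 where 1: "subbox I a b a1 b1" "\<And>x. x \<in> box I a1 b1 \<Longrightarrow> Q1 x l"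
    by blast
  define Q2 where "Q2 x u \<longleftrightarrow> l < u \<and> (\<forall>v. l < v \<and> v < u \<longrightarrow> Q x v)" for x u
  have d: "def_pred \<M> (\<lambda>e. Q2 (\<lambda>i. e (Suc i)) (e 0))"
    unfolding Q2_def by (intro def_pred_intros dQ')
  have "\<exists>a b. a < b \<and> (\<forall>u. a < u \<and> u < b \<longrightarrow> Q2 x u)" if x: "x \<in> box I a1 b1" for x
    using 1(2)[OF x] less_trans unfolding Q1_def Q2_def by metis
  from constant_on_box[of I Q2 a1 b1, OF I d subbox_less[OF 1(1)] this]
  obtain u a2 b2 where 2: "subbox I a1 b1 a2 b2" "\<And>x. x \<in> box I a2 b2 \<Longrightarrow> Q2 x u"
    by blast
  obtain x where "x \<in> box I a2 b2" using box_nonempty subbox_less[OF 2(1)] by metis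
  then show thesis
    using that[of a2 b2 l u] subbox_trans[OF 1(1) 2(1)] 2(2) unfolding Q2_def by blast
qed

text \<open>The values of a tuple are fixed one at a time. With \<open>k\<close> twice the
  dimension, this fixes both corners of a box.\<close>

lemma constant_block_on_box:
  assumes I: "finite I" and "def_pred \<M> (\<lambda>e. T (\<lambda>i. e (2 * i + 1)) (\<lambda>i. e (2 * i)))"
    and "\<And>i. i \<in> I \<Longrightarrow> a i < b i"
    and "\<And>x. x \<in> box I a b \<Longrightarrow>
      \<exists>l u. (\<forall>i\<in>{..<k}. l i < u i) \<and> (\<forall>t. (\<forall>i\<in>{..<k}. l i < t i \<and> t i < u i) \<longrightarrow> T x t)"
  shows "\<exists>a' b' t. subbox I a b a' b' \<and> (\<forall>x\<in>box I a' b'. T x t)"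
  using assms(2-)
proof (induction k arbitrary: T a b)
  case 0
  then have "\<forall>x\<in>box I a b. T x undefined" by auto
  then show ?case using subbox_refl[of I a b] 0(2) by blast
next
  case (Suc k)
  note dT = def_pred_appBB[OF Suc.prems(1)]
  let ?T = "\<lambda>x v t. T x (\<lambda>i. if i = k then v else t i)"
  let ?Q = "\<lambda>x v. \<exists>l u. (\<forall>i\<in>{..<k}. l i < u i) \<and> (\<forall>t. (\<forall>i\<in>{..<k}. l i < t i \<and> t i < u i) \<longrightarrow> ?T x v t)"
  have "def_pred \<M> (\<lambda>e. ?Q (\<lambda>i. e (Suc i)) (e 0))"
    by (intro def_pred_intros dT finite_lessThan)
  moreover have "\<exists>l u. l < u \<and> (\<forall>v. l < v \<and> v < u \<longrightarrow> ?Q x v)" if x: "x \<in> box I a b" for x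
  proof -
    obtain l u where lu: "\<forall>i\<in>{..<Suc k}. l i < u i"
        "\<forall>t. (\<forall>i\<in>{..<Suc k}. l i < t i \<and> t i < u i) \<longrightarrow> T x t"
      using Suc.prems(3)[OF x] by blast
    have "?Q x v" if v: "l k < v" "v < u k" for v
    proof (rule exI[of _ l], rule exI[of _ u], intro conjI allI impI)
      show "\<forall>i\<in>{..<k}. l i < u i" using lu(1) by simp
      fix t assume "\<forall>i\<in>{..<k}. l i < t i \<and> t i < u i"
      then have "\<forall>i\<in>{..<Suc k}. l i < (if i = k then v else t i) \<and> (if i = k then v else t i) < u i"
        using v by (auto simp: less_Suc_eq)
      then show "?T x v t" by (rule lu(2)[THEN spec, THEN mp])
    qed
    then show ?thesis using lu(1) by blast
  qed
  ultimately obtain a1 b1 v where 1: "subbox I a b a1 b1" "\<And>x. x \<in> box I a1 b1 \<Longrightarrow> ?Q x v"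
    using constant_on_box[OF I, of ?Q a b] Suc.prems(2) by blast
  have "def_pred \<M> (\<lambda>e. ?T (\<lambda>i. e (2 * i + 1)) v (\<lambda>i. e (2 * i)))"
    by (intro def_pred_intros dT)
  then obtain a2 b2 t where "subbox I a1 b1 a2 b2" "\<forall>x\<in>box I a2 b2. ?T x v t"
    using Suc.IH[of "\<lambda>x. ?T x v" a1 b1] 1(2) subbox_less[OF 1(1)] by blast
  then show ?case using subbox_trans[OF 1(1)] by blast
qed

text \<open>Over each point of the smaller box, either \<open>P\<close> holds on an interval in the
  direction \<open>j\<close>, or by \<open>interval_split\<close> its negation does. The induction
  hypothesis makes this choice uniform, and \<open>box_in_fibres\<close> then makes the interval
  uniform.\<close>

lemma box_dichotomy:
  assumes "finite I" and "def_pred \<M> P" and "\<And>i. i \<in> I \<Longrightarrow> a i < b i"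
  shows "\<exists>a' b'. subbox I a b a' b' \<and> ((\<forall>x\<in>box I a' b'. P x) \<or> (\<forall>x\<in>box I a' b'. \<not> P x))"
  using assms
proof (induction I arbitrary: P a b)
  case empty
  show ?case unfolding box_empty subbox_def by blast
next
  case (insert j I)
  interpret L: tame_line \<M> "(<)" by unfold_locales auto
  have w: "weak (<) = ((\<le>) :: 'a \<Rightarrow> _)" by (auto simp: weak_def fun_eq_iff)
  note dP = def_pred_subst[OF insert.prems(1)]
  have ab: "a j < b j" "\<And>i. i \<in> I \<Longrightarrow> a i < b i" using insert.prems(2) by auto
  let ?P = "\<lambda>x s. P (\<lambda>i. if i = j then s else x i)"
  \<comment> \<open>Both outcomes of the choice end in the same way, with \<open>R\<close> being
    \<open>P\<close> or its negation.\<close>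
  have *: ?case
    if sub1: "subbox I a b a1 b1" and dR: "def_pred \<M> R" and RP: "R = P \<or> R = (\<lambda>x. \<not> P x)" and
      R: "\<And>x. x \<in> box I a1 b1 \<Longrightarrow> \<exists>l u. \<not> l < a j \<and> l < u \<and> \<not> b j < u \<and>
        (\<forall>s. l < s \<and> s < u \<longrightarrow> R (\<lambda>i. if i = j then s else x i))" for a1 b1 R
  proof -
    note dR' = def_pred_subst[OF dR]
    let ?Q = "\<lambda>x s. a j < s \<and> s < b j \<and> R (\<lambda>i. if i = j then s else x i)"
    have "def_pred \<M> (\<lambda>e. ?Q (\<lambda>i. e (Suc i)) (e 0))"
      by (intro def_pred_intros dR')
    moreover have "\<exists>l u. l < u \<and> (\<forall>s. l < s \<and> s < u \<longrightarrow> ?Q x s)" if x: "x \<in> box I a1 b1" for x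
      using R[OF x] by (meson le_less_trans less_le_trans not_less)
    ultimately obtain a2 b2 l u where 2: "subbox I a1 b1 a2 b2" "l < u"
        "\<And>x s. x \<in> box I a2 b2 \<Longrightarrow> l < s \<Longrightarrow> s < u \<Longrightarrow> ?Q x s"
      using box_in_fibres[OF insert.hyps(1), of ?Q a1 b1] subbox_less[OF sub1] by blast
    have sub: "subbox I a b a2 b2" using subbox_trans[OF sub1 2(1)] .
    obtain x where x: "x \<in> box I a2 b2" using box_nonempty subbox_less[OF sub] by metis
    have "a j \<le> l" "u \<le> b j"
      using 2(3)[OF x] dense[OF 2(2)] 2(2) by (meson dense le_less_linear less_asym less_trans)+
    then have "subbox (insert j I) a b (a2(j := l)) (b2(j := u))"
      using sub 2(2) \<open>j \<notin> I\<close> unfolding subbox_def by auto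
    moreover have "R y" if "y \<in> box (insert j I) (a2(j := l)) (b2(j := u))" for y
      using box_insertE[OF that \<open>j \<notin> I\<close>] 2(3) by metis
    ultimately show ?thesis using RP by metis
  qed
  let ?R = "\<lambda>x. \<exists>l u. \<not> l < a j \<and> l < u \<and> \<not> b j < u \<and> (\<forall>s. l < s \<and> s < u \<longrightarrow> ?P x s)"
  have "def_pred \<M> ?R" by (intro def_pred_intros dP)
  then obtain a1 b1 where 1: "subbox I a b a1 b1"
      "(\<forall>x\<in>box I a1 b1. ?R x) \<or> (\<forall>x\<in>box I a1 b1. \<not> ?R x)"
    using insert.IH[of ?R a b] ab(2) by blast
  from 1(2) show ?case
  proof
    assume "\<forall>x\<in>box I a1 b1. ?R x"
    then show ?thesis using *[OF 1(1) insert.prems(1)] by blast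
  next
    assume no: "\<forall>x\<in>box I a1 b1. \<not> ?R x"
    have "\<exists>l u. \<not> l < a j \<and> l < u \<and> \<not> b j < u \<and> (\<forall>s. l < s \<and> s < u \<longrightarrow> \<not> ?P x s)"
      if x: "x \<in> box I a1 b1" for x
    proof -
      have "def_pred \<M> (\<lambda>e. ?P x (e 0))" by (intro def_pred_intros dP)
      then obtain u where "a j < u" "u \<le> b j"
          "(\<forall>s. a j < s \<longrightarrow> s < u \<longrightarrow> ?P x s) \<or> (\<forall>s. a j < s \<longrightarrow> s < u \<longrightarrow> \<not> ?P x s)"
        using L.interval_split[of "?P x" "a j" "b j" "\<lambda>s. \<not> ?P x s"] ab(1) unfolding w by blast
      moreover from this have "\<not> (\<forall>s. a j < s \<longrightarrow> s < u \<longrightarrow> ?P x s)"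
        using no x by (meson less_irrefl not_less)
      ultimately show ?thesis by (meson less_irrefl not_less)
    qed
    then show ?thesis using *[OF 1(1) def_pred_not[OF insert.prems(1)]] by blast
  qed
qed

end

section \<open>Thresholds over a discrete set\<close>

context tame_line begin

text \<open>
  The least admissible thresholds of the points of a discrete set form a discrete set of the line, so
  they stay away from \<open>u\<close>.
\<close>

lemma uniform_threshold:
  assumes Y: "definable \<M> n Y" "discrete_in_power n Y"
    and dR: "def_pred \<M> (\<lambda>e. R (\<lambda>i. e (Suc i)) (e 0))"
    and mono: "\<And>y t t'. y \<in> Y \<Longrightarrow> R y t \<Longrightarrow> lt t t' \<Longrightarrow> lt t' u \<Longrightarrow> R y t'"
    and ex: "\<And>y. y \<in> Y \<Longrightarrow> \<exists>t. lt t u \<and> R y t"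
  obtains t where "lt t u" "\<And>y. y \<in> Y \<Longrightarrow> R y t"
proof -
  interpret C: tame_line \<M> "lt\<inverse>\<inverse>"
    using tame_axioms oriented_converse by (intro tame_line.intro)
  note dR' = def_pred_appB1[OF dR]
  have Y_cart: "Y \<subseteq> cart_power n" and dY: "def_pred \<M> (\<lambda>e. restrict e {..<n} \<in> Y)"
    using Y(1) unfolding definable_iff_def_pred by auto
  note dY' = def_pred_subst[OF dY]
  \<comment> \<open>The least threshold of \<open>y\<close>, unique by density. It does not exist if
    \<open>R y s\<close> holds for all \<open>s\<close> before \<open>u\<close>, and such a
    \<open>y\<close> imposes no constraint.\<close>
  define B where "B y t \<longleftrightarrow> lt t u \<and> (\<forall>s. lt t s \<longrightarrow> lt s u \<longrightarrow> R y s) \<and> (\<forall>s. lt s t \<longrightarrow> \<not> R y s)" for y t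
  have B_fun: "s = t" if "B y s" "B y t" for y s t
  proof -
    have False if "lt s t" "B y s" "B y t" for s t
    proof -
      obtain r where "lt s r" "lt r t" using ord.dense[OF \<open>lt s t\<close>] by blast
      then show False using that unfolding B_def by (meson ord.less_trans)
    qed
    then show ?thesis using that by (metis ord.neqE)
  qed
  have res: "(\<lambda>i. if i < n then e i else undefined) = restrict e {..<n}" for e :: "nat \<Rightarrow> 'a"
    by (auto simp: fun_eq_iff)
  \<comment> \<open>The threshold is a function of \<open>y\<close>, so attaching it as a last
    coordinate keeps the set discrete; \<open>discrete_coordinate\<close> then applies to that
    coordinate.\<close>
  define Z where "Z = {z \<in> cart_power (Suc n). restrict z {..<n} \<in> Y \<and> B (restrict z {..<n}) (z n)}"
  have "def_pred \<M> (\<lambda>e. restrict e {..<n} \<in> Y \<and> B (\<lambda>i. if i < n then e i else undefined) (e n))"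
    unfolding B_def by (intro def_pred_intros def_pred_lt dR' dY')
  moreover have "restrict e {..<Suc n} \<in> Z \<longleftrightarrow>
      restrict e {..<n} \<in> Y \<and> B (\<lambda>i. if i < n then e i else undefined) (e n)" for e
  proof -
    have "restrict (restrict e {..<Suc n}) {..<n} = restrict e {..<n}" by (auto simp: fun_eq_iff)
    then show ?thesis unfolding Z_def res by auto
  qed
  ultimately have dZ: "definable \<M> (Suc n) Z"
    unfolding definable_iff_def_pred Z_def by auto
  have discZ: "discrete_in_power (Suc n) Z"
    unfolding discrete_in_power_iff
  proof (intro conjI ballI)
    fix z assume z: "z \<in> Z"
    let ?y = "restrict z {..<n}"
    have "?y \<in> Y" using z unfolding Z_def by blast
    then obtain a b where ab: "?y \<in> box {..<n} a b" "Y \<inter> box {..<n} a b \<subseteq> {?y}"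
      using Y(2) unfolding discrete_in_power_iff by meson
    obtain l m where lm: "l < z n" "z n < m" using lt_ex gt_ex by blast
    have zc: "z \<in> extensional {..<Suc n}" using z unfolding Z_def by (auto simp: PiE_iff)
    then have "z \<in> box {..<Suc n} (a(n := l)) (b(n := m))"
      using ab(1) lm by (auto simp: mem_box less_Suc_eq)
    moreover have "z' = z" if z': "z' \<in> Z" "z' \<in> box {..<Suc n} (a(n := l)) (b(n := m))" for z'
    proof
      fix i
      have "a i < z' i \<and> z' i < b i" if "i < n" for i
        using z'(2)[unfolded mem_box, THEN conjunct2, THEN bspec, of i] that by simp
      then have "restrict z' {..<n} \<in> Y \<inter> box {..<n} a b"
        using z'(1) unfolding Z_def by (simp add: mem_box)
      then have eq: "restrict z' {..<n} = ?y" using ab(2) by blast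
      then have "B ?y (z' n)" "B ?y (z n)" using z z' unfolding Z_def by auto
      then have "z' n = z n" by (rule B_fun)
      moreover have "z' i = z i" if "i < n" using fun_cong[OF eq, of i] that by simp
      moreover have "z' i = z i" if "\<not> i < Suc n"
        using zc z'(2) that by (auto simp: mem_box extensional_def)
      ultimately show "z' i = z i" using less_Suc_eq by blast
    qed
    ultimately show "\<exists>a b. z \<in> box {..<Suc n} a b \<and> Z \<inter> box {..<Suc n} a b \<subseteq> {z}"
      by blast
  qed (auto simp: Z_def)
  let ?S = "\<lambda>t. \<exists>z. restrict z {..<n} \<in> Y \<and> B (\<lambda>i. if i < n then z i else undefined) t"
  have S_iff: "?S t \<longleftrightarrow> (\<exists>y\<in>Y. B y t)" for t
    unfolding res using Y_cart by (metis PiE_restrict subsetD)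
  have S_Z: "t \<in> (\<lambda>z. z n) ` Z" if S: "?S t" for t
  proof -
    obtain y where y: "y \<in> Y" "B y t" using S unfolding S_iff by blast
    then have ye: "y \<in> extensional {..<n}" using Y_cart by (auto simp: PiE_iff)
    let ?z = "\<lambda>i. if i = n then t else y i"
    have "restrict ?z {..<n} = y" using ye by (auto simp: fun_eq_iff extensional_def)
    moreover have "?z \<in> cart_power (Suc n)" using ye by (auto simp: extensional_def PiE_iff)
    ultimately have "?z \<in> Z" using y unfolding Z_def by simp
    then show ?thesis by (rule rev_image_eqI) simp
  qed
  have "def_pred \<M> (\<lambda>e. ?S (e 0))"
    unfolding B_def by (intro def_pred_intros def_pred_lt dR' dY')
  moreover have "\<not> before lt u ?S"
  proof
    assume "before lt u ?S"
    then obtain q where q: "lt q u" "\<And>t. lt q t \<Longrightarrow> lt t u \<Longrightarrow> t \<in> (\<lambda>z. z n) ` Z"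
      using S_Z unfolding after_def conversep_iff by blast
    from orientation show False
    proof
      assume "lt = (<)"
      then show False using discrete_coordinate[OF dZ discZ, of n q u] q by auto
    next
      assume "lt = (>)"
      then show False using discrete_coordinate[OF dZ discZ, of n u q] q by auto
    qed
  qed
  ultimately have "before lt u (\<lambda>t. \<not> ?S t)" using C.after_dichotomy[of ?S u] by blast
  then obtain q where q: "lt q u" "\<And>t. lt q t \<Longrightarrow> lt t u \<Longrightarrow> \<not> (\<exists>y\<in>Y. B y t)"
    unfolding S_iff after_def conversep_iff by blast
  obtain t where t: "lt q t" "lt t u" using ord.dense[OF q(1)] by blast
  have "R y t" if y: "y \<in> Y" for y
  proof (rule ccontr)
    assume nR: "\<not> R y t"
    obtain t0 where t0: "lt t0 u" "R y t0" using ex[OF y] by blast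
    \<comment> \<open>The supremum \<open>s\<close> of the failures before \<open>u\<close> would be
      the least threshold of \<open>y\<close>, and it would lie between \<open>q\<close> and
      \<open>u\<close>, where there is none.\<close>
    let ?N = "\<lambda>s. lt s u \<and> \<not> R y s"
    have "def_pred \<M> (\<lambda>e. ?N (e 0))"
      by (intro def_pred_intros def_pred_lt dR')
    moreover have "\<not> lt t0 s" if "?N s" for s using mono[OF y t0(2)] that by blast
    ultimately obtain s where s: "\<And>x. ?N x \<Longrightarrow> \<not> lt s x" "\<And>v. lt v s \<Longrightarrow> \<exists>x. ?N x \<and> lt v x"
      using definable_Sup[of ?N t t0] nR t(2) by blast
    have "\<not> lt s t" using s(1) nR t(2) by blast
    moreover have "\<not> lt t0 s" using s(2) mono[OF y t0(2)] by blast
    ultimately have 1: "lt q s" "lt s u" using t(1) t0(1) by order+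
    have "R y r" if "lt s r" "lt r u" for r using s(1) that by blast
    moreover have "\<not> R y r" if "lt r s" for r using s(2)[OF that] mono[OF y] by blast
    ultimately have "B y s" using 1(2) unfolding B_def by blast
    then show False using q(2)[OF 1] y by blast
  qed
  then show thesis using that t(2) by blast
qed

end

section \<open>Normal points\<close>


text \<open>From here on points are arbitrary sequences, of which only the first \<open>n\<close> terms matter.\<close>

definition inside :: "nat set \<Rightarrow> (nat \<Rightarrow> 'a::linorder) \<Rightarrow> (nat \<Rightarrow> 'a) \<Rightarrow> (nat \<Rightarrow> 'a) \<Rightarrow> bool" where
  "inside I a b y \<longleftrightarrow> (\<forall>i\<in>I. a i < y i \<and> y i < b i)"

definition agree :: "nat set \<Rightarrow> (nat \<Rightarrow> 'a) \<Rightarrow> (nat \<Rightarrow> 'a) \<Rightarrow> bool" where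
  "agree I y z \<longleftrightarrow> (\<forall>i\<in>I. y i = z i)"

abbreviation over ::
    "nat \<Rightarrow> (nat \<Rightarrow> 'a::linorder) set \<Rightarrow> nat set \<Rightarrow> (nat \<Rightarrow> 'a) \<Rightarrow> (nat \<Rightarrow> 'a) \<Rightarrow> (nat \<Rightarrow> 'a) \<Rightarrow> (nat \<Rightarrow> 'a) \<Rightarrow> bool" where
  "over n X I a b u z \<equiv> restrict z {..<n} \<in> X \<and> inside {..<n} a b z \<and> agree I z u"

text \<open>A map is replaced by existence and uniqueness of a point over each base point,
  uniqueness being meant for the first \<open>n\<close> terms. This keeps the notion a first-order
  condition on the corners \<open>a\<close> and \<open>b\<close>.\<close>

definition sheet :: "nat \<Rightarrow> (nat \<Rightarrow> 'a::linorder) set \<Rightarrow> nat set \<Rightarrow> (nat \<Rightarrow> 'a) \<Rightarrow> (nat \<Rightarrow> 'a) \<Rightarrow> bool" where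
  "sheet n X I a b \<longleftrightarrow> (\<forall>u. inside I a b u \<longrightarrow>
     (\<exists>z. over n X I a b u z) \<and>
     (\<forall>z z'. over n X I a b u z \<longrightarrow>
        over n X I a b u z' \<longrightarrow> agree {..<n} z z'))"

text \<open>As the sheets are required to be arbitrarily small, the maps in question are continuous.\<close>

definition normal_point :: "nat \<Rightarrow> (nat \<Rightarrow> 'a::linorder) set \<Rightarrow> nat set \<Rightarrow> (nat \<Rightarrow> 'a) \<Rightarrow> bool" where
  "normal_point n X I y \<longleftrightarrow> (\<forall>a b. inside {..<n} a b y \<longrightarrow>
     (\<exists>a' b'. subbox {..<n} a b a' b' \<and> inside {..<n} a' b' y \<and> sheet n X I a' b'))"

definition isolated_in_fibre :: "nat \<Rightarrow> (nat \<Rightarrow> 'a::linorder) set \<Rightarrow> nat set \<Rightarrow> (nat \<Rightarrow> 'a) \<Rightarrow> bool" where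
  "isolated_in_fibre n X I y \<longleftrightarrow> (\<exists>c d. inside {..<n} c d y \<and>
     (\<forall>z. restrict z {..<n} \<in> X \<and> inside {..<n} c d z \<and> agree I z y \<longrightarrow> agree {..<n} z y))"

definition normal_fibre :: "nat \<Rightarrow> (nat \<Rightarrow> 'a::linorder) set \<Rightarrow> nat set \<Rightarrow> (nat \<Rightarrow> 'a) \<Rightarrow> bool" where
  "normal_fibre n X I u \<longleftrightarrow> (\<exists>y. restrict y {..<n} \<in> X \<and> agree I y u) \<and>
     (\<forall>y. restrict y {..<n} \<in> X \<and> agree I y u \<longrightarrow> normal_point n X I y)"

text \<open>The projection of \<open>X\<close> to the coordinates in \<open>I\<close> has interior.
  For empty \<open>I\<close> this means that \<open>X\<close> has a point.\<close>

definition covers_box :: "nat \<Rightarrow> (nat \<Rightarrow> 'a::linorder) set \<Rightarrow> nat set \<Rightarrow> bool" where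
  "covers_box n X I \<longleftrightarrow> (\<exists>a b. (\<forall>i\<in>I. a i < b i) \<and>
     (\<forall>u\<in>box I a b. \<exists>y. restrict y {..<n} \<in> X \<and> agree I y u))"

section \<open>Definability and restriction of sheets\<close>

lemma agree_sym: "agree I y z \<Longrightarrow> agree I z y"
  and agree_trans: "agree I x y \<Longrightarrow> agree I y z \<Longrightarrow> agree I x z"
  and agree_refl: "agree I x x"
  unfolding agree_def by auto

lemma inside_agree: "agree I y z \<Longrightarrow> inside I a b y \<longleftrightarrow> inside I a b z"
  unfolding agree_def inside_def by auto

lemma restrict_agree: "agree {..<n} y z \<Longrightarrow> restrict y {..<n} = restrict z {..<n}"
  unfolding agree_def by (auto simp: fun_eq_iff)

lemma mem_box_inside: "x \<in> box I a b \<longleftrightarrow> x \<in> extensional I \<and> inside I a b x"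
  unfolding mem_box inside_def ..

lemma inside_nonempty:
  fixes y :: "nat \<Rightarrow> 'a::unbounded_dense_linorder"
  obtains a b where "inside I a b y"
proof -
  have "\<forall>i. \<exists>a. a < y i" "\<forall>i. \<exists>b. y i < b" using lt_ex gt_ex by blast+
  then show thesis using that unfolding inside_def by metis
qed

lemma def_pred_le:
  assumes "accessor s" "accessor t"
  shows "def_pred \<M> (\<lambda>e. s e \<le> t e)"
  using def_pred_not[OF def_pred_less[OF assms(2,1)]] by (simp only: not_less)

lemma def_pred_inside:
  assumes "finite I" "\<And>i. accessor (\<lambda>e. f e i)" "\<And>i. accessor (\<lambda>e. g e i)" "\<And>i. accessor (\<lambda>e. h e i)"
  shows "def_pred \<M> (\<lambda>e. inside I (f e) (g e) (h e))"
  unfolding inside_def by (intro def_pred_intros assms)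

lemma def_pred_agree:
  assumes "finite I" "\<And>i. accessor (\<lambda>e. f e i)" "\<And>i. accessor (\<lambda>e. g e i)"
  shows "def_pred \<M> (\<lambda>e. agree I (f e) (g e))"
  unfolding agree_def by (intro def_pred_intros assms)

lemma def_pred_subbox:
  assumes "finite I" "\<And>i. accessor (\<lambda>e. a e i)" "\<And>i. accessor (\<lambda>e. b e i)"
    "\<And>i. accessor (\<lambda>e. c e i)" "\<And>i. accessor (\<lambda>e. d e i)"
  shows "def_pred \<M> (\<lambda>e. subbox I (a e) (b e) (c e) (d e))"
  unfolding subbox_def by (intro def_pred_intros def_pred_le assms)

lemma def_pred_mem:
  assumes "definable \<M> n X" "\<And>i. accessor (\<lambda>e. f e i)"
  shows "def_pred \<M> (\<lambda>e. restrict (f e) {..<n} \<in> X)"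
  by (rule def_pred_subst[OF assms(1)[unfolded definable_iff_def_pred, THEN conjunct2] assms(2)])

lemma def_pred_sheet:
  assumes "definable \<M> n X" "finite I" "\<And>i. accessor (\<lambda>e. f e i)" "\<And>i. accessor (\<lambda>e. g e i)"
  shows "def_pred \<M> (\<lambda>e. sheet n X I (f e) (g e))"
  unfolding sheet_def
  by (intro def_pred_intros def_pred_inside def_pred_agree
      def_pred_mem[OF assms(1)] assms(2) finite_lessThan
      accessor_subst[OF assms(3)] accessor_subst[OF assms(4)])

lemma def_pred_normal_point:
  assumes "definable \<M> n X" "finite I" "\<And>i. accessor (\<lambda>e. f e i)"
  shows "def_pred \<M> (\<lambda>e. normal_point n X I (f e))"
  unfolding normal_point_def
  by (intro def_pred_intros def_pred_inside def_pred_subbox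
      def_pred_sheet[OF assms(1,2)] finite_lessThan accessor_subst[OF assms(3)])

lemma def_pred_isolated_in_fibre:
  assumes "definable \<M> n X" "finite I" "\<And>i. accessor (\<lambda>e. f e i)"
  shows "def_pred \<M> (\<lambda>e. isolated_in_fibre n X I (f e))"
  unfolding isolated_in_fibre_def
  by (intro def_pred_intros def_pred_inside def_pred_agree
      def_pred_mem[OF assms(1)] assms(2) finite_lessThan accessor_subst[OF assms(3)])

lemma def_pred_normal_fibre:
  assumes "definable \<M> n X" "finite I" "\<And>i. accessor (\<lambda>e. f e i)"
  shows "def_pred \<M> (\<lambda>e. normal_fibre n X I (f e))"
  unfolding normal_fibre_def
  by (intro def_pred_intros def_pred_agree def_pred_mem[OF assms(1)]
      def_pred_normal_point[OF assms(1,2)] assms(2) accessor_subst[OF assms(3)])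

text \<open>Only sides in \<open>I\<close> move. For a point over the smaller base this does not
  affect membership in the box, whereas moving another side could cut the sheet.\<close>

lemma sheet_shrink:
  assumes "sheet n X I a b" "I \<subseteq> {..<n}"
    and "\<And>i. i \<in> I \<Longrightarrow> a i \<le> a' i \<and> b' i \<le> b i" "\<And>i. i \<notin> I \<Longrightarrow> a' i = a i \<and> b' i = b i"
  shows "sheet n X I a' b'"
  unfolding sheet_def
proof (intro allI impI)
  fix u assume u: "inside I a' b' u"
  then have u': "inside I a b u"
    using assms(3) unfolding inside_def by (meson le_less_trans less_le_trans)
  have *: "inside {..<n} a' b' z \<longleftrightarrow> inside {..<n} a b z" if "agree I z u" for z
  proof -
    have "(a' i < z i \<and> z i < b' i) \<longleftrightarrow> (a i < z i \<and> z i < b i)" for i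
      using assms(4)[of i] u u' that unfolding inside_def agree_def by (cases "i \<in> I") auto
    then show ?thesis unfolding inside_def by blast
  qed
  then show "(\<exists>z. over n X I a' b' u z) \<and>
     (\<forall>z z'. over n X I a' b' u z \<longrightarrow>
        over n X I a' b' u z' \<longrightarrow> agree {..<n} z z')"
    using assms(1) u' unfolding sheet_def by meson
qed

lemma sheet_unique:
  assumes "sheet n X I a b" "I \<subseteq> {..<n}"
    and "restrict z {..<n} \<in> X" "inside {..<n} a b z" "restrict z' {..<n} \<in> X" "inside {..<n} a b z'"
    and "agree I z z'"
  shows "agree {..<n} z z'"
proof -
  have "inside I a b z" using assms(2,4) unfolding inside_def by blast
  then show ?thesis using assms agree_refl agree_sym unfolding sheet_def by meson
qed

lemma normal_point_isolated:
  fixes y :: "nat \<Rightarrow> 'a::unbounded_dense_linorder"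
  assumes "normal_point n X I y" "I \<subseteq> {..<n}" "restrict y {..<n} \<in> X"
  shows "isolated_in_fibre n X I y"
proof -
  obtain a b where "inside {..<n} a b y" using inside_nonempty by blast
  then obtain a' b' where "inside {..<n} a' b' y" "sheet n X I a' b'"
    using assms(1) unfolding normal_point_def by blast
  then show ?thesis
    unfolding isolated_in_fibre_def using sheet_unique[OF _ assms(2)] assms(3) by blast
qed

section \<open>Normality of generic fibres\<close>

context tame begin

text \<open>
  If a point is isolated in its fibre but not normal, so that small boxes contain no sheet around it,
  then over a smaller base one and the same box witnesses this for all fibres. But then the set is a
  sheet in this box.
\<close>

lemma not_isolated_abnormal:
  assumes X: "definable \<M> n X" and I: "I \<subseteq> {..<n}" and ab: "\<And>i. i \<in> I \<Longrightarrow> a i < b i"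
    and ex: "\<And>x. x \<in> box I a b \<Longrightarrow> \<exists>y. restrict y {..<n} \<in> X \<and> agree I y x \<and>
      \<not> normal_point n X I y \<and> isolated_in_fibre n X I y"
  shows False
proof -
  have fin: "finite I" using I finite_subset by blast
  \<comment> \<open>A box in \<open>n\<close> dimensions is coded by one tuple \<open>t\<close> of
    length \<open>n + n\<close>: its lower corner followed by its upper corner.\<close>
  define lo hi where "lo t i = t i" and "hi t i = t (n + i)" for t :: "nat \<Rightarrow> 'a" and i
  define T where "T x t \<longleftrightarrow> (\<exists>y. restrict y {..<n} \<in> X \<and> agree I y x \<and> inside {..<n} (lo t) (hi t) y \<and>
      (\<forall>z. restrict z {..<n} \<in> X \<and> inside {..<n} (lo t) (hi t) z \<and> agree I z x \<longrightarrow> agree {..<n} z y) \<and>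
      (\<forall>a' b'. subbox {..<n} (lo t) (hi t) a' b' \<and> inside {..<n} a' b' y \<longrightarrow> \<not> sheet n X I a' b'))" for x t
  have "def_pred \<M> (\<lambda>e. T (\<lambda>i. e (2 * i + 1)) (\<lambda>i. e (2 * i)))"
    unfolding T_def lo_def hi_def
    by (intro def_pred_intros def_pred_inside def_pred_agree def_pred_subbox
      def_pred_mem[OF X] def_pred_sheet[OF X fin] fin finite_lessThan)
  moreover have "\<exists>l u. (\<forall>i\<in>{..<n + n}. l i < u i) \<and> (\<forall>t. (\<forall>i\<in>{..<n + n}. l i < t i \<and> t i < u i) \<longrightarrow> T x t)"
    if x: "x \<in> box I a b" for x
  proof -
    obtain y where y: "restrict y {..<n} \<in> X" "agree I y x" "\<not> normal_point n X I y"
      "isolated_in_fibre n X I y" using ex[OF x] by blast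
    obtain c d where cd: "inside {..<n} c d y"
      "\<And>z. restrict z {..<n} \<in> X \<Longrightarrow> inside {..<n} c d z \<Longrightarrow> agree I z y \<Longrightarrow> agree {..<n} z y"
      using y(4) unfolding isolated_in_fibre_def by blast
    obtain p q where pq: "inside {..<n} p q y"
      "\<And>a' b'. subbox {..<n} p q a' b' \<Longrightarrow> inside {..<n} a' b' y \<Longrightarrow> \<not> sheet n X I a' b'"
      using y(3) unfolding normal_point_def by blast
    \<comment> \<open>The lower corner may lie anywhere between \<open>y\<close> and the larger of
      \<open>c\<close> and \<open>p\<close>, the upper corner between \<open>y\<close> and the
      smaller of \<open>d\<close> and \<open>q\<close>. Each such box isolates \<open>y\<close> in
      its fibre and contains no sheet in a subbox around \<open>y\<close>.\<close>
    let ?l = "\<lambda>i. if i < n then max (c i) (p i) else y (i - n)"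
    let ?u = "\<lambda>i. if i < n then y i else min (d (i - n)) (q (i - n))"
    have lu: "\<forall>i\<in>{..<n + n}. ?l i < ?u i" using cd(1) pq(1) by (auto simp: inside_def)
    have Tt: "T x t" if t: "\<forall>i\<in>{..<n + n}. ?l i < t i \<and> t i < ?u i" for t
    proof -
      have 1: "c i < lo t i \<and> p i < lo t i \<and> lo t i < y i \<and> y i < hi t i \<and> hi t i < d i \<and> hi t i < q i"
        if "i < n" for i
        using t[THEN bspec, of i] t[THEN bspec, of "n + i"] that by (simp add: lo_def hi_def)
      have "inside {..<n} (lo t) (hi t) y" using 1 unfolding inside_def by simp
      moreover have "inside {..<n} c d z" if "inside {..<n} (lo t) (hi t) z" for z
        using 1 that less_trans unfolding inside_def by blast
      then have "agree {..<n} z y"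
        if "restrict z {..<n} \<in> X" "inside {..<n} (lo t) (hi t) z" "agree I z x" for z
        using cd(2)[of z] that y(2) agree_sym agree_trans by blast
      moreover have "subbox {..<n} p q a' b'" if "subbox {..<n} (lo t) (hi t) a' b'" for a' b'
        using 1 that unfolding subbox_def by (meson lessThan_iff less_imp_le order_trans)
      ultimately show ?thesis using y(1,2) pq(2) unfolding T_def by blast
    qed
    show ?thesis
      by (rule exI[of _ ?l], rule exI[of _ ?u], intro conjI allI impI lu) (rule Tt)
  qed
  ultimately obtain a1 b1 t where 1: "subbox I a b a1 b1" "\<And>x. x \<in> box I a1 b1 \<Longrightarrow> T x t"
    using constant_block_on_box[OF fin, of T a b "n + n"] ab by blast
  \<comment> \<open>The box coded by \<open>t\<close>, with its sides in \<open>I\<close> cut down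
    to the base over which \<open>t\<close> is a witness.\<close>
  define a' b' where "a' i = (if i \<in> I then max (a1 i) (lo t i) else lo t i)"
    and "b' i = (if i \<in> I then min (b1 i) (hi t i) else hi t i)" for i
  have sub: "inside {..<n} (lo t) (hi t) z" if "inside {..<n} a' b' z" for z
    using that unfolding inside_def a'_def b'_def by (auto split: if_splits)
  have key: "inside {..<n} a' b' y"
    if "agree I y x" "inside I a1 b1 x" "inside {..<n} (lo t) (hi t) y" for x y
  proof -
    have "a' i < y i \<and> y i < b' i" if "i < n" for i
    proof -
      have 1: "lo t i < y i" "y i < hi t i"
        using \<open>inside {..<n} (lo t) (hi t) y\<close> that unfolding inside_def by blast+
      have 2: "a1 i < y i \<and> y i < b1 i" if "i \<in> I"
        using \<open>agree I y x\<close> \<open>inside I a1 b1 x\<close> that unfolding inside_def agree_def by auto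
      show ?thesis unfolding a'_def b'_def using 1 2 by simp
    qed
    then show ?thesis unfolding inside_def by simp
  qed
  have sh: "sheet n X I a' b'"
    unfolding sheet_def
  proof (intro allI impI)
    fix u assume u: "inside I a' b' u"
    then have u1: "inside I a1 b1 u" unfolding inside_def a'_def b'_def by auto
    define x where "x = restrict u I"
    have xu: "agree I x u" unfolding x_def agree_def by simp
    have x1: "inside I a1 b1 x" using u1 inside_agree[OF xu] by blast
    then have "x \<in> box I a1 b1" unfolding mem_box_inside x_def by simp
    then obtain y where y: "restrict y {..<n} \<in> X" "agree I y x" "inside {..<n} (lo t) (hi t) y"
      "\<And>z. restrict z {..<n} \<in> X \<Longrightarrow> inside {..<n} (lo t) (hi t) z \<Longrightarrow> agree I z x \<Longrightarrow> agree {..<n} z y"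
      using 1(2) unfolding T_def by blast
    have iy: "inside {..<n} a' b' y" by (rule key[OF y(2) x1 y(3)])
    have yu: "agree I y u" by (rule agree_trans[OF y(2) xu])
    have un: "agree {..<n} z y"
      if "over n X I a' b' u z" for z
      using that y(4)[OF _ sub agree_trans[OF _ agree_sym[OF xu]]] by simp
    show "(\<exists>z. over n X I a' b' u z) \<and>
     (\<forall>z z'. over n X I a' b' u z \<longrightarrow>
        over n X I a' b' u z' \<longrightarrow> agree {..<n} z z')"
    proof (intro conjI allI impI)
      show "\<exists>z. over n X I a' b' u z"
        using y(1) iy yu by blast
      fix z z'
      assume z: "over n X I a' b' u z"
        and z': "over n X I a' b' u z'"
      show "agree {..<n} z z'" by (rule agree_trans[OF un[OF z] agree_sym[OF un[OF z']]])
    qed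
  qed
  obtain x where x: "x \<in> box I a1 b1" using box_nonempty subbox_less[OF 1(1)] by metis
  then obtain y where y: "agree I y x" "inside {..<n} (lo t) (hi t) y"
      "\<And>a' b'. subbox {..<n} (lo t) (hi t) a' b' \<Longrightarrow> inside {..<n} a' b' y \<Longrightarrow> \<not> sheet n X I a' b'"
    using 1(2) unfolding T_def by blast
  have in': "inside {..<n} a' b' y" using key y x unfolding mem_box_inside by blast
  have "subbox {..<n} (lo t) (hi t) a' b'"
    unfolding subbox_def
  proof
    fix i assume "i \<in> {..<n}"
    then have "a' i < b' i" using in' unfolding inside_def by (blast intro: less_trans)
    then show "lo t i \<le> a' i \<and> a' i < b' i \<and> b' i \<le> hi t i" unfolding a'_def b'_def by auto
  qed
  then show False using y(3) in' sh by blast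
qed

text \<open>If the values of each coordinate outside \<open>I\<close> on the fibre contain no
  interval, the dichotomy leaves only the value \<open>y j\<close> near \<open>y j\<close>. These
  neighbourhoods together make a box that isolates \<open>y\<close>.\<close>

lemma nonisolated_coordinate_interval:
  assumes X: "definable \<M> n X" and I: "I \<subseteq> {..<n}"
    and y: "restrict y {..<n} \<in> X" "agree I y x" "\<not> isolated_in_fibre n X I y"
  obtains j l u where "j \<in> {..<n} - I" "l < u"
    "\<And>v. l < v \<Longrightarrow> v < u \<Longrightarrow> \<exists>z. restrict z {..<n} \<in> X \<and> agree I z x \<and> z j = v"
proof (rule ccontr)
  assume no: "\<not> thesis"
  note found = that
  interpret U: tame_line \<M> "(<)" by unfold_locales auto
  interpret D: tame_line \<M> "(>)" by unfold_locales auto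
  have fin: "finite I" using I finite_subset by blast
  let ?S = "\<lambda>j v. \<exists>z. restrict z {..<n} \<in> X \<and> agree I z x \<and> z j = v"
  have dS: "def_pred \<M> (\<lambda>e. ?S j (e 0))" for j
    by (intro def_pred_intros def_pred_agree def_pred_mem[OF X] fin)
  have "\<exists>c d. c < y j \<and> y j < d \<and> (j \<notin> I \<longrightarrow> (\<forall>v. c < v \<and> v < d \<and> ?S j v \<longrightarrow> v = y j))"
    if j: "j < n" for j
  proof (cases "j \<in> I")
    case True
    then show ?thesis using lt_ex gt_ex by blast
  next
    case False
    have *: "\<not> (\<forall>v. l < v \<longrightarrow> v < u \<longrightarrow> ?S j v)" if "l < u" for l u
      using no found[of j l u] j False that by blast
    have "\<not> after (<) (y j) (?S j)" "\<not> after (>) (y j) (?S j)"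
      unfolding after_def using * by blast+
    then have "after (<) (y j) (\<lambda>v. \<not> ?S j v)" "after (>) (y j) (\<lambda>v. \<not> ?S j v)"
      using U.after_dichotomy[OF dS] D.after_dichotomy[OF dS] by blast+
    then obtain c d where "c < y j" "y j < d"
        "\<And>v. c < v \<Longrightarrow> v < y j \<Longrightarrow> \<not> ?S j v" "\<And>v. y j < v \<Longrightarrow> v < d \<Longrightarrow> \<not> ?S j v"
      unfolding after_def by blast
    then show ?thesis by (meson neqE)
  qed
  then obtain c d where cd: "\<And>j. j < n \<Longrightarrow> c j < y j \<and> y j < d j \<and>
      (j \<notin> I \<longrightarrow> (\<forall>v. c j < v \<and> v < d j \<and> ?S j v \<longrightarrow> v = y j))"
    by metis
  have "inside {..<n} c d y" using cd unfolding inside_def by blast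
  moreover have "agree {..<n} z y"
    if z: "restrict z {..<n} \<in> X" "inside {..<n} c d z" "agree I z y" for z
  proof -
    have zx: "agree I z x" using z(3) y(2) agree_trans by blast
    have "z j = y j" if j: "j < n" for j
    proof (cases "j \<in> I")
      case True
      then show ?thesis using z(3) unfolding agree_def by blast
    next
      case False
      then show ?thesis using cd[OF j] z(1,2) zx j unfolding inside_def by blast
    qed
    then show ?thesis unfolding agree_def by simp
  qed
  ultimately show False using y(3) unfolding isolated_in_fibre_def by blast
qed

lemma box_finite_cover:
  assumes "finite J" "finite I" "\<And>i. i \<in> I \<Longrightarrow> a i < b i" "\<And>j. j \<in> J \<Longrightarrow> def_pred \<M> (P j)"
    and "\<And>x. x \<in> box I a b \<Longrightarrow> \<exists>j\<in>J. P j x"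
  shows "\<exists>a' b'. \<exists>j\<in>J. subbox I a b a' b' \<and> (\<forall>x\<in>box I a' b'. P j x)"
  using assms(1,3-)
proof (induction J arbitrary: a b)
  case empty
  obtain x where "x \<in> box I a b" using box_nonempty[of I a b] empty.prems(1) by metis
  then show ?case using empty.prems(3) by blast
next
  case (insert j J)
  obtain a1 b1 where 1: "subbox I a b a1 b1" "(\<forall>x\<in>box I a1 b1. P j x) \<or> (\<forall>x\<in>box I a1 b1. \<not> P j x)"
    using box_dichotomy[OF assms(2), of "P j" a b] insert.prems(1,2) by blast
  from 1(2) show ?case
  proof
    assume "\<forall>x\<in>box I a1 b1. P j x"
    then show ?thesis using 1(1) by blast
  next
    assume no: "\<forall>x\<in>box I a1 b1. \<not> P j x"
    have "\<exists>j\<in>J. P j x" if "x \<in> box I a1 b1" for x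
      using insert.prems(3)[OF subbox_mem[OF 1(1) that]] no that by blast
    then obtain a2 b2 j' where "j' \<in> J" "subbox I a1 b1 a2 b2" "\<forall>x\<in>box I a2 b2. P j' x"
      using insert.IH[of a1 b1] subbox_less[OF 1(1)] insert.prems(2) by blast
    then show ?thesis using subbox_trans[OF 1(1)] by blast
  qed
qed

text \<open>Otherwise abnormal points occur over a whole box. If over a subbox all points are
  isolated in their fibres, \<open>not_isolated_abnormal\<close> applies. If not, then over some
  subbox every fibre takes an interval of values in one and the same coordinate \<open>j\<close>;
  \<open>box_in_fibres\<close> makes the interval uniform, so that the projection to
  \<open>insert j I\<close> has interior, against \<open>dim\<close>.\<close>

lemma generic_normal_fibre:
  assumes X: "definable \<M> n X" and I: "I \<subseteq> {..<n}" and ab: "\<And>i. i \<in> I \<Longrightarrow> a i < b i"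
    and cov: "\<And>u. u \<in> box I a b \<Longrightarrow> \<exists>y. restrict y {..<n} \<in> X \<and> agree I y u"
    and dim: "\<And>j. j \<in> {..<n} - I \<Longrightarrow> \<not> covers_box n X (insert j I)"
  obtains a' b' where "subbox I a b a' b'" "\<And>u. u \<in> box I a' b' \<Longrightarrow> normal_fibre n X I u"
proof -
  have fin: "finite I" using I finite_subset by blast
  note dX = def_pred_mem[OF X]
  let ?P = "\<lambda>u. \<exists>y. restrict y {..<n} \<in> X \<and> agree I y u \<and> \<not> normal_point n X I y"
  have "def_pred \<M> ?P"
    by (intro def_pred_intros def_pred_agree dX def_pred_normal_point[OF X fin] fin)
  then obtain a1 b1 where 1: "subbox I a b a1 b1" "(\<forall>u\<in>box I a1 b1. ?P u) \<or> (\<forall>u\<in>box I a1 b1. \<not> ?P u)"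
    using box_dichotomy[OF fin, of ?P a b] ab by blast
  have "\<not> (\<forall>u\<in>box I a1 b1. ?P u)"
  proof
    assume abn: "\<forall>u\<in>box I a1 b1. ?P u"
    let ?Iso = "\<lambda>u. \<forall>y. restrict y {..<n} \<in> X \<and> agree I y u \<longrightarrow> isolated_in_fibre n X I y"
    have "def_pred \<M> ?Iso"
      by (intro def_pred_intros def_pred_agree dX
          def_pred_isolated_in_fibre[OF X fin] fin)
    then obtain a2 b2 where 2: "subbox I a1 b1 a2 b2"
        "(\<forall>u\<in>box I a2 b2. ?Iso u) \<or> (\<forall>u\<in>box I a2 b2. \<not> ?Iso u)"
      using box_dichotomy[OF fin, of ?Iso a1 b1] subbox_less[OF 1(1)] by blast
    have "\<not> (\<forall>u\<in>box I a2 b2. ?Iso u)"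
    proof
      assume iso: "\<forall>u\<in>box I a2 b2. ?Iso u"
      have "\<exists>y. restrict y {..<n} \<in> X \<and> agree I y x \<and> \<not> normal_point n X I y \<and> isolated_in_fibre n X I y"
        if "x \<in> box I a2 b2" for x
        using abn subbox_mem[OF 2(1) that] iso that by blast
      then show False using not_isolated_abnormal[of n X I a2 b2, OF X I subbox_less[OF 2(1)]] by blast
    qed
    then have non: "\<not> ?Iso u" if "u \<in> box I a2 b2" for u using 2(2) that by blast
    let ?S = "\<lambda>j u v. \<exists>z. restrict z {..<n} \<in> X \<and> agree I z u \<and> z j = v"
    let ?F = "\<lambda>j u. \<exists>l m. l < m \<and> (\<forall>v. l < v \<and> v < m \<longrightarrow> ?S j u v)"
    have "\<exists>j\<in>{..<n} - I. ?F j u" if u: "u \<in> box I a2 b2" for u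
    proof -
      obtain y where "restrict y {..<n} \<in> X" "agree I y u" "\<not> isolated_in_fibre n X I y"
        using non[OF u] by blast
      from nonisolated_coordinate_interval[OF X I this]
      obtain j l m where "j \<in> {..<n} - I" "l < m" "\<And>v. l < v \<Longrightarrow> v < m \<Longrightarrow> ?S j u v" by metis
      then show ?thesis by blast
    qed
    moreover have dF: "def_pred \<M> (?F j)" for j
      by (intro def_pred_intros def_pred_agree dX fin)
    ultimately obtain a3 b3 j where 3: "j \<in> {..<n} - I" "subbox I a2 b2 a3 b3" "\<forall>u\<in>box I a3 b3. ?F j u"
      using box_finite_cover[of "{..<n} - I" I a2 b2 ?F] fin subbox_less[OF 2(1)] by blast
    have "def_pred \<M> (\<lambda>e. ?S j (\<lambda>i. e (Suc i)) (e 0))"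
      by (intro def_pred_intros def_pred_agree dX fin)
    then obtain a4 b4 l m where 4: "subbox I a3 b3 a4 b4" "l < m"
        "\<And>u v. u \<in> box I a4 b4 \<Longrightarrow> l < v \<Longrightarrow> v < m \<Longrightarrow> ?S j u v"
      using box_in_fibres[OF fin, of "?S j" a3 b3] subbox_less[OF 3(2)] 3(3) by blast
    have "covers_box n X (insert j I)"
      unfolding covers_box_def
    proof (rule exI[of _ "a4(j := l)"], rule exI[of _ "b4(j := m)"], intro conjI ballI)
      fix i assume "i \<in> insert j I"
      then show "(a4(j := l)) i < (b4(j := m)) i" using 4(2) subbox_less[OF 4(1)] by auto
    next
      fix w assume "w \<in> box (insert j I) (a4(j := l)) (b4(j := m))"
      then obtain u v where uv: "u \<in> box I a4 b4" "l < v" "v < m" "w = (\<lambda>i. if i = j then v else u i)"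
        by (rule box_insertE) (use 3(1) in auto)
      then obtain z where z: "restrict z {..<n} \<in> X" "agree I z u" "z j = v" using 4(3) by blast
      then have "agree (insert j I) z w" using uv(4) unfolding agree_def by auto
      then show "\<exists>y. restrict y {..<n} \<in> X \<and> agree (insert j I) y w" using z(1) by blast
    qed
    then show False using dim 3(1) by blast
  qed
  then have no: "\<forall>u\<in>box I a1 b1. \<not> ?P u" using 1(2) by blast
  show thesis
  proof (rule that[OF 1(1)])
    fix u assume u: "u \<in> box I a1 b1"
    show "normal_fibre n X I u"
      unfolding normal_fibre_def using cov[OF subbox_mem[OF 1(1) u]] no u by blast
  qed
qed

text \<open>Normal points are isolated, so the fibre is discrete and
  \<open>uniform_threshold\<close> applies to it. The sides of the base box are fixed one at a time:
  those in \<open>J\<close> are already common to all points, and the next one is found as a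
  threshold, since \<open>sheet_shrink\<close> allows a sheet to be narrowed in that
  direction.\<close>

lemma common_base_box:
  assumes X: "definable \<M> n X" and I: "I \<subseteq> {..<n}" and x: "normal_fibre n X I x"
  obtains a b where "inside I a b x"
    "\<And>y. restrict y {..<n} \<in> X \<Longrightarrow> agree I y x \<Longrightarrow>
      \<exists>c d. agree I c a \<and> agree I d b \<and> inside {..<n} c d y \<and> sheet n X I c d"
proof -
  interpret U: tame_line \<M> "(<)" by unfold_locales auto
  interpret D: tame_line \<M> "(>)" by unfold_locales auto
  have fin: "finite I" using I finite_subset by blast
  have X_cart: "X \<subseteq> cart_power n" using X unfolding definable_iff_def_pred by blast
  define Y where "Y = {y \<in> X. agree I y x}"
  have res_agree: "agree I (restrict y {..<n}) x \<longleftrightarrow> agree I y x" for y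
    using I unfolding agree_def by auto
  have res: "restrict y {..<n} = y" if "y \<in> X" for y
    using X_cart that by (auto intro: PiE_restrict)
  have "def_pred \<M> (\<lambda>e. restrict e {..<n} \<in> X \<and> agree I e x)"
    by (intro def_pred_intros def_pred_mem[OF X] def_pred_agree fin)
  then have Y1: "definable \<M> n Y"
    unfolding definable_iff_def_pred Y_def using X_cart res_agree by auto
  have normal: "normal_point n X I y" if "y \<in> Y" for y
    using x that res unfolding normal_fibre_def Y_def by auto
  have Y2: "discrete_in_power n Y"
    unfolding discrete_in_power_iff
  proof (intro conjI ballI)
    show "Y \<subseteq> cart_power n" using X_cart unfolding Y_def by blast
  next
    fix y assume y: "y \<in> Y"
    then have yX: "restrict y {..<n} \<in> X" "y \<in> extensional {..<n}"
      using res X_cart by (auto simp: Y_def PiE_iff)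
    have iso: "isolated_in_fibre n X I y" using normal_point_isolated[OF normal[OF y] I yX(1)] .
    obtain c d where cd: "inside {..<n} c d y"
      "\<And>z. restrict z {..<n} \<in> X \<Longrightarrow> inside {..<n} c d z \<Longrightarrow> agree I z y \<Longrightarrow> agree {..<n} z y"
      using iso unfolding isolated_in_fibre_def by blast
    have "z = y" if z: "z \<in> Y" "z \<in> box {..<n} c d" for z
    proof -
      have "agree I z y" using z(1) y agree_sym agree_trans unfolding Y_def by blast
      moreover have "restrict z {..<n} \<in> X" using z(1) res unfolding Y_def by simp
      ultimately have "agree {..<n} z y" using cd(2)[of z] z(2) unfolding mem_box_inside by blast
      then have "restrict z {..<n} = restrict y {..<n}" by (rule restrict_agree)
      then show "z = y" using res z(1) y unfolding Y_def by simp
    qed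
    then have "Y \<inter> box {..<n} c d \<subseteq> {y}" by blast
    moreover have "y \<in> box {..<n} c d" using cd(1) yX(2) unfolding mem_box_inside by blast
    ultimately show "\<exists>a b. y \<in> box {..<n} a b \<and> Y \<inter> box {..<n} a b \<subseteq> {y}" by blast
  qed
  have "\<exists>a b. inside J a b x \<and>
      (\<forall>y\<in>Y. \<exists>c d. agree J c a \<and> agree J d b \<and> inside {..<n} c d y \<and> sheet n X I c d)"
    if "finite J" "J \<subseteq> I" for J
    using that
  proof (induction J)
    case empty
    have "\<exists>c d. inside {..<n} c d y \<and> sheet n X I c d" if "y \<in> Y" for y
      using normal[OF that] inside_nonempty[of "{..<n}" y] unfolding normal_point_def by metis
    then show ?case unfolding inside_def agree_def by blast
  next
    case (insert j J)
    then obtain a b where ab: "inside J a b x"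
      "\<And>y. y \<in> Y \<Longrightarrow> \<exists>c d. agree J c a \<and> agree J d b \<and> inside {..<n} c d y \<and> sheet n X I c d"
      by blast
    have jI: "j \<in> I" "j < n" using insert.prems I by auto
    have yj: "y j = x j" if "y \<in> Y" for y using that jI unfolding Y_def agree_def by blast
    define R where "R y t \<longleftrightarrow> (\<exists>c d. agree J c a \<and> agree J d b \<and> c j = t \<and> inside {..<n} c d y \<and> sheet n X I c d)" for y t
    have finJ: "finite J" using insert by blast
    have dR: "def_pred \<M> (\<lambda>e. R (\<lambda>i. e (Suc i)) (e 0))"
      unfolding R_def
      by (intro def_pred_intros def_pred_agree def_pred_inside
          def_pred_sheet[OF X fin] finJ finite_lessThan)
    have monoR: "R y t'" if y: "y \<in> Y" and R: "R y t" "t < t'" "t' < x j" for y t t'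
    proof -
      obtain c d where cd: "agree J c a" "agree J d b" "c j = t" "inside {..<n} c d y" "sheet n X I c d"
        using R(1) unfolding R_def by blast
      have "sheet n X I (c(j := t')) d"
        by (rule sheet_shrink[OF cd(5) I]) (use cd(3) R(2) jI in auto)
      moreover have "inside {..<n} (c(j := t')) d y"
        using cd(4) R(3) yj[OF y] unfolding inside_def by auto
      moreover have "agree J (c(j := t')) a" using cd(1) insert.hyps(2) unfolding agree_def by auto
      ultimately show ?thesis using cd(2) unfolding R_def by (metis fun_upd_same)
    qed
    have exR: "\<exists>t. t < x j \<and> R y t" if "y \<in> Y" for y
      using ab(2)[OF that] yj[OF that] jI(2) unfolding R_def inside_def by (metis lessThan_iff)
    obtain t where t: "t < x j" "\<And>y. y \<in> Y \<Longrightarrow> R y t"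
      using U.uniform_threshold[OF Y1 Y2 dR, of "x j"] monoR exR by blast
    \<comment> \<open>With the lower side fixed at \<open>t\<close>, the upper side is a threshold
      for the reversed order.\<close>
    define Q where "Q y s \<longleftrightarrow> (\<exists>c d. agree J c a \<and> agree J d b \<and> c j = t \<and> d j = s \<and> inside {..<n} c d y \<and> sheet n X I c d)" for y s
    have dQ: "def_pred \<M> (\<lambda>e. Q (\<lambda>i. e (Suc i)) (e 0))"
      unfolding Q_def
      by (intro def_pred_intros def_pred_agree def_pred_inside
          def_pred_sheet[OF X fin] finJ finite_lessThan)
    have monoQ: "Q y s'" if y: "y \<in> Y" and Q: "Q y s" "s > s'" "s' > x j" for y s s'
    proof -
      obtain c d where cd: "agree J c a" "agree J d b" "c j = t" "d j = s" "inside {..<n} c d y" "sheet n X I c d"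
        using Q(1) unfolding Q_def by blast
      have "sheet n X I c (d(j := s'))"
        by (rule sheet_shrink[OF cd(6) I]) (use cd(4) Q(2) jI in auto)
      moreover have "inside {..<n} c (d(j := s')) y"
        using cd(5) Q(3) yj[OF y] unfolding inside_def by auto
      moreover have "agree J (d(j := s')) b" using cd(2) insert.hyps(2) unfolding agree_def by auto
      ultimately show ?thesis using cd(1,3) unfolding Q_def by (metis fun_upd_same)
    qed
    have exQ: "\<exists>s. s > x j \<and> Q y s" if "y \<in> Y" for y
      using t(2)[OF that] yj[OF that] jI(2) unfolding Q_def R_def inside_def by (metis lessThan_iff)
    obtain s where s: "s > x j" "\<And>y. y \<in> Y \<Longrightarrow> Q y s"
      using D.uniform_threshold[OF Y1 Y2 dQ, of "x j"] monoQ exQ by blast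
    have "inside (insert j J) (a(j := t)) (b(j := s)) x"
      using ab(1) t(1) s(1) unfolding inside_def by auto
    moreover have "\<exists>c d. agree (insert j J) c (a(j := t)) \<and> agree (insert j J) d (b(j := s)) \<and>
        inside {..<n} c d y \<and> sheet n X I c d" if y: "y \<in> Y" for y
    proof -
      obtain c d where cd: "agree J c a" "agree J d b" "c j = t" "d j = s" "inside {..<n} c d y" "sheet n X I c d"
        using s(2)[OF y] unfolding Q_def by blast
      have "agree (insert j J) c (a(j := t))" "agree (insert j J) d (b(j := s))"
        using cd(1-4) unfolding agree_def by auto
      then show ?thesis using cd(5,6) by blast
    qed
    ultimately show ?case by blast
  qed
  from this[OF fin subset_refl] obtain a b where ab: "inside I a b x"
      "\<And>y. y \<in> Y \<Longrightarrow> \<exists>c d. agree I c a \<and> agree I d b \<and> inside {..<n} c d y \<and> sheet n X I c d"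
    by blast
  show thesis
  proof (rule that[OF ab(1)])
    fix y assume y: "restrict y {..<n} \<in> X" "agree I y x"
    then have "restrict y {..<n} \<in> Y" unfolding Y_def using res_agree by blast
    from ab(2)[OF this] show "\<exists>c d. agree I c a \<and> agree I d b \<and> inside {..<n} c d y \<and> sheet n X I c d"
      unfolding inside_def by simp
  qed
qed

end

section \<open>Decomposition\<close>


text \<open>Passing to the interior of the set of base points with normal fibre makes the image of
  the normal part open, as quasi-special submanifolds require.\<close>

definition normal_interior :: "nat \<Rightarrow> (nat \<Rightarrow> 'a::linorder) set \<Rightarrow> nat set \<Rightarrow> (nat \<Rightarrow> 'a) \<Rightarrow> bool" where
  "normal_interior n X I u \<longleftrightarrow>
     (\<exists>a b. inside I a b u \<and> (\<forall>w. inside I a b w \<longrightarrow> normal_fibre n X I w))"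

definition normal_part :: "nat \<Rightarrow> (nat \<Rightarrow> 'a::linorder) set \<Rightarrow> nat set \<Rightarrow> (nat \<Rightarrow> 'a) set" where
  "normal_part n X I = {y \<in> X. normal_interior n X I y}"

lemma def_pred_normal_interior:
  assumes "definable \<M> n X" "finite I" "\<And>i. accessor (\<lambda>e. f e i)"
  shows "def_pred \<M> (\<lambda>e. normal_interior n X I (f e))"
  unfolding normal_interior_def
  by (intro def_pred_intros def_pred_inside def_pred_normal_fibre[OF assms(1,2)]
      assms(2) accessor_subst[OF assms(3)])

lemma normal_interior_agree: "agree I u v \<Longrightarrow> normal_interior n X I u \<longleftrightarrow> normal_interior n X I v"
  unfolding normal_interior_def using inside_agree by blast

lemma normal_interior_fibre: "normal_interior n X I u \<Longrightarrow> normal_fibre n X I u"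
  unfolding normal_interior_def by blast

lemma agree_restrict: "I \<subseteq> {..<n} \<Longrightarrow> agree I (restrict y {..<n}) y"
  unfolding agree_def by auto

lemma inside_restrict: "inside {..<n} a b (restrict y {..<n}) \<longleftrightarrow> inside {..<n} a b y"
  unfolding inside_def by simp

lemma definable_subset: "definable \<M> n X \<Longrightarrow> X \<subseteq> cart_power n"
  unfolding definable_iff_def_pred by blast

lemma definable_restrict: "definable \<M> n X \<Longrightarrow> y \<in> X \<Longrightarrow> restrict y {..<n} = y"
  using definable_subset by (fastforce intro: PiE_restrict)

lemma definable_Diff:
  assumes "definable \<M> n X" "definable \<M> n Y"
  shows "definable \<M> n (X - Y)"
  unfolding definable_iff_def_pred Diff_iff
  using definable_subset[OF assms(1)]
  by (intro conjI def_pred_conj def_pred_not def_pred_mem assms accessor_var) auto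

lemma covers_box_mono: "covers_box n X I \<Longrightarrow> X \<subseteq> Y \<Longrightarrow> covers_box n Y I"
  unfolding covers_box_def by blast

lemma open_box_box: "open_box n (box {..<n} a b)"
  unfolding open_box_def box_def by (rule exI, rule exI, rule refl)

lemma definable_normal_part:
  assumes X: "definable \<M> n X" and I: "I \<subseteq> {..<n}"
  shows "definable \<M> n (normal_part n X I)"
proof -
  have fin: "finite I" using I finite_subset by blast
  have "def_pred \<M> (\<lambda>e. restrict e {..<n} \<in> X \<and> normal_interior n X I e)"
    by (intro def_pred_intros def_pred_mem[OF X] def_pred_normal_interior[OF X fin])
  then show ?thesis
    unfolding definable_iff_def_pred normal_part_def
    using definable_subset[OF X] by (auto simp: normal_interior_agree[OF agree_restrict[OF I]])
qed

context tame begin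

text \<open>A box covered by the projection of the remainder is covered by that of \<open>X\<close>,
  so fibres of \<open>X\<close> are normal over a whole subbox. All points of \<open>X\<close> above
  it then belong to the normal part, and none is left for the remainder.\<close>

lemma normal_part_remainder:
  assumes X: "definable \<M> n X" and I: "I \<subseteq> {..<n}"
    and dim: "\<And>j. j \<in> {..<n} - I \<Longrightarrow> \<not> covers_box n X (insert j I)"
  shows "\<not> covers_box n (X - normal_part n X I) I"
proof
  assume "covers_box n (X - normal_part n X I) I"
  then obtain a b where ab: "\<And>i. i \<in> I \<Longrightarrow> a i < b i"
    and cov: "\<And>u. u \<in> box I a b \<Longrightarrow> \<exists>y. restrict y {..<n} \<in> X - normal_part n X I \<and> agree I y u"
    unfolding covers_box_def by blast
  have "\<exists>y. restrict y {..<n} \<in> X \<and> agree I y u" if "u \<in> box I a b" for u using cov[OF that] by blast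
  from generic_normal_fibre[of n X I a b, OF X I ab this dim]
  obtain a' b' where 1: "subbox I a b a' b'" "\<And>u. u \<in> box I a' b' \<Longrightarrow> normal_fibre n X I u" by metis
  have nf: "normal_fibre n X I w" if "inside I a' b' w" for w
  proof -
    have ag: "agree I (restrict w I) w" unfolding agree_def by simp
    then have "restrict w I \<in> box I a' b'"
      using that inside_agree[OF ag] unfolding mem_box_inside by simp
    then have "normal_fibre n X I (restrict w I)" by (rule 1(2))
    moreover have "agree I y (restrict w I) \<longleftrightarrow> agree I y w" for y unfolding agree_def by simp
    ultimately show ?thesis unfolding normal_fibre_def by simp
  qed
  obtain u where u: "u \<in> box I a' b'" using box_nonempty subbox_less[OF 1(1)] by metis
  then have "normal_interior n X I u"
    using nf unfolding normal_interior_def mem_box_inside by blast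
  moreover obtain y where y: "restrict y {..<n} \<in> X - normal_part n X I" "agree I y u"
    using cov[OF subbox_mem[OF 1(1) u]] by blast
  have "agree I (restrict y {..<n}) u" using agree_restrict[OF I] y(2) agree_trans by blast
  ultimately have "normal_interior n X I (restrict y {..<n})" using normal_interior_agree by blast
  then show False using y(1) unfolding normal_part_def by blast
qed

text \<open>The box \<open>U\<close> must serve all points above \<open>x\<close>: it is the box of
  \<open>common_base_box\<close> intersected with a neighbourhood over which all fibres are normal.
  The sheet at each point is the graph of \<open>\<tau>\<close>, which is continuous because there
  are arbitrarily small sheets at each of its values.\<close>

lemma normal_part_quasi_special:
  assumes X: "definable \<M> n X" and I: "I \<subseteq> {..<n}"
  shows "quasi_special \<M> n (normal_part n X I)"
proof -
  have fin: "finite I" using I finite_subset by blast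
  define d where "d = card I"
  define \<sigma> where "\<sigma> = enumerate I"
  define C where "C = normal_part n X I"
  have mono: "strict_mono_on {..<d} \<sigma>"
    unfolding strict_mono_on_def \<sigma>_def d_def using finite_enumerate_mono[OF _ fin] by auto
  then have inj: "inj_on \<sigma> {..<d}" by (rule strict_mono_on_imp_inj_on)
  have "\<sigma> ` {..<d} \<subseteq> I" unfolding \<sigma>_def d_def using finite_enumerate_in_set[OF fin] by auto
  then have img: "\<sigma> ` {..<d} = I"
    by (rule card_subset_eq[OF fin], unfold card_image[OF inj]) (simp add: d_def)
  have \<sigma>I: "\<sigma> k \<in> I" if "k < d" for k using img that by blast
  define \<kappa> where "\<kappa> = inv_into {..<d} \<sigma>"
  have \<kappa>: "\<kappa> i < d" "\<sigma> (\<kappa> i) = i" if "i \<in> I" for i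
    using that img inv_into_into[of i \<sigma> "{..<d}"] f_inv_into_f[of i \<sigma> "{..<d}"] unfolding \<kappa>_def by auto
  have \<kappa>\<sigma>: "\<kappa> (\<sigma> k) = k" if "k < d" for k
    unfolding \<kappa>_def using inv_into_f_f[OF inj] that by simp
  \<comment> \<open>A base point is renumbered by the elements of \<open>I\<close>, so that it can
    be compared with points by \<open>agree I\<close>; its terms outside \<open>I\<close> do not
    matter.\<close>
  define lift :: "(nat \<Rightarrow> 'a) \<Rightarrow> nat \<Rightarrow> 'a" where "lift w = (\<lambda>i. w (\<kappa> i))" for w
  have proj_iff: "coord_proj d \<sigma> z = w \<longleftrightarrow> agree I z (lift w)" if "w \<in> extensional {..<d}" for z w
  proof
    assume "coord_proj d \<sigma> z = w"
    then show "agree I z (lift w)"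
      using \<kappa> unfolding agree_def lift_def coord_proj_def by auto
  next
    assume "agree I z (lift w)"
    then have "z (\<sigma> k) = w k" if "k < d" for k
      using \<sigma>I[OF that] \<kappa>\<sigma>[OF that] unfolding agree_def lift_def by auto
    then show "coord_proj d \<sigma> z = w"
      using that unfolding coord_proj_def by (auto simp: fun_eq_iff extensional_def)
  qed
  have proj_ext: "coord_proj d \<sigma> z \<in> extensional {..<d}" for z
    unfolding coord_proj_def by simp
  have cart: "w \<in> cart_power k \<longleftrightarrow> w \<in> extensional {..<k}" for w :: "nat \<Rightarrow> 'a" and k
    by (auto simp: PiE_iff)
  have inside_lift: "inside {..<d} (\<lambda>k. a (\<sigma> k)) (\<lambda>k. b (\<sigma> k)) w \<longleftrightarrow> inside I a b (lift w)" for a b w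
    using \<kappa> \<kappa>\<sigma> \<sigma>I unfolding inside_def lift_def by (metis lessThan_iff)
  have dC: "definable \<M> n C" unfolding C_def by (rule definable_normal_part[OF X I])
  have CX: "y \<in> X \<and> restrict y {..<n} = y \<and> normal_interior n X I y" if "y \<in> C" for y
    using that definable_restrict[OF X] unfolding C_def normal_part_def by blast
  have base: "coord_proj d \<sigma> ` C = {w \<in> cart_power d. normal_interior n X I (lift w)}"
  proof (intro equalityI subsetI)
    fix w assume "w \<in> coord_proj d \<sigma> ` C"
    then obtain y where y: "y \<in> C" "coord_proj d \<sigma> y = w" by blast
    then have w: "w \<in> extensional {..<d}" using proj_ext by blast
    then have "agree I y (lift w)" using proj_iff y(2) by blast
    then show "w \<in> {w \<in> cart_power d. normal_interior n X I (lift w)}"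
      using normal_interior_agree CX[OF y(1)] w cart by blast
  next
    fix w assume w: "w \<in> {w \<in> cart_power d. normal_interior n X I (lift w)}"
    then obtain y where y: "restrict y {..<n} \<in> X" "agree I y (lift w)"
      using normal_interior_fibre unfolding normal_fibre_def by blast
    let ?y = "restrict y {..<n}"
    have ag: "agree I ?y (lift w)" using agree_restrict[OF I] y(2) agree_trans by blast
    then have "?y \<in> C"
      using y(1) w normal_interior_agree[OF ag] unfolding C_def normal_part_def by blast
    moreover have "coord_proj d \<sigma> ?y = w" using proj_iff ag w cart by blast
    ultimately show "w \<in> coord_proj d \<sigma> ` C" by blast
  qed
  have la: "agree I (lift (restrict e {..<d})) (lift e)" for e
    using \<kappa>(1) unfolding agree_def lift_def by simp
  have "restrict e {..<d} \<in> coord_proj d \<sigma> ` C \<longleftrightarrow> normal_interior n X I (lift e)" for e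
    unfolding base using normal_interior_agree[OF la[of e]] by simp
  moreover have "def_pred \<M> (\<lambda>e. normal_interior n X I (lift e))"
    unfolding lift_def by (intro def_pred_normal_interior[OF X fin] accessor_var)
  ultimately have "def_pred \<M> (\<lambda>e. restrict e {..<d} \<in> coord_proj d \<sigma> ` C)"
    by (simp only: )
  moreover have base_cart: "coord_proj d \<sigma> ` C \<subseteq> cart_power d" unfolding base by blast
  ultimately have dbase: "definable \<M> d (coord_proj d \<sigma> ` C)"
    unfolding definable_iff_def_pred by blast
  have obase: "openin (power_topology d) (coord_proj d \<sigma> ` C)"
    unfolding openin_power_iff
  proof (intro conjI ballI)
    show "coord_proj d \<sigma> ` C \<subseteq> cart_power d" unfolding base by blast
    fix w assume "w \<in> coord_proj d \<sigma> ` C"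
    then have w: "w \<in> extensional {..<d}" "normal_interior n X I (lift w)"
      unfolding base cart by auto
    then obtain a b where ab: "inside I a b (lift w)" "\<And>v. inside I a b v \<Longrightarrow> normal_fibre n X I v"
      unfolding normal_interior_def by blast
    have "w \<in> box {..<d} (\<lambda>k. a (\<sigma> k)) (\<lambda>k. b (\<sigma> k))"
      unfolding mem_box_inside inside_lift using w(1) ab(1) by blast
    moreover have "box {..<d} (\<lambda>k. a (\<sigma> k)) (\<lambda>k. b (\<sigma> k)) \<subseteq> coord_proj d \<sigma> ` C"
    proof
      fix v assume "v \<in> box {..<d} (\<lambda>k. a (\<sigma> k)) (\<lambda>k. b (\<sigma> k))"
      then have "v \<in> extensional {..<d}" "inside I a b (lift v)"
        unfolding mem_box_inside inside_lift by auto
      then show "v \<in> coord_proj d \<sigma> ` C"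
        unfolding base cart normal_interior_def using ab(2) by blast
    qed
    ultimately show "\<exists>a b. w \<in> box {..<d} a b \<and> box {..<d} a b \<subseteq> coord_proj d \<sigma> ` C" by blast
  qed
  have "\<exists>U. open_box d U \<and> x \<in> U \<and>
      (\<forall>y \<in> C. coord_proj d \<sigma> y = x \<longrightarrow>
         (\<exists>V \<tau>. open_box n V \<and> y \<in> V \<and> definable_map \<M> d n U \<tau> \<and>
            continuous_map (subtopology (power_topology d) U) (power_topology n) \<tau> \<and>
            coord_proj d \<sigma> ` V = U \<and> \<tau> ` U = C \<inter> V \<and> (\<forall>u \<in> U. coord_proj d \<sigma> (\<tau> u) = u)))"
    if x: "x \<in> coord_proj d \<sigma> ` C" for x
  proof -
    have x': "x \<in> extensional {..<d}" "normal_interior n X I (lift x)"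
      using x unfolding base cart by auto
    obtain a0 b0 where 0: "inside I a0 b0 (lift x)" "\<And>w. inside I a0 b0 w \<Longrightarrow> normal_fibre n X I w"
      using x'(2) unfolding normal_interior_def by blast
    obtain a1 b1 where 1: "inside I a1 b1 (lift x)"
      "\<And>y. restrict y {..<n} \<in> X \<Longrightarrow> agree I y (lift x) \<Longrightarrow>
        \<exists>c e. agree I c a1 \<and> agree I e b1 \<and> inside {..<n} c e y \<and> sheet n X I c e"
      using common_base_box[OF X I normal_interior_fibre[OF x'(2)]] by metis
    define a b where "a i = max (a0 i) (a1 i)" and "b i = min (b0 i) (b1 i)" for i
    have abx: "inside I a b (lift x)" using 0(1) 1(1) unfolding inside_def a_def b_def by auto
    have ab_nf: "normal_interior n X I w" if "inside I a b w" for w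
    proof -
      have "inside I a0 b0 w" using that unfolding inside_def a_def b_def by auto
      then show ?thesis using 0(2) unfolding normal_interior_def by blast
    qed
    define U where "U = box {..<d} (\<lambda>k. a (\<sigma> k)) (\<lambda>k. b (\<sigma> k))"
    have U: "w \<in> U \<longleftrightarrow> w \<in> extensional {..<d} \<and> inside I a b (lift w)" for w
      unfolding U_def mem_box_inside inside_lift ..
    have Uo: "open_box d U" unfolding U_def by (rule open_box_box)
    have "\<exists>V \<tau>. open_box n V \<and> y \<in> V \<and> definable_map \<M> d n U \<tau> \<and>
        continuous_map (subtopology (power_topology d) U) (power_topology n) \<tau> \<and>
        coord_proj d \<sigma> ` V = U \<and> \<tau> ` U = C \<inter> V \<and> (\<forall>u \<in> U. coord_proj d \<sigma> (\<tau> u) = u)"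
      if y: "y \<in> C" "coord_proj d \<sigma> y = x" for y
    proof -
      have yx: "agree I y (lift x)" using y(2) proj_iff[OF x'(1)] by blast
      obtain c0 e0 where ce0: "agree I c0 a1" "agree I e0 b1" "inside {..<n} c0 e0 y" "sheet n X I c0 e0"
        using 1(2)[OF _ yx] CX[OF y(1)] by metis
      \<comment> \<open>The box of the sheet at \<open>y\<close> keeps its own sides outside
        \<open>I\<close>. Those in \<open>I\<close> are replaced by the sides common to all points
        of the fibre, so that \<open>V\<close> projects exactly onto \<open>U\<close>.\<close>
      define c e where "c i = (if i \<in> I then a i else c0 i)" and "e i = (if i \<in> I then b i else e0 i)" for i
      have sh: "sheet n X I c e"
        by (rule sheet_shrink[OF ce0(4) I])
          (use ce0(1,2) in \<open>auto simp: c_def e_def a_def b_def agree_def\<close>)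
      have ce_I: "inside I c e w \<longleftrightarrow> inside I a b w" for w unfolding inside_def c_def e_def by auto
      have ce_in: "inside I a b z" if "inside {..<n} c e z" for z
      proof -
        have "inside I c e z" using that I unfolding inside_def by blast
        then show ?thesis unfolding ce_I .
      qed
      have iy: "inside {..<n} c e y"
      proof -
        have "inside I a b y" using abx inside_agree[OF yx] by blast
        then have "c i < y i \<and> y i < e i" if "i < n" for i
          using ce0(3) that unfolding inside_def c_def e_def by auto
        then show ?thesis unfolding inside_def by blast
      qed
      define V where "V = box {..<n} c e"
      have V: "z \<in> V \<longleftrightarrow> z \<in> extensional {..<n} \<and> inside {..<n} c e z" for z
        unfolding V_def mem_box_inside ..
      have Vo: "open_box n V" unfolding V_def by (rule open_box_box)
      have ext: "z \<in> extensional {..<n}" if "z \<in> X" for z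
        using definable_subset[OF X] that cart by blast
      have yV: "y \<in> V" unfolding V using iy ext CX[OF y(1)] by blast
      have ex: "\<exists>z. z \<in> X \<and> z \<in> V \<and> coord_proj d \<sigma> z = w" if w: "w \<in> U" for w
      proof -
        have "inside I c e (lift w)" using w unfolding U ce_I by blast
        then obtain z where z: "restrict z {..<n} \<in> X" "inside {..<n} c e z" "agree I z (lift w)"
          using sh unfolding sheet_def by blast
        let ?z = "restrict z {..<n}"
        have "?z \<in> V" unfolding V inside_restrict using z(2) by simp
        moreover have "coord_proj d \<sigma> ?z = w"
          using proj_iff w agree_trans[OF agree_restrict[OF I] z(3)] unfolding U by blast
        ultimately show ?thesis using z(1) by blast
      qed
      have uniq: "z = z'" if "z \<in> X" "z \<in> V" "z' \<in> X" "z' \<in> V" "coord_proj d \<sigma> z = coord_proj d \<sigma> z'" for z z'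
      proof -
        have "agree I z (lift (coord_proj d \<sigma> z))" "agree I z' (lift (coord_proj d \<sigma> z))"
          using proj_iff[OF proj_ext] that(5) by metis+
        then have "agree I z z'" using agree_sym agree_trans by blast
        moreover have r: "restrict z {..<n} = z" "restrict z' {..<n} = z'"
          using definable_restrict[OF X] that by blast+
        ultimately have "agree {..<n} z z'"
          using sheet_unique[OF sh I, of z z'] that V by auto
        then show "z = z'" using restrict_agree[of n z z'] r by simp
      qed
      \<comment> \<open>By \<open>uniq\<close> there is only one candidate, so \<open>SOME\<close>
        makes no real choice; the formula \<open>?P\<close> below describes the graph.\<close>
      define \<tau> where "\<tau> w = (SOME z. z \<in> X \<and> z \<in> V \<and> coord_proj d \<sigma> z = w)" for w
      have \<tau>: "\<tau> w \<in> X" "\<tau> w \<in> V" "coord_proj d \<sigma> (\<tau> w) = w" if "w \<in> U" for w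
        using someI_ex[OF ex[OF that]] unfolding \<tau>_def by blast+
      have \<tau>_eq: "\<tau> w = z" if "w \<in> U" "z \<in> X" "z \<in> V" "coord_proj d \<sigma> z = w" for w z
        using uniq[OF \<tau>(1,2)[OF that(1)] that(2,3)] \<tau>(3)[OF that(1)] that(4) by simp
      have V_proj: "coord_proj d \<sigma> z \<in> U" if "z \<in> V" for z
      proof -
        have "agree I z (lift (coord_proj d \<sigma> z))" using proj_iff[OF proj_ext] by blast
        then show ?thesis
          using ce_in that inside_agree proj_ext unfolding U V by blast
      qed
      have VC: "z \<in> C" if "z \<in> X" "z \<in> V" for z
        using ab_nf[OF ce_in] that unfolding V C_def normal_part_def by blast
      have pV: "coord_proj d \<sigma> ` V = U"
        using V_proj \<tau>(2,3) by (metis equalityI image_eqI image_subsetI subsetI)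
      have tU: "\<tau> ` U = C \<inter> V"
      proof (intro equalityI subsetI)
        fix z assume "z \<in> \<tau> ` U"
        then show "z \<in> C \<inter> V" using VC \<tau>(1,2) by blast
      next
        fix z assume z: "z \<in> C \<inter> V"
        then have "\<tau> (coord_proj d \<sigma> z) = z" using \<tau>_eq V_proj CX by blast
        then show "z \<in> \<tau> ` U" using V_proj z by (metis IntE image_eqI)
      qed
      have "definable_map \<M> d n U \<tau>"
        unfolding definable_map_def
      proof (intro conjI)
        show "U \<subseteq> cart_power d" unfolding subset_iff U cart by blast
        show "\<tau> ` U \<subseteq> cart_power n" using \<tau>(1) definable_subset[OF X] by blast
        let ?\<Gamma> = "(\<lambda>w. concat_point d n w (\<tau> w)) ` U"
        let ?P = "\<lambda>v. inside {..<d} (\<lambda>k. a (\<sigma> k)) (\<lambda>k. b (\<sigma> k)) v \<and> restrict (\<lambda>i. v (i + d)) {..<n} \<in> X \<and>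
          inside {..<n} c e (\<lambda>i. v (i + d)) \<and> (\<forall>k\<in>{..<d}. v (\<sigma> k + d) = v k)"
        have sub: "?\<Gamma> \<subseteq> cart_power (d + n)"
          by (rule image_subsetI) (simp add: concat_point_def)
        have "def_pred \<M> ?P"
          by (intro def_pred_intros def_pred_inside def_pred_mem[OF X] finite_lessThan)
        moreover have "restrict v {..<d + n} \<in> ?\<Gamma> \<longleftrightarrow> ?P v" for v
        proof
          assume "restrict v {..<d + n} \<in> ?\<Gamma>"
          then obtain w where w: "w \<in> U" "restrict v {..<d + n} = concat_point d n w (\<tau> w)" by blast
          have v1: "v k = w k" if "k < d" for k
            using fun_cong[OF w(2), of k] that by (simp add: concat_point_def)
          have v2: "v (i + d) = \<tau> w i" if "i < n" for i
            using fun_cong[OF w(2), of "i + d"] that by (simp add: concat_point_def)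
          have tw: "agree I (\<tau> w) (lift w)" using proj_iff \<tau>(3)[OF w(1)] w(1) unfolding U by blast
          have "inside {..<d} (\<lambda>k. a (\<sigma> k)) (\<lambda>k. b (\<sigma> k)) v"
            using w(1) v1 unfolding U_def mem_box_inside inside_def by simp
          moreover have ag: "agree {..<n} (\<lambda>i. v (i + d)) (\<tau> w)" using v2 unfolding agree_def by simp
          then have "restrict (\<lambda>i. v (i + d)) {..<n} \<in> X"
            using restrict_agree[OF ag] definable_restrict[OF X] \<tau>(1)[OF w(1)] by simp
          moreover have "inside {..<n} c e (\<lambda>i. v (i + d))"
            using inside_agree[OF ag] \<tau>(2)[OF w(1)] unfolding V by blast
          moreover have "v (\<sigma> k + d) = v k" if "k < d" for k
          proof -
            have "\<sigma> k < n" using \<sigma>I[OF that] I by blast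
            moreover have "\<tau> w (\<sigma> k) = w k"
              using tw \<sigma>I[OF that] \<kappa>\<sigma>[OF that] unfolding agree_def lift_def by auto
            ultimately show ?thesis using v1[OF that] v2 by simp
          qed
          ultimately show "?P v" by blast
        next
          assume P: "?P v"
          let ?w = "restrict v {..<d}" and ?z = "restrict (\<lambda>i. v (i + d)) {..<n}"
          have wU: "?w \<in> U"
            using P unfolding U_def mem_box_inside inside_restrict by simp
          have "?z \<in> V" unfolding V inside_restrict using P by simp
          moreover have "coord_proj d \<sigma> ?z = ?w"
            unfolding coord_proj_def using P \<sigma>I I by (auto simp: fun_eq_iff)
          ultimately have "\<tau> ?w = ?z" using \<tau>_eq[OF wU] P by blast
          then have "concat_point d n ?w (\<tau> ?w) = restrict v {..<d + n}"
            by (auto simp: concat_point_def fun_eq_iff)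
          then show "restrict v {..<d + n} \<in> ?\<Gamma>" using imageI[OF wU, of "\<lambda>w. concat_point d n w (\<tau> w)"] by simp
        qed
        ultimately show "definable \<M> (d + n) ?\<Gamma>"
          unfolding definable_iff_def_pred using sub by simp
      qed
      moreover have "continuous_map (subtopology (power_topology d) U) (power_topology n) \<tau>"
      proof -
        have Uop: "openin (power_topology d) U"
          unfolding U_def box_def by (subst openin_PiE_gen) auto
        have Ucart: "U \<subseteq> cart_power d" unfolding subset_iff U cart by blast
        have "openin (power_topology d) {w \<in> U. \<tau> w \<in> S}" if S: "openin (power_topology n) S" for S
          unfolding openin_power_iff
        proof (intro conjI ballI)
          show "{w \<in> U. \<tau> w \<in> S} \<subseteq> cart_power d" using Ucart by blast
          fix w assume "w \<in> {w \<in> U. \<tau> w \<in> S}"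
          then have w: "w \<in> U" "\<tau> w \<in> S" by auto
          then obtain a2 b2 where 2: "\<tau> w \<in> box {..<n} a2 b2" "box {..<n} a2 b2 \<subseteq> S"
            using S unfolding openin_power_iff by meson
          have zC: "\<tau> w \<in> C" using tU w(1) by blast
          then have "normal_point n X I (\<tau> w)"
            using normal_interior_fibre CX agree_refl unfolding normal_fibre_def by metis
          \<comment> \<open>The small sheet at \<open>\<tau> w\<close> is sought inside
            \<open>V\<close> as well as inside the given neighbourhood, so that its points are
            values of \<open>\<tau>\<close> by \<open>\<tau>_eq\<close>.\<close>
          moreover have "inside {..<n} (\<lambda>i. max (a2 i) (c i)) (\<lambda>i. min (b2 i) (e i)) (\<tau> w)"
            using 2(1) \<tau>(2)[OF w(1)] unfolding V mem_box_inside inside_def by simp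
          ultimately obtain a3 b3 where 3: "inside {..<n} a3 b3 (\<tau> w)" "sheet n X I a3 b3"
              "subbox {..<n} (\<lambda>i. max (a2 i) (c i)) (\<lambda>i. min (b2 i) (e i)) a3 b3"
            unfolding normal_point_def by blast
          have in3: "inside {..<n} a2 b2 z \<and> inside {..<n} c e z" if "inside {..<n} a3 b3 z" for z
            using that 3(3) unfolding inside_def subbox_def by (auto intro: le_less_trans less_le_trans)
          have tw: "agree I (\<tau> w) (lift w)" using proj_iff \<tau>(3)[OF w(1)] w(1) unfolding U by blast
          have "inside I a3 b3 (\<tau> w)" using 3(1) I unfolding inside_def by blast
          then have "w \<in> box {..<d} (\<lambda>k. a3 (\<sigma> k)) (\<lambda>k. b3 (\<sigma> k))"
            unfolding mem_box_inside inside_lift using w(1) inside_agree[OF tw] U by blast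
          moreover have "w' \<in> {w \<in> U. \<tau> w \<in> S}" if w': "w' \<in> box {..<d} (\<lambda>k. a3 (\<sigma> k)) (\<lambda>k. b3 (\<sigma> k))" for w'
          proof -
            have w'e: "w' \<in> extensional {..<d}" "inside I a3 b3 (lift w')"
              using w' unfolding mem_box_inside inside_lift by auto
            then obtain z where z: "restrict z {..<n} \<in> X" "inside {..<n} a3 b3 z" "agree I z (lift w')"
              using 3(2) unfolding sheet_def by blast
            let ?z = "restrict z {..<n}"
            have zV: "?z \<in> V" unfolding V inside_restrict using in3[OF z(2)] by simp
            have pz: "coord_proj d \<sigma> ?z = w'"
              using proj_iff[OF w'e(1)] agree_trans[OF agree_restrict[OF I] z(3)] by blast
            then have w'U: "w' \<in> U" using V_proj[OF zV] by simp
            moreover have "?z \<in> box {..<n} a2 b2"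
              unfolding mem_box_inside inside_restrict using in3[OF z(2)] by simp
            ultimately show ?thesis using \<tau>_eq[OF w'U z(1) zV pz] 2(2) by auto
          qed
          ultimately show "\<exists>a b. w \<in> box {..<d} a b \<and> box {..<d} a b \<subseteq> {w \<in> U. \<tau> w \<in> S}" by blast
        qed
        moreover have "topspace (subtopology (power_topology d) U) = U"
          using Ucart by auto
        moreover have "\<tau> ` U \<subseteq> topspace (power_topology n)"
          using \<tau>(1) definable_subset[OF X] by auto
        ultimately show ?thesis
          unfolding continuous_map_def openin_open_subtopology[OF Uop] by auto
      qed
      ultimately show ?thesis using Vo yV pV tU \<tau>(3) by blast
    qed
    moreover have "x \<in> U" unfolding U using x'(1) abx by blast
    ultimately show ?thesis using Uo by blast
  qed
  then have "proj_quasi_special \<M> n d \<sigma> C"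
    unfolding proj_quasi_special_def using dC dbase obase by blast
  moreover have "coord_selection n d \<sigma>"
    unfolding coord_selection_def using mono img I by simp
  ultimately show ?thesis unfolding quasi_special_def C_def by blast
qed

text \<open>The family is closed under adding coordinates, and a minimal \<open>I\<close> is treated
  last. Its enlargements by one coordinate all lie in the smaller family, so the remainder
  \<open>R\<close> left by that family satisfies the dimension hypothesis for \<open>I\<close>.
  Later remainders are smaller, so what they fail to cover stays uncovered.\<close>

lemma partial_decomposition:
  assumes Z: "definable \<M> n Z" and "finite \<I>" "\<I> \<subseteq> Pow {..<n}"
    and "\<forall>I\<in>\<I>. \<forall>j\<in>{..<n} - I. insert j I \<in> \<I>"
  shows "\<exists>C. (\<forall>I\<in>\<I>. quasi_special \<M> n (C I) \<and> C I \<subseteq> Z) \<and>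
    (\<forall>I\<in>\<I>. \<forall>J\<in>\<I>. I \<noteq> J \<longrightarrow> C I \<inter> C J = {}) \<and>
    definable \<M> n (Z - (\<Union>I\<in>\<I>. C I)) \<and> (\<forall>I\<in>\<I>. \<not> covers_box n (Z - (\<Union>I\<in>\<I>. C I)) I)"
  using assms(2-)
proof (induction "card \<I>" arbitrary: \<I>)
  case 0
  then show ?case using Z by simp
next
  case (Suc k)
  then have "\<I> \<noteq> {}" by auto
  then obtain I where I: "I \<in> \<I>" "\<And>J. J \<in> \<I> \<Longrightarrow> J \<subseteq> I \<Longrightarrow> J = I"
    using finite_has_minimal[OF Suc.prems(1)] by blast
  let ?\<I> = "\<I> - {I}"
  have k: "k = card ?\<I>" using Suc.hyps(2) I(1) Suc.prems(1) by simp
  have up: "\<forall>J\<in>?\<I>. \<forall>j\<in>{..<n} - J. insert j J \<in> ?\<I>"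
  proof (intro ballI)
    fix J j assume J: "J \<in> ?\<I>" "j \<in> {..<n} - J"
    then have "insert j J \<in> \<I>" using Suc.prems(3) by blast
    moreover have "insert j J \<noteq> I" using J I(2)[of J] by blast
    ultimately show "insert j J \<in> ?\<I>" by blast
  qed
  have "finite ?\<I>" "?\<I> \<subseteq> Pow {..<n}" using Suc.prems(1,2) by auto
  from Suc.hyps(1)[OF k this up]
  obtain C where C: "\<forall>J\<in>?\<I>. quasi_special \<M> n (C J) \<and> C J \<subseteq> Z"
      "\<forall>J\<in>?\<I>. \<forall>K\<in>?\<I>. J \<noteq> K \<longrightarrow> C J \<inter> C K = {}"
      "definable \<M> n (Z - (\<Union>J\<in>?\<I>. C J))"
      "\<forall>J\<in>?\<I>. \<not> covers_box n (Z - (\<Union>J\<in>?\<I>. C J)) J"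
    by (elim exE conjE)
  define R where "R = Z - (\<Union>J\<in>?\<I>. C J)"
  have dRR: "definable \<M> n R" and RZ: "R \<subseteq> Z" using C(3) unfolding R_def by auto
  define D where "D = C(I := normal_part n R I)"
  have In: "I \<subseteq> {..<n}" using I(1) Suc.prems(2) by blast
  have sub: "normal_part n R I \<subseteq> R" unfolding normal_part_def by blast
  have "\<not> covers_box n R (insert j I)" if j: "j \<in> {..<n} - I" for j
  proof -
    have "insert j I \<in> ?\<I>" using Suc.prems(3) I(1) j by blast
    then show ?thesis using C(4) unfolding R_def by blast
  qed
  then have rem: "\<not> covers_box n (R - normal_part n R I) I"
    using normal_part_remainder[OF _ In] C(3) unfolding R_def by blast
  have DJ: "D J = C J" if "J \<in> ?\<I>" for J using that unfolding D_def by auto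
  have DI: "D I = normal_part n R I" unfolding D_def by simp
  have "(\<Union>J\<in>\<I>. D J) = normal_part n R I \<union> (\<Union>J\<in>?\<I>. C J)"
    using I(1) unfolding D_def by auto
  then have eq: "Z - (\<Union>J\<in>\<I>. D J) = R - normal_part n R I" unfolding R_def by blast
  have qs: "quasi_special \<M> n (D J) \<and> D J \<subseteq> Z" if "J \<in> \<I>" for J
  proof -
    show "quasi_special \<M> n (D J) \<and> D J \<subseteq> Z"
    proof (cases "J = I")
      case True
      then show ?thesis
        using normal_part_quasi_special[OF dRR In] sub RZ by (simp only: DI) blast
    next
      case False
      then show ?thesis using C(1)[THEN bspec, of J] DJ[of J] \<open>J \<in> \<I>\<close> by simp
    qed
  qed
  have disj: "C J \<inter> normal_part n R I = {}" if "J \<in> ?\<I>" for J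
    using sub that unfolding R_def by blast
  have dd: "D J \<inter> D K = {}" if JK: "J \<in> \<I>" "K \<in> \<I>" "J \<noteq> K" for J K
  proof -
    consider "J = I" "K \<in> ?\<I>" | "K = I" "J \<in> ?\<I>" | "J \<in> ?\<I>" "K \<in> ?\<I>" using JK by blast
    then show ?thesis
    proof cases
      case 1
      then show ?thesis using disj DI DJ by auto
    next
      case 2
      then show ?thesis using disj DI DJ by auto
    next
      case 3
      then show ?thesis using C(2)[THEN bspec, THEN bspec, of J K] JK(3) DJ by simp
    qed
  qed
  have dR: "definable \<M> n (R - normal_part n R I)"
    by (rule definable_Diff) (use C(3) definable_normal_part[OF _ In] in \<open>auto simp: R_def\<close>)
  have nc: "\<not> covers_box n (R - normal_part n R I) J" if "J \<in> \<I>" for J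
  proof (cases "J = I")
    case True
    then show ?thesis using rem by simp
  next
    case False
    then show ?thesis using C(4)[THEN bspec, of J] covers_box_mono[of n "R - normal_part n R I" J R] that
      unfolding R_def by blast
  qed
  show ?case
    by (rule exI[of _ D], unfold eq, intro conjI ballI impI)
      (use qs dd dR nc in blast)+
qed

text \<open>Among all sets \<open>I\<close> is the empty one, and a remainder that covers no box in
  dimension zero has no points.\<close>

lemma decomposition:
  assumes Z: "definable \<M> n Z"
  obtains C where "\<And>I. I \<subseteq> {..<n} \<Longrightarrow> quasi_special \<M> n (C I)"
    "\<And>I J. I \<subseteq> {..<n} \<Longrightarrow> J \<subseteq> {..<n} \<Longrightarrow> I \<noteq> J \<Longrightarrow> C I \<inter> C J = {}"
    "(\<Union>I\<in>Pow {..<n}. C I) = Z"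
proof -
  obtain C where C: "\<forall>I\<in>Pow {..<n}. quasi_special \<M> n (C I) \<and> C I \<subseteq> Z"
    "\<forall>I\<in>Pow {..<n}. \<forall>J\<in>Pow {..<n}. I \<noteq> J \<longrightarrow> C I \<inter> C J = {}"
    "definable \<M> n (Z - (\<Union>I\<in>Pow {..<n}. C I))"
    "\<forall>I\<in>Pow {..<n}. \<not> covers_box n (Z - (\<Union>I\<in>Pow {..<n}. C I)) I"
    using partial_decomposition[OF Z, of "Pow {..<n}"] by auto
  have "Z - (\<Union>I\<in>Pow {..<n}. C I) = {}"
  proof (rule ccontr)
    assume "Z - (\<Union>I\<in>Pow {..<n}. C I) \<noteq> {}"
    then obtain z where z: "z \<in> Z - (\<Union>I\<in>Pow {..<n}. C I)" by blast
    then have "restrict z {..<n} \<in> Z - (\<Union>I\<in>Pow {..<n}. C I)"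
      using definable_restrict[OF C(3) z] by simp
    then have "covers_box n (Z - (\<Union>I\<in>Pow {..<n}. C I)) {}"
      unfolding covers_box_def agree_def by blast
    then show False using C(4) by blast
  qed
  then have Z_eq: "(\<Union>I\<in>Pow {..<n}. C I) = Z" using C(1) by blast
  show thesis
  proof (rule that[OF _ _ Z_eq])
    show "quasi_special \<M> n (C I)" if "I \<subseteq> {..<n}" for I
      using C(1) that by simp
    show "C I \<inter> C J = {}" if "I \<subseteq> {..<n}" "J \<subseteq> {..<n}" "I \<noteq> J" for I J
      using C(2) that by simp
  qed
qed

end

section \<open>Atoms of the given family and the number of pieces\<close>

lemma definable_atom:
  fixes X :: "nat \<Rightarrow> (nat \<Rightarrow> 'a::linorder) set"
  assumes "\<And>i. i \<in> {1..m} \<Longrightarrow> definable \<M> n (X i)"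
  shows "definable \<M> n {x \<in> cart_power n. \<forall>j\<in>{1..m}. x \<in> X j \<longleftrightarrow> j \<in> A}"
proof -
  have "def_pred \<M> (\<lambda>e. \<forall>j\<in>{1..m}. restrict e {..<n} \<in> X j \<longleftrightarrow> j \<in> A)"
    by (intro def_pred_ball_fin def_pred_iff def_pred_const
        def_pred_mem[OF assms] accessor_var finite_atLeastAtMost)
  then show ?thesis unfolding definable_iff_def_pred by auto
qed

theorem theorem4p4:
  fixes \<M> :: "('a::{unbounded_dense_linorder, linorder_topology}, 'f, 'r) fo_structure"
    and n m :: nat
    and X :: "nat \<Rightarrow> (nat \<Rightarrow> 'a) set"
  assumes "locally_o_minimal \<M>"
    and "definably_complete \<M>"
    and "property_a \<M>"
    and "\<And>i. i \<in> {1..m} \<Longrightarrow> definable \<M> n (X i)"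
  shows "\<exists>N C. quasi_special_decomposition \<M> n m X N C \<and> N \<le> 2 ^ (m + n)"
proof -
  interpret tame \<M> using assms(1-3) by unfold_locales
  define atom where "atom A = {x \<in> cart_power n. \<forall>j\<in>{1..m}. x \<in> X j \<longleftrightarrow> j \<in> A}" for A
  have "\<forall>A. \<exists>C. (\<forall>I. I \<subseteq> {..<n} \<longrightarrow> quasi_special \<M> n (C I)) \<and>
      (\<forall>I J. I \<subseteq> {..<n} \<longrightarrow> J \<subseteq> {..<n} \<longrightarrow> I \<noteq> J \<longrightarrow> C I \<inter> C J = {}) \<and>
      (\<Union>I\<in>Pow {..<n}. C I) = atom A" (is "\<forall>A. ?P A")
  proof
    fix A
    have "definable \<M> n (atom A)" unfolding atom_def using definable_atom assms(4) by blast
    then show "?P A"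
      by (rule decomposition) blast
  qed
  then obtain C where C: "\<And>A I. I \<subseteq> {..<n} \<Longrightarrow> quasi_special \<M> n (C A I)"
      "\<And>A I J. I \<subseteq> {..<n} \<Longrightarrow> J \<subseteq> {..<n} \<Longrightarrow> I \<noteq> J \<Longrightarrow> C A I \<inter> C A J = {}"
      "\<And>A. (\<Union>I\<in>Pow {..<n}. C A I) = atom A"
    by metis
  \<comment> \<open>All pairs of a set of indices and a set of coordinates are numbered, including
    those whose piece is empty; this gives the bound exactly.\<close>
  define N :: nat where "N = 2 ^ (m + n)"
  let ?K = "Pow {1..m} \<times> Pow {..<n}"
  have "card ?K = N" by (simp add: N_def card_cartesian_product card_Pow power_add)
  moreover have "finite ?K" by simp
  ultimately obtain h where h: "bij_betw h {1..N} ?K"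
    using ex_bij_betw_nat_finite_1[of ?K] by metis
  have hK: "fst (h i) \<subseteq> {1..m} \<and> snd (h i) \<subseteq> {..<n}" if "i \<in> {1..N}" for i
    using bij_betwE[OF h] that by (metis PowD mem_Times_iff)
  have sub: "C A I \<subseteq> atom A" if "I \<subseteq> {..<n}" for A I using C(3)[of A] that by blast
  have atom_disj: "A = B" if "A \<subseteq> {1..m}" "B \<subseteq> {1..m}" "x \<in> atom A" "x \<in> atom B" for A B x
    using that unfolding atom_def by blast
  define E where "E i = C (fst (h i)) (snd (h i))" for i
  have "quasi_special_decomposition \<M> n m X N E"
    unfolding quasi_special_decomposition_def
  proof (intro conjI ballI impI)
    fix i assume "i \<in> {1..N}"
    then show "quasi_special \<M> n (E i)" unfolding E_def using C(1) hK by blast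
  next
    show "(\<Union>i\<in>{1..N}. E i) = cart_power n"
    proof (intro equalityI subsetI)
      fix x assume "x \<in> (\<Union>i\<in>{1..N}. E i)"
      then obtain i where i: "i \<in> {1..N}" "x \<in> E i" by blast
      then have "x \<in> atom (fst (h i))" unfolding E_def using sub hK by blast
      then show "x \<in> cart_power n" unfolding atom_def by blast
    next
      fix x :: "nat \<Rightarrow> 'a" assume x: "x \<in> cart_power n"
      let ?A = "{j \<in> {1..m}. x \<in> X j}"
      have "x \<in> atom ?A" unfolding atom_def using x by blast
      then obtain I where I: "I \<in> Pow {..<n}" "x \<in> C ?A I" unfolding C(3)[symmetric] by blast
      have "(?A, I) \<in> ?K" using I(1) by blast
      then have "(?A, I) \<in> h ` {1..N}" using h unfolding bij_betw_def by simp
      then obtain i where i: "(?A, I) = h i" "i \<in> {1..N}" by (rule imageE)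
      have "x \<in> E i" unfolding E_def using I(2) by (simp flip: i(1))
      then show "x \<in> (\<Union>i\<in>{1..N}. E i)" using i(2) by blast
    qed
  next
    fix i j assume ij: "i \<in> {1..N}" "j \<in> {1..N}" "i \<noteq> j"
    then have ne: "h i \<noteq> h j" using h unfolding bij_betw_def inj_on_def by blast
    show "E i \<inter> E j = {}"
    proof (cases "fst (h i) = fst (h j)")
      case True
      then have "snd (h i) \<noteq> snd (h j)" using ne prod_eqI by blast
      then show ?thesis unfolding E_def True using C(2) hK ij by blast
    next
      case False
      have "x \<notin> E j" if "x \<in> E i" for x
      proof
        assume "x \<in> E j"
        then have "x \<in> atom (fst (h i))" "x \<in> atom (fst (h j))"
          using that sub hK ij unfolding E_def by blast+
        then show False using atom_disj hK ij False by blast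
      qed
      then show ?thesis by blast
    qed
  next
    fix i j assume ij: "i \<in> {1..N}" "j \<in> {1..m}"
    have "E i \<subseteq> atom (fst (h i))" unfolding E_def using sub hK ij by blast
    then show "E i \<inter> X j = {} \<or> E i \<subseteq> X j" using ij(2) unfolding atom_def by blast
  qed
  then show ?thesis unfolding N_def by blast
qed

end
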